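(* Let $\mathbf{k}$ be a field and let $d,n\ge 3$ be integers such that $d$ is not a multiple of $\mathrm{char}(\mathbf{k})$ and such that $(d,n)\neq(3,3)$. Then there are two non-isomorphic irreducible hypersurfaces $H,H'\subseteq\mathbb{P}^n_{\mathbf{k}}$ of degree $d$ that have isomorphic complements, i.e. $\mathbb{P}^n_{\mathbf{k}}\setminus H\simeq\mathbb{P}^n_{\mathbf{k}}\setminus H'$.
   Context: An irreducible hypersurface of degree $d$ in $\mathbb{P}^n_{\mathbf{k}}$ is the zero locus $V_{\mathbb{P}^n}(f)$ of an irreducible homogeneous polynomial $f\in\mathbf{k}[x_0,\ldots,x_n]$ of degree $d$ (a closed subscheme). Isomorphisms are isomorphisms of schemes over $\mathbf{k}$. If $\mathrm{char}(\mathbf{k})=0$, the condition that $d$ is not a multiple of $\mathrm{char}(\mathbf{k})$ is automatic. *)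

theory Defs
  imports
    "HOL-Algebra.QuotRing"
    "HOL-Algebra.Ring_Divisibility"
    "HOL-Analysis.Abstract_Topology"
    "HOL-Library.Poly_Mapping"
begin

section \<open>Locally ringed spaces over a field\<close>

text \<open>
  A space with a sheaf of rings and a structure map from the field to the global sections.
  The latter is the same datum as a morphism to the spectrum of the field.
\<close>

record ('p, 's, 'k) ringed_space =
  space :: "'p topology"
  sections :: "'p set \<Rightarrow> 's ring"
  restr :: "'p set \<Rightarrow> 'p set \<Rightarrow> 's \<Rightarrow> 's"
  const :: "'k \<Rightarrow> 's"

definition preimage :: "('p, 's, 'k) ringed_space \<Rightarrow> ('p \<Rightarrow> 'q) \<Rightarrow> 'q set \<Rightarrow> 'p set" where
  "preimage X f V = {x \<in> topspace (space X). f x \<in> V}"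

text \<open>The germ at \<open>x\<close> of a section \<open>s\<close> over \<open>U\<close> is a unit of the stalk at \<open>x\<close>.\<close>

definition germ_unit :: "('p, 's, 'k) ringed_space \<Rightarrow> 'p set \<Rightarrow> 's \<Rightarrow> 'p \<Rightarrow> bool" where
  "germ_unit X U s x \<longleftrightarrow>
     (\<exists>W. openin (space X) W \<and> x \<in> W \<and> W \<subseteq> U \<and> restr X U W s \<in> Units (sections X W))"

text \<open>
  Morphisms of locally ringed spaces over the field: \<open>f\<close> is the map on points and \<open>\<phi> V\<close> is the
  map from the sections over \<open>V\<close> to the sections over the preimage of \<open>V\<close>. The fourth condition
  says that the induced maps on stalks are local homomorphisms.
\<close>

definition morphism ::
  "('p, 's, 'k) ringed_space \<Rightarrow> ('q, 't, 'k) ringed_space \<Rightarrow> ('p \<Rightarrow> 'q) \<Rightarrow> ('q set \<Rightarrow> 't \<Rightarrow> 's) \<Rightarrow> bool"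
  where
  "morphism X Y f \<phi> \<longleftrightarrow>
     continuous_map (space X) (space Y) f \<and>
     (\<forall>V. openin (space Y) V \<longrightarrow>
        \<phi> V \<in> ring_hom (sections Y V) (sections X (preimage X f V))) \<and>
     (\<forall>V W s. openin (space Y) V \<and> openin (space Y) W \<and> W \<subseteq> V \<and> s \<in> carrier (sections Y V) \<longrightarrow>
        \<phi> W (restr Y V W s) = restr X (preimage X f V) (preimage X f W) (\<phi> V s)) \<and>
     (\<forall>V s x. openin (space Y) V \<and> s \<in> carrier (sections Y V) \<and> x \<in> preimage X f V \<and>
        germ_unit X (preimage X f V) (\<phi> V s) x \<longrightarrow> germ_unit Y V s (f x)) \<and>
     (\<forall>c. \<phi> (topspace (space Y)) (const Y c) = const X c)"

definition isomorphic :: "('p, 's, 'k) ringed_space \<Rightarrow> ('q, 't, 'k) ringed_space \<Rightarrow> bool" where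
  "isomorphic X Y \<longleftrightarrow>
     (\<exists>f \<phi> g \<psi>. morphism X Y f \<phi> \<and> morphism Y X g \<psi> \<and>
        (\<forall>x \<in> topspace (space X). g (f x) = x) \<and>
        (\<forall>y \<in> topspace (space Y). f (g y) = y) \<and>
        (\<forall>V s. openin (space Y) V \<and> s \<in> carrier (sections Y V) \<longrightarrow>
           \<psi> (preimage X f V) (\<phi> V s) = s) \<and>
        (\<forall>U s. openin (space X) U \<and> s \<in> carrier (sections X U) \<longrightarrow>
           \<phi> (preimage Y g U) (\<psi> U s) = s))"

definition open_subspace :: "('p, 's, 'k) ringed_space \<Rightarrow> 'p set \<Rightarrow> ('p, 's, 'k) ringed_space" where
  "open_subspace X U =
     \<lparr>space = subtopology (space X) U,
      sections = sections X,
      restr = restr X,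
      const = (\<lambda>c. restr X (topspace (space X)) U (const X c))\<rparr>"


section \<open>Proj of a graded algebra\<close>

text \<open>Here \<open>piece S e\<close> is the homogeneous part of degree \<open>e\<close>.\<close>

record ('a, 'k) graded_algebra = "'a ring" +
  piece :: "nat \<Rightarrow> 'a set"
  scalar :: "'k \<Rightarrow> 'a"

definition homogeneous_elems :: "('a, 'k) graded_algebra \<Rightarrow> 'a set" where
  "homogeneous_elems S = (\<Union>e. piece S e)"

definition irrelevant_ideal :: "('a, 'k) graded_algebra \<Rightarrow> 'a set" where
  "irrelevant_ideal S = Idl\<^bsub>S\<^esub> (\<Union>e \<in> {0<..}. piece S e)"

definition proj_points :: "('a, 'k) graded_algebra \<Rightarrow> 'a set set" where
  "proj_points S =
     {P. primeideal P S \<and> P = Idl\<^bsub>S\<^esub> (P \<inter> homogeneous_elems S) \<and> \<not> irrelevant_ideal S \<subseteq> P}"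

text \<open>The sets generating the topology are the basic open sets of nonvanishing of a form \<open>h\<close>.\<close>

definition zariski :: "('a, 'k) graded_algebra \<Rightarrow> 'a set topology" where
  "zariski S =
     topology_generated_by ((\<lambda>h. {P \<in> proj_points S. h \<notin> P}) ` homogeneous_elems S)"

text \<open>
  The stalk at \<open>P\<close> is the degree zero part of the localization of \<open>S\<close> at the homogeneous elements
  outside \<open>P\<close>. The fraction \<open>a/s\<close>, with \<open>a\<close> and \<open>s\<close> homogeneous of the same degree, is
  represented by its equivalence class of pairs. The ring operations take unions over
  representatives, and all the classes in such a union coincide.
\<close>

definition hfrac :: "('a, 'k) graded_algebra \<Rightarrow> 'a set \<Rightarrow> 'a \<Rightarrow> 'a \<Rightarrow> ('a \<times> 'a) set" where
  "hfrac S P a s =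
     {(b, t). (\<exists>e. b \<in> piece S e \<and> t \<in> piece S e - P) \<and>
        (\<exists>u \<in> homogeneous_elems S - P.
           u \<otimes>\<^bsub>S\<^esub> (a \<otimes>\<^bsub>S\<^esub> t \<ominus>\<^bsub>S\<^esub> b \<otimes>\<^bsub>S\<^esub> s) = \<zero>\<^bsub>S\<^esub>)}"

definition hloc :: "('a, 'k) graded_algebra \<Rightarrow> 'a set \<Rightarrow> ('a \<times> 'a) set ring" where
  "hloc S P =
     \<lparr>carrier = {hfrac S P a s | a s e. a \<in> piece S e \<and> s \<in> piece S e - P},
      mult = (\<lambda>X Y. \<Union>(a, s) \<in> X. \<Union>(b, t) \<in> Y. hfrac S P (a \<otimes>\<^bsub>S\<^esub> b) (s \<otimes>\<^bsub>S\<^esub> t)),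
      one = hfrac S P \<one>\<^bsub>S\<^esub> \<one>\<^bsub>S\<^esub>,
      zero = hfrac S P \<zero>\<^bsub>S\<^esub> \<one>\<^bsub>S\<^esub>,
      add = (\<lambda>X Y. \<Union>(a, s) \<in> X. \<Union>(b, t) \<in> Y.
               hfrac S P (a \<otimes>\<^bsub>S\<^esub> t \<oplus>\<^bsub>S\<^esub> b \<otimes>\<^bsub>S\<^esub> s) (s \<otimes>\<^bsub>S\<^esub> t))\<rparr>"

definition proj_sections ::
  "('a, 'k) graded_algebra \<Rightarrow> 'a set set \<Rightarrow> ('a set \<Rightarrow> ('a \<times> 'a) set) ring" where
  "proj_sections S U =
     \<lparr>carrier = {\<sigma> \<in> \<Pi>\<^sub>E P \<in> U. carrier (hloc S P).
        \<forall>P \<in> U. \<exists>W. openin (zariski S) W \<and> P \<in> W \<and> W \<subseteq> U \<and>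
          (\<exists>e. \<exists>a \<in> piece S e. \<exists>s \<in> piece S e. \<forall>Q \<in> W. s \<notin> Q \<and> \<sigma> Q = hfrac S Q a s)},
      mult = (\<lambda>\<sigma> \<tau>. \<lambda>P \<in> U. \<sigma> P \<otimes>\<^bsub>hloc S P\<^esub> \<tau> P),
      one = (\<lambda>P \<in> U. \<one>\<^bsub>hloc S P\<^esub>),
      zero = (\<lambda>P \<in> U. \<zero>\<^bsub>hloc S P\<^esub>),
      add = (\<lambda>\<sigma> \<tau>. \<lambda>P \<in> U. \<sigma> P \<oplus>\<^bsub>hloc S P\<^esub> \<tau> P)\<rparr>"

definition Proj ::
  "('a, 'k) graded_algebra \<Rightarrow> ('a set, 'a set \<Rightarrow> ('a \<times> 'a) set, 'k) ringed_space" where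
  "Proj S =
     \<lparr>space = zariski S,
      sections = proj_sections S,
      restr = (\<lambda>U V \<sigma>. restrict \<sigma> V),
      const = (\<lambda>c. \<lambda>P \<in> proj_points S. hfrac S P (scalar S c) \<one>\<^bsub>S\<^esub>)\<rparr>"

definition graded_quotient :: "('a, 'k) graded_algebra \<Rightarrow> 'a set \<Rightarrow> ('a set, 'k) graded_algebra" where
  "graded_quotient S I =
     ring.extend (S Quot I)
       (graded_algebra.fields (\<lambda>e. (\<lambda>a. I +>\<^bsub>S\<^esub> a) ` piece S e) (\<lambda>c. I +>\<^bsub>S\<^esub> scalar S c))"


section \<open>Hypersurfaces in projective space\<close>

text \<open>
  A monomial \<open>m\<close> has exponent \<open>lookup m i\<close> at the \<open>i\<close>-th variable. The polynomial ring
  in \<open>x\<^sub>0, \<dots>, x\<^sub>n\<close> consists of the polynomials in which only these variables occur.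
\<close>

type_synonym 'k mpoly = "(nat \<Rightarrow>\<^sub>0 nat) \<Rightarrow>\<^sub>0 'k"

definition monom_degree :: "(nat \<Rightarrow>\<^sub>0 nat) \<Rightarrow> nat" where
  "monom_degree m = (\<Sum>i \<in> Poly_Mapping.keys m. Poly_Mapping.lookup m i)"

definition polys :: "nat \<Rightarrow> 'k::zero mpoly set" where
  "polys n = {p. \<forall>m \<in> Poly_Mapping.keys p. Poly_Mapping.keys m \<subseteq> {..n}}"

definition forms :: "nat \<Rightarrow> nat \<Rightarrow> 'k::zero mpoly set" where
  "forms n e = {p \<in> polys n. \<forall>m \<in> Poly_Mapping.keys p. monom_degree m = e}"

definition poly_alg :: "nat \<Rightarrow> ('k::field mpoly, 'k) graded_algebra" where
  "poly_alg n =
     \<lparr>carrier = polys n, mult = (*), one = 1, zero = 0, add = (+),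
      piece = forms n, scalar = Poly_Mapping.single 0\<rparr>"

abbreviation projective_space ::
  "nat \<Rightarrow> ('k::field mpoly set, 'k mpoly set \<Rightarrow> ('k mpoly \<times> 'k mpoly) set, 'k) ringed_space" where
  "projective_space n \<equiv> Proj (poly_alg n)"

definition irreducible_form :: "nat \<Rightarrow> nat \<Rightarrow> 'k::field mpoly \<Rightarrow> bool" where
  "irreducible_form n d f \<longleftrightarrow> f \<in> forms n d \<and> ring_irreducible\<^bsub>poly_alg n\<^esub> f"

text \<open>
  The closed subscheme of projective space cut out by the form \<open>f\<close>, as Proj of the homogeneous
  coordinate ring. Its points correspond to those \<open>P\<close> in projective space with \<open>f \<in> P\<close>,
  so these are removed for the complement.
\<close>

definition hypersurface ::
  "nat \<Rightarrow> 'k::field mpoly \<Rightarrow>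
    ('k mpoly set set, 'k mpoly set set \<Rightarrow> ('k mpoly set \<times> 'k mpoly set) set, 'k) ringed_space"
  where
  "hypersurface n f = Proj (graded_quotient (poly_alg n) (PIdl\<^bsub>poly_alg n\<^esub> f))"

definition hypersurface_complement ::
  "nat \<Rightarrow> 'k::field mpoly \<Rightarrow>
    ('k mpoly set, 'k mpoly set \<Rightarrow> ('k mpoly \<times> 'k mpoly) set, 'k) ringed_space"
  where
  "hypersurface_complement n f =
     open_subspace (projective_space n) (proj_points (poly_alg n) - {P. f \<in> P})"

end

theory Submission
  imports Defs "HOL-Computational_Algebra.Polynomial"
begin

text \<open>
  Consider \<open>f0 = x^(k+1) y + w^(k+1) (\<alpha> z + \<beta> w)\<close> and \<open>f1 = f0 + C q\<close>, where \<open>C = x^k v^c\<close>, \<open>q\<close> is a form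
  in \<open>z\<close>, \<open>w\<close> of degree \<open>e\<close>, and \<open>d = k + 2 = k + c + e\<close>. Where the equation \<open>F\<close> is invertible, two
  shears in the \<open>z,w\<close>-plane with coefficient \<open>C / F\<close> compose to an automorphism that is the identity
  modulo \<open>C\<close> and changes \<open>F\<close> only by a first order term, because \<open>C\<^sup>2\<close> is divisible by \<open>x^(k+1)\<close>. For
  suitable \<open>q\<close> this term cancels \<open>C q\<close>; what remains is divisible by \<open>x^(k+1)\<close> and is absorbed into \<open>y\<close>.
  Clearing denominators by powers of \<open>F\<close> gives maps between the complements that are inverse to each other.

  The hypersurfaces differ in their local rings at rational points. At a coordinate point, \<open>f1 = 0\<close>
  reads \<open>u^r v = w^(r+2) g\<close> with \<open>r = max 1 (k - 1)\<close> and nonunits \<open>u\<close>, \<open>v\<close> whose linear parts do not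
  vanish (and are independent if \<open>d = 3\<close>). On \<open>f0 = 0\<close> no rational point has such a relation, as one sees
  by comparing leading terms: either \<open>f0\<close> is locally a graph, so that the tangent space is that of an
  affine space, or \<open>f0\<close> vanishes to order \<open>r + 2\<close>, or \<open>d = 3\<close> and its tangent cone is a double plane.
\<close>

section \<open>Substitution into polynomials\<close>

text \<open>A single shear of w by a multiple of z^(e+1) does not preserve w = 0, so it changes p0 =
  w^(k+1) (\<alpha> z + \<beta> w) by a term that p0 need not divide. Composing it with a shear in
  the direction (-1,1) by a power of z + w displaces w, to first order, by a multiple of (z +
  w)^(e+1) - z^(e+1), which w divides. The condition on q is then a chain rule: the derivative of p0
  along the displacement is p0 q. For \<alpha> = 0, \<beta> = 1 it holds with q = d ((z + w)^(e+1) -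
  z^(e+1)) / w, whose factor d explains the hypothesis on the characteristic. If d \<ge> 4, the
  invariant needs the coefficient of z^2 in q, here 3 d, to be nonzero; so characteristic 3 gets its
  own p0, with \<alpha> = 1, \<beta> = -1, where z - w divides the derivative only thanks to 3 = 0.
  If d = 3, then k = 1, and with c = 0 the coordinate point that serves for d \<ge> 4 would be a
  regular point of f1 = 0. The factor v cures this: it moves the point to the v-axis, where q
  vanishes. That costs a fifth variable, which is why (d,n) = (3,3) is excluded.\<close>

definition var :: "nat \<Rightarrow> 'k::comm_ring_1 mpoly" where
  "var i = Poly_Mapping.single (Poly_Mapping.single i 1) 1"

abbreviation cst :: "'k::zero \<Rightarrow> 'k mpoly" where
  "cst c \<equiv> Poly_Mapping.single 0 c"

definition monom_eval :: "(nat \<Rightarrow> 'b::comm_semiring_1) \<Rightarrow> (nat \<Rightarrow>\<^sub>0 nat) \<Rightarrow> 'b" where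
  "monom_eval g m = (\<Prod>i \<in> Poly_Mapping.keys m. g i ^ Poly_Mapping.lookup m i)"

text \<open>Coefficients are mapped by a separate function \<open>h\<close>, so that one operation
  covers evaluation in the field (\<open>id\<close>), substitution of polynomials
  (\<open>cst\<close>) and expansion in a formal parameter (constant polynomials over
  \<open>cst\<close>).\<close>

definition subst :: "('k::zero \<Rightarrow> 'b::comm_semiring_1) \<Rightarrow> (nat \<Rightarrow> 'b) \<Rightarrow> 'k mpoly \<Rightarrow> 'b" where
  "subst h g p = (\<Sum>m \<in> Poly_Mapping.keys p. h (Poly_Mapping.lookup p m) * monom_eval g m)"

lemma monom_eval_superset:
  assumes "finite A" "Poly_Mapping.keys m \<subseteq> A"
  shows "monom_eval g m = (\<Prod>i \<in> A. g i ^ Poly_Mapping.lookup m i)"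
  unfolding monom_eval_def using assms
  by (intro prod.mono_neutral_left) (auto simp: in_keys_iff)

lemma monom_eval_0 [simp]: "monom_eval g 0 = 1"
  by (simp add: monom_eval_def)

lemma monom_eval_add: "monom_eval g (m + m') = monom_eval g m * monom_eval g m'"
proof -
  let ?A = "Poly_Mapping.keys m \<union> Poly_Mapping.keys m'"
  have "Poly_Mapping.keys (m + m') \<subseteq> ?A"
    by (rule keys_add)
  then show ?thesis
    by (simp add: monom_eval_superset[of ?A] lookup_add power_add prod.distrib)
qed

lemma monom_eval_single [simp]: "monom_eval g (Poly_Mapping.single i e) = g i ^ e"
  by (cases "e = 0") (simp_all add: monom_eval_def)

lemma monom_eval_scale:
  "monom_eval (\<lambda>i. s * g i) m = s ^ monom_degree m * monom_eval g m"
  by (simp add: monom_eval_def monom_degree_def power_mult_distrib prod.distrib power_sum)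

lemma monom_degree_add: "monom_degree (m + m') = monom_degree m + monom_degree m'"
proof -
  have superset: "monom_degree p = (\<Sum>i \<in> A. Poly_Mapping.lookup p i)"
    if "finite A" "Poly_Mapping.keys p \<subseteq> A" for A p
    unfolding monom_degree_def using that by (intro sum.mono_neutral_left) (auto simp: in_keys_iff)
  let ?A = "Poly_Mapping.keys m \<union> Poly_Mapping.keys m'"
  have "Poly_Mapping.keys (m + m') \<subseteq> ?A"
    by (rule keys_add)
  then show ?thesis
    by (simp add: superset[of ?A] lookup_add sum.distrib)
qed

lemma monom_degree_single [simp]: "monom_degree (Poly_Mapping.single i e) = e"
  by (cases "e = 0") (simp_all add: monom_degree_def)

lemma monom_degree_0 [simp]: "monom_degree 0 = 0"
  by (simp add: monom_degree_def)

lemma keys_add_nat: "Poly_Mapping.keys (m + m' :: nat \<Rightarrow>\<^sub>0 nat) = Poly_Mapping.keys m \<union> Poly_Mapping.keys m'"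
  by (auto simp: in_keys_iff lookup_add)

lemma mpoly_expansion:
  "p = (\<Sum>m \<in> Poly_Mapping.keys p. Poly_Mapping.single m (Poly_Mapping.lookup p m))"
proof (rule poly_mapping_eqI)
  fix m
  have "(\<Sum>m' \<in> Poly_Mapping.keys p. Poly_Mapping.lookup (Poly_Mapping.single m' (Poly_Mapping.lookup p m')) m) =
        (\<Sum>m' \<in> Poly_Mapping.keys p. if m' = m then Poly_Mapping.lookup p m else 0)"
    by (intro sum.cong) (auto simp: lookup_single)
  then show "Poly_Mapping.lookup p m =
      Poly_Mapping.lookup (\<Sum>m \<in> Poly_Mapping.keys p. Poly_Mapping.single m (Poly_Mapping.lookup p m)) m"
    by (simp add: lookup_sum in_keys_iff)
qed

lemma mpoly_terms_induct:
  fixes p :: "'a \<Rightarrow>\<^sub>0 'b::comm_monoid_add"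
  assumes "P 0" "\<And>m c. m \<in> Poly_Mapping.keys p \<Longrightarrow> P (Poly_Mapping.single m c)"
    "\<And>p q. P p \<Longrightarrow> P q \<Longrightarrow> P (p + q)"
  shows "P p"
proof -
  have "P (\<Sum>m \<in> A. Poly_Mapping.single m (Poly_Mapping.lookup p m))"
    if "finite A" "A \<subseteq> Poly_Mapping.keys p" for A
    using that by (induction A rule: finite_induct) (use assms in auto)
  then show ?thesis
    by (metis mpoly_expansion finite_keys subset_refl)
qed

locale coeff_hom =
  fixes h :: "'k::comm_ring_1 \<Rightarrow> 'b::comm_ring_1"
  assumes h_0 [simp]: "h 0 = 0" and h_1 [simp]: "h 1 = 1"
    and h_add: "h (a + b) = h a + h b" and h_mult: "h (a * b) = h a * h b"
begin

lemma subst_superset: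
  assumes "finite A" "Poly_Mapping.keys p \<subseteq> A"
  shows "subst h g p = (\<Sum>m \<in> A. h (Poly_Mapping.lookup p m) * monom_eval g m)"
  unfolding subst_def using assms
  by (intro sum.mono_neutral_left) (auto simp: in_keys_iff)

lemma subst_0 [simp]: "subst h g 0 = 0"
  by (simp add: subst_def)

lemma subst_add [simp]: "subst h g (p + q) = subst h g p + subst h g q"
proof -
  let ?A = "Poly_Mapping.keys p \<union> Poly_Mapping.keys q"
  have "Poly_Mapping.keys (p + q) \<subseteq> ?A"
    by (rule keys_add)
  then show ?thesis
    by (simp add: subst_superset[of ?A] lookup_add h_add sum.distrib distrib_right)
qed

lemma subst_single [simp]: "subst h g (Poly_Mapping.single m c) = h c * monom_eval g m"
  by (cases "c = 0") (simp_all add: subst_def)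

lemma subst_1 [simp]: "subst h g 1 = 1"
  using subst_single[of g 0 1] by simp

lemma subst_mult [simp]: "subst h g (p * q) = subst h g p * subst h g q"
proof (induction p rule: mpoly_terms_induct)
  case (2 m c)
  show ?case
    by (induction q rule: mpoly_terms_induct)
      (simp_all add: mult_single monom_eval_add h_mult algebra_simps)
qed (simp_all add: algebra_simps)

lemma subst_uminus [simp]: "subst h g (- p) = - subst h g p"
  using subst_add[of g p "- p"] by (simp add: eq_neg_iff_add_eq_0 add.commute)

lemma subst_diff [simp]: "subst h g (p - q) = subst h g p - subst h g q"
  using subst_add[of g p "- q"] by simp

lemma subst_power [simp]: "subst h g (p ^ r) = subst h g p ^ r"
  by (induction r) simp_all

lemma subst_sum: "subst h g (sum F A) = (\<Sum>x\<in>A. subst h g (F x))"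
  by (induction A rule: infinite_finite_induct) simp_all

lemma subst_of_nat [simp]: "subst h g (of_nat r) = of_nat r"
  by (induction r) simp_all

lemma subst_var [simp]: "subst h g (var i) = g i"
  by (simp add: var_def)

text \<open>Homogeneous coordinates matter only up to a common factor; this says which power of the
  factor comes out of a form.\<close>

lemma subst_scale:
  assumes "p \<in> forms n e"
  shows "subst h (\<lambda>i. s * g i) p = s ^ e * subst h g p"
proof -
  have "subst h (\<lambda>i. s * g i) p =
      (\<Sum>m \<in> Poly_Mapping.keys p. h (Poly_Mapping.lookup p m) * (s ^ e * monom_eval g m))"
    unfolding subst_def monom_eval_scale using assms by (intro sum.cong) (auto simp: forms_def)
  also have "\<dots> = s ^ e * subst h g p"
    by (simp add: subst_def sum_distrib_left algebra_simps)
  finally show ?thesis .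
qed

lemma subst_cong:
  assumes "p \<in> polys n" "\<And>i. i \<le> n \<Longrightarrow> g i = g' i"
  shows "subst h g p = subst h g' p"
  unfolding subst_def monom_eval_def using assms
  by (intro sum.cong prod.cong refl arg_cong2[where f="(*)"] arg_cong2[where f="(^)"])
    (auto simp: polys_def subset_iff)

end

interpretation cst: coeff_hom "cst :: 'k::comm_ring_1 \<Rightarrow> 'k mpoly"
  by unfold_locales (simp_all add: single_add mult_single)

lemma var_power: "var i ^ e = (Poly_Mapping.single (Poly_Mapping.single i e) 1 :: 'k::comm_ring_1 mpoly)"
  by (induction e) (simp_all add: var_def mult_single flip: single_add)

lemma monom_eval_var: "monom_eval var m = (Poly_Mapping.single m 1 :: 'k::comm_ring_1 mpoly)"
proof -
  have prod_single: "(\<Prod>i\<in>A. Poly_Mapping.single (F i) 1) = (Poly_Mapping.single (sum F A) 1 :: 'k mpoly)"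
    for A and F :: "nat \<Rightarrow> nat \<Rightarrow>\<^sub>0 nat"
    by (induction A rule: infinite_finite_induct) (simp_all add: mult_single)
  have "(\<Sum>i\<in>Poly_Mapping.keys m. Poly_Mapping.single i (Poly_Mapping.lookup m i)) = m"
  proof (rule poly_mapping_eqI)
    fix j
    have "(\<Sum>i\<in>Poly_Mapping.keys m. Poly_Mapping.lookup (Poly_Mapping.single i (Poly_Mapping.lookup m i)) j) =
        (\<Sum>i\<in>Poly_Mapping.keys m. if i = j then Poly_Mapping.lookup m j else 0)"
      by (intro sum.cong) (auto simp: lookup_single)
    then show "Poly_Mapping.lookup (\<Sum>i\<in>Poly_Mapping.keys m. Poly_Mapping.single i (Poly_Mapping.lookup m i)) j =
        Poly_Mapping.lookup m j"
      by (simp add: lookup_sum in_keys_iff)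
  qed
  then show ?thesis
    unfolding monom_eval_def by (simp add: var_power prod_single)
qed

lemma subst_cst_var [simp]: "subst cst var p = p"
proof (induction p rule: mpoly_terms_induct)
  case (2 m c)
  then show ?case by (simp add: monom_eval_var mult_single)
qed simp_all

lemma (in coeff_hom) monom_eval_subst:
  "subst h g (monom_eval g' m) = monom_eval (\<lambda>i. subst h g (g' i)) m"
proof -
  have "subst h g (prod F A) = (\<Prod>x\<in>A. subst h g (F x))" for F :: "nat \<Rightarrow> _" and A
    by (induction A rule: infinite_finite_induct) simp_all
  then show ?thesis
    by (simp add: monom_eval_def)
qed

lemma (in coeff_hom) subst_subst:
  "subst h g (subst cst g' p) = subst h (\<lambda>i. subst h g (g' i)) p"
  by (induction p rule: mpoly_terms_induct) (simp_all add: monom_eval_subst)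


section \<open>Forms\<close>

lemma polys_0 [simp]: "0 \<in> polys n"
  and polys_cst [simp]: "cst c \<in> polys n"
  and polys_add [intro]: "p \<in> polys n \<Longrightarrow> q \<in> polys n \<Longrightarrow> p + q \<in> polys n"
  using keys_add[of p q] by (auto simp: polys_def split: if_splits)

lemma polys_var [simp]: "i \<le> n \<Longrightarrow> var i \<in> polys n"
  by (simp add: polys_def var_def)

lemma polys_1 [simp]: "1 \<in> (polys n :: 'k::comm_ring_1 mpoly set)"
  using polys_cst[of "1::'k" n] by simp

lemma polys_mult [intro]:
  fixes p q :: "'k::comm_ring_1 mpoly"
  assumes "p \<in> polys n" "q \<in> polys n"
  shows "p * q \<in> polys n"
  using assms keys_mult[of p q] by (fastforce simp: polys_def keys_add_nat)

lemma polys_uminus [intro]: "p \<in> polys n \<Longrightarrow> - p \<in> (polys n :: 'k::comm_ring_1 mpoly set)"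
  by (simp add: polys_def in_keys_iff)

lemma polys_diff [intro]:
  "p \<in> polys n \<Longrightarrow> q \<in> polys n \<Longrightarrow> p - q \<in> (polys n :: 'k::comm_ring_1 mpoly set)"
  using polys_add[of p n "- q"] by auto

lemma polys_power [intro]: "p \<in> polys n \<Longrightarrow> p ^ r \<in> (polys n :: 'k::comm_ring_1 mpoly set)"
  by (induction r) auto

lemma polys_prod:
  "(\<And>i. i \<in> A \<Longrightarrow> F i \<in> polys n) \<Longrightarrow> prod F A \<in> (polys n :: 'k::comm_ring_1 mpoly set)"
  by (induction A rule: infinite_finite_induct) auto

lemma polys_sum:
  "(\<And>i. i \<in> A \<Longrightarrow> F i \<in> polys n) \<Longrightarrow> sum F A \<in> (polys n :: 'k::comm_ring_1 mpoly set)"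
  by (induction A rule: infinite_finite_induct) auto

lemma polys_subst:
  fixes p :: "'k::comm_ring_1 mpoly"
  assumes "p \<in> polys n" "\<And>i. i \<le> n \<Longrightarrow> g i \<in> polys n'"
  shows "subst cst g p \<in> polys n'"
  unfolding subst_def monom_eval_def using assms
  by (intro polys_sum polys_mult polys_prod polys_power) (auto simp: polys_def[of n])

lemma polys_induct [consumes 1, case_names cst var add mult]:
  fixes p :: "'k::comm_ring_1 mpoly"
  assumes "p \<in> polys n" "\<And>c. P (cst c)" "\<And>i. i \<le> n \<Longrightarrow> P (var i)"
    and add: "\<And>p q. p \<in> polys n \<Longrightarrow> q \<in> polys n \<Longrightarrow> P p \<Longrightarrow> P q \<Longrightarrow> P (p + q)"
    and mult: "\<And>p q. p \<in> polys n \<Longrightarrow> q \<in> polys n \<Longrightarrow> P p \<Longrightarrow> P q \<Longrightarrow> P (p * q)"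
  shows "P p"
proof -
  have P1: "P 1"
    using assms(2)[of 1] by simp
  have pow: "P (q ^ r) \<and> q ^ r \<in> polys n" if "P q" "q \<in> polys n" for q r
    by (induction r) (use that P1 mult in auto)
  have prodP: "P (prod F A) \<and> prod F A \<in> polys n" if "\<And>i. i \<in> A \<Longrightarrow> P (F i) \<and> F i \<in> polys n" for F and A :: "nat set"
    using that by (induction A rule: infinite_finite_induct) (use P1 mult in auto)
  have sum: "P (sum F A) \<and> sum F A \<in> polys n"
    if "\<And>m. m \<in> A \<Longrightarrow> P (F m) \<and> F m \<in> polys n" for F and A :: "(nat \<Rightarrow>\<^sub>0 nat) set"
    using that assms(2)[of 0] by (induction A rule: infinite_finite_induct) (use add in auto)
  \<comment> \<open>Substituting the variables for themselves writes \<open>p\<close> as a sum of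
    products of constants and variables.\<close>
  have "P (subst cst var p) \<and> subst cst var p \<in> polys n"
    unfolding subst_def monom_eval_def
  proof (rule sum)
    fix m assume "m \<in> Poly_Mapping.keys p"
    with assms(1) have le: "i \<le> n" if "i \<in> Poly_Mapping.keys m" for i
      using that by (auto simp: polys_def)
    define M :: "'k mpoly" where "M = (\<Prod>i\<in>Poly_Mapping.keys m. var i ^ Poly_Mapping.lookup m i)"
    have "P M \<and> M \<in> polys n"
      unfolding M_def using pow[OF assms(3)[OF le] polys_var[OF le]] by (intro prodP) blast
    then show "P (cst (Poly_Mapping.lookup p m) * (\<Prod>i\<in>Poly_Mapping.keys m. var i ^ Poly_Mapping.lookup m i)) \<and>
        cst (Poly_Mapping.lookup p m) * (\<Prod>i\<in>Poly_Mapping.keys m. var i ^ Poly_Mapping.lookup m i) \<in> polys n"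
      using mult[OF polys_cst _ assms(2)] unfolding M_def by auto
  qed
  then show ?thesis
    by simp
qed

lemma forms_polys: "p \<in> forms n e \<Longrightarrow> p \<in> polys n"
  by (simp add: forms_def)

lemma forms_0 [simp]: "0 \<in> forms n e"
  by (simp add: forms_def)

lemma forms_cst [simp]: "cst c \<in> forms n 0"
  by (auto simp: forms_def split: if_splits)

lemma forms_1 [simp]: "1 \<in> (forms n 0 :: 'k::comm_ring_1 mpoly set)"
  using forms_cst[of "1::'k" n] by simp

lemma forms_var [simp]: "i \<le> n \<Longrightarrow> var i \<in> forms n 1"
  by (simp add: forms_def var_def polys_def)

lemma forms_add [intro]: "p \<in> forms n e \<Longrightarrow> q \<in> forms n e \<Longrightarrow> p + q \<in> forms n e"
  using keys_add[of p q] by (auto simp: forms_def)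

lemma forms_uminus [intro]: "p \<in> forms n e \<Longrightarrow> - p \<in> (forms n e :: 'k::comm_ring_1 mpoly set)"
  using polys_uminus by (auto simp: forms_def in_keys_iff)

lemma forms_diff [intro]:
  "p \<in> forms n e \<Longrightarrow> q \<in> forms n e \<Longrightarrow> p - q \<in> (forms n e :: 'k::comm_ring_1 mpoly set)"
  using forms_add[of p n e "- q"] by auto

lemma forms_mult:
  fixes p q :: "'k::comm_ring_1 mpoly"
  assumes "p \<in> forms n e" "q \<in> forms n e'" "e'' = e + e'"
  shows "p * q \<in> forms n e''"
  using assms keys_mult[of p q] by (fastforce simp: forms_def monom_degree_add intro: polys_mult)

lemma forms_power:
  fixes p :: "'k::comm_ring_1 mpoly"
  assumes "p \<in> forms n e" "e' = r * e"
  shows "p ^ r \<in> forms n e'"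
proof -
  have "p ^ r \<in> forms n (r * e)"
    using assms(1) by (induction r) (auto intro: forms_mult)
  with assms(2) show ?thesis by simp
qed

lemma forms_scale: "p \<in> forms n e \<Longrightarrow> cst c * p \<in> (forms n e :: 'k::comm_ring_1 mpoly set)"
  by (rule forms_mult[OF forms_cst]) simp_all

lemma forms_sum:
  "(\<And>i. i \<in> A \<Longrightarrow> F i \<in> forms n e) \<Longrightarrow> sum F A \<in> (forms n e :: 'k::comm_ring_1 mpoly set)"
  by (induction A rule: infinite_finite_induct) auto

lemma forms_prod:
  fixes F :: "nat \<Rightarrow> 'k::comm_ring_1 mpoly"
  shows "(\<And>i. i \<in> A \<Longrightarrow> F i \<in> forms n (r i)) \<Longrightarrow> finite A \<Longrightarrow> prod F A \<in> forms n (sum r A)"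
  by (rotate_tac, induction A rule: finite_induct) (auto intro: forms_mult)

lemma forms_subst:
  fixes p :: "'k::comm_ring_1 mpoly"
  assumes "p \<in> forms n e" "\<And>i. i \<le> n \<Longrightarrow> g i \<in> forms n' r"
  shows "subst cst g p \<in> forms n' (e * r)"
  unfolding subst_def
proof (rule forms_sum)
  fix m assume m: "m \<in> Poly_Mapping.keys p"
  have "monom_eval g m \<in> forms n' (\<Sum>i \<in> Poly_Mapping.keys m. Poly_Mapping.lookup m i * r)"
    unfolding monom_eval_def using assms m
    by (intro forms_prod forms_power[OF assms(2) refl]) (auto simp: forms_def[of n] polys_def)
  moreover have "(\<Sum>i \<in> Poly_Mapping.keys m. Poly_Mapping.lookup m i * r) = e * r"
    using assms(1) m by (auto simp: forms_def monom_degree_def simp flip: sum_distrib_right)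
  ultimately show "cst (Poly_Mapping.lookup p m) * monom_eval g m \<in> forms n' (e * r)"
    by (simp add: forms_scale)
qed

lemma polys_forms_decomp:
  fixes p :: "'k::comm_ring_1 mpoly"
  assumes "p \<in> polys n"
  obtains F N where "\<forall>e. F e \<in> forms n e" "p = (\<Sum>e<N. F e)"
proof -
  define G where "G e = (\<Sum>m \<in> {m \<in> Poly_Mapping.keys p. monom_degree m = e}.
      Poly_Mapping.single m (Poly_Mapping.lookup p m))" for e
  \<comment> \<open>A bound above all degrees that occur; the inserted 0 covers
    \<open>p = 0\<close>, where the set of degrees is empty.\<close>
  define N where "N = Suc (Max (insert 0 (monom_degree ` Poly_Mapping.keys p)))"
  have "G e \<in> forms n e" for e
    unfolding G_def using assms by (intro forms_sum) (auto simp: forms_def polys_def)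
  moreover have "p = (\<Sum>e<N. G e)"
  proof -
    have "monom_degree m < N" if "m \<in> Poly_Mapping.keys p" for m
      using that unfolding N_def by (intro le_imp_less_Suc Max_ge) auto
    then have "(\<Sum>e<N. G e) = (\<Sum>m \<in> Poly_Mapping.keys p. Poly_Mapping.single m (Poly_Mapping.lookup p m))"
      unfolding G_def by (intro sum.group) auto
    then show ?thesis
      using mpoly_expansion by metis
  qed
  ultimately show ?thesis
    using that by blast
qed


section \<open>Stalks and sections of Proj\<close>

text \<open>Closure of the pieces is what the calculus of homogeneous fractions rests on, so
  polynomial rings and their quotients by a form qualify alike.\<close>

locale graded_cring = cring S for S :: "('a, 'k) graded_algebra" (structure) +
  assumes piece_carrier: "a \<in> piece S e \<Longrightarrow> a \<in> carrier S"
    and piece_add: "a \<in> piece S e \<Longrightarrow> b \<in> piece S e \<Longrightarrow> a \<oplus> b \<in> piece S e"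
    and piece_mult: "a \<in> piece S e \<Longrightarrow> b \<in> piece S e' \<Longrightarrow> a \<otimes> b \<in> piece S (e + e')"
    and piece_zero: "\<zero> \<in> piece S e"
    and piece_one: "\<one> \<in> piece S 0"
    and piece_scalar: "scalar S c \<in> piece S 0"
begin

definition D :: "'a \<Rightarrow> 'a set set" where
  "D h = {P \<in> proj_points S. h \<notin> P}"

definition fracs :: "'a set \<Rightarrow> ('a \<times> 'a) set" where
  "fracs P = {(a, s). \<exists>e. a \<in> piece S e \<and> s \<in> piece S e - P}"

lemma fracsI: "a \<in> piece S e \<Longrightarrow> s \<in> piece S e \<Longrightarrow> s \<notin> P \<Longrightarrow> (a, s) \<in> fracs P"
  by (auto simp: fracs_def)

lemma fracsE:
  assumes "(a, s) \<in> fracs P"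
  obtains e where "a \<in> piece S e" "s \<in> piece S e" "s \<notin> P" "a \<in> carrier S" "s \<in> carrier S"
  using assms piece_carrier by (auto simp: fracs_def)

lemma homogI [intro]: "a \<in> piece S e \<Longrightarrow> a \<in> homogeneous_elems S"
  by (auto simp: homogeneous_elems_def)

lemma homog_carrier: "a \<in> homogeneous_elems S \<Longrightarrow> a \<in> carrier S"
  by (auto simp: homogeneous_elems_def piece_carrier)

lemma homog_mult: "a \<in> homogeneous_elems S \<Longrightarrow> b \<in> homogeneous_elems S \<Longrightarrow> a \<otimes> b \<in> homogeneous_elems S"
  by (auto simp: homogeneous_elems_def intro: piece_mult)

lemma mult_diff_zero_iff:
  assumes "u \<in> carrier S" "x \<in> carrier S" "y \<in> carrier S"
  shows "u \<otimes> (x \<ominus> y) = \<zero> \<longleftrightarrow> u \<otimes> x = u \<otimes> y"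
proof -
  have "u \<otimes> (x \<ominus> y) = u \<otimes> x \<ominus> u \<otimes> y"
    using assms by algebra
  then show ?thesis
    using assms by (simp add: r_right_minus_eq)
qed

context
  fixes P assumes P: "P \<in> proj_points S"
begin

lemma prime_P: "primeideal P S"
  using P by (simp add: proj_points_def)

lemma one_notin: "\<one> \<notin> P"
proof -
  interpret primeideal P S by (rule prime_P)
  show ?thesis
    using I_notcarr one_imp_carrier by auto
qed

lemma mult_notin:
  assumes "a \<in> carrier S" "b \<in> carrier S" "a \<notin> P" "b \<notin> P"
  shows "a \<otimes> b \<notin> P"
proof -
  interpret primeideal P S by (rule prime_P)
  show ?thesis using I_prime assms by blast
qed

lemma in_mult:
  assumes "a \<in> carrier S" "b \<in> P"
  shows "a \<otimes> b \<in> P" "b \<otimes> a \<in> P"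
proof -
  interpret primeideal P S by (rule prime_P)
  show "a \<otimes> b \<in> P" "b \<otimes> a \<in> P" using assms I_l_closed I_r_closed by auto
qed

lemma in_add: "a \<in> P \<Longrightarrow> b \<in> P \<Longrightarrow> a \<oplus> b \<in> P"
proof -
  interpret primeideal P S by (rule prime_P)
  show "a \<in> P \<Longrightarrow> b \<in> P \<Longrightarrow> a \<oplus> b \<in> P" by (rule a_closed)
qed

lemma zero_in: "\<zero> \<in> P"
proof -
  interpret primeideal P S by (rule prime_P)
  show ?thesis by simp
qed

lemma fracs_mult:
  assumes "(a, s) \<in> fracs P" "(b, t) \<in> fracs P"
  shows "(a \<otimes> b, s \<otimes> t) \<in> fracs P"
proof -
  obtain e where e: "a \<in> piece S e" "s \<in> piece S e" "s \<notin> P" "s \<in> carrier S"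
    using assms(1) by (rule fracsE)
  obtain e' where e': "b \<in> piece S e'" "t \<in> piece S e'" "t \<notin> P" "t \<in> carrier S"
    using assms(2) by (rule fracsE)
  show ?thesis
    using e e' fracsI[OF piece_mult[OF e(1) e'(1)] piece_mult[OF e(2) e'(2)]] mult_notin by simp
qed

lemma fracs_add:
  assumes "(a, s) \<in> fracs P" "(b, t) \<in> fracs P"
  shows "(a \<otimes> t \<oplus> b \<otimes> s, s \<otimes> t) \<in> fracs P"
proof -
  obtain e where e: "a \<in> piece S e" "s \<in> piece S e" "s \<notin> P" "s \<in> carrier S"
    using assms(1) by (rule fracsE)
  obtain e' where e': "b \<in> piece S e'" "t \<in> piece S e'" "t \<notin> P" "t \<in> carrier S"
    using assms(2) by (rule fracsE)
  have "b \<otimes> s \<in> piece S (e + e')"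
    using piece_mult[OF e'(1) e(2)] by (simp add: add.commute)
  then show ?thesis
    using e e' fracsI[OF piece_add[OF piece_mult[OF e(1) e'(2)]] piece_mult[OF e(2) e'(2)]] mult_notin by simp
qed

lemma fracs_one: "(\<one>, \<one>) \<in> fracs P" "(\<zero>, \<one>) \<in> fracs P" "(scalar S c, \<one>) \<in> fracs P"
  using one_notin by (auto intro: fracsI piece_one piece_zero piece_scalar)

text \<open>The equivalence behind \<open>hfrac\<close>, written without subtraction: its properties
  become rearrangements of products.\<close>

definition frac_eq :: "'a \<Rightarrow> 'a \<Rightarrow> 'a \<Rightarrow> 'a \<Rightarrow> bool" where
  "frac_eq a s b t \<longleftrightarrow> (\<exists>u \<in> homogeneous_elems S - P. u \<otimes> (a \<otimes> t) = u \<otimes> (b \<otimes> s))"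

lemma frac_eq_sym: "frac_eq a s b t \<Longrightarrow> frac_eq b t a s"
  unfolding frac_eq_def by metis

lemma frac_eq_trans:
  assumes "frac_eq a s b t" "frac_eq b t c r" "(a, s) \<in> fracs P" "(b, t) \<in> fracs P" "(c, r) \<in> fracs P"
  shows "frac_eq a s c r"
proof -
  obtain u where u: "u \<in> homogeneous_elems S" "u \<notin> P" "u \<otimes> (a \<otimes> t) = u \<otimes> (b \<otimes> s)"
    using assms(1) by (auto simp: frac_eq_def)
  obtain v where v: "v \<in> homogeneous_elems S" "v \<notin> P" "v \<otimes> (b \<otimes> r) = v \<otimes> (c \<otimes> t)"
    using assms(2) by (auto simp: frac_eq_def)
  obtain e where t: "t \<in> piece S e" "t \<notin> P"
    using assms(4) by (rule fracsE)
  have [simp]: "u \<in> carrier S" "v \<in> carrier S" "a \<in> carrier S" "s \<in> carrier S" "b \<in> carrier S"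
    "t \<in> carrier S" "c \<in> carrier S" "r \<in> carrier S"
    using u v assms(3-5) homog_carrier by (auto elim: fracsE)
  \<comment> \<open>The multiplier must contain the middle denominator t as well as u and v, because
    t links the two given equations.\<close>
  have "u \<otimes> v \<otimes> t \<otimes> (a \<otimes> r) = v \<otimes> r \<otimes> (u \<otimes> (a \<otimes> t))"
    by (simp add: m_ac)
  also have "\<dots> = u \<otimes> s \<otimes> (v \<otimes> (b \<otimes> r))"
    unfolding u(3) by (simp add: m_ac)
  also have "\<dots> = u \<otimes> v \<otimes> t \<otimes> (c \<otimes> s)"
    unfolding v(3) by (simp add: m_ac)
  finally show ?thesis
    unfolding frac_eq_def using u v t homogI
    by (intro bexI[of _ "u \<otimes> v \<otimes> t"]) (simp_all add: homog_mult mult_notin)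
qed

lemma frac_eq_refl: "frac_eq a s a s"
  unfolding frac_eq_def using piece_one one_notin by (intro bexI[of _ \<one>]) auto

lemma mem_hfrac_iff:
  assumes "(a, s) \<in> fracs P"
  shows "(b, t) \<in> hfrac S P a s \<longleftrightarrow> (b, t) \<in> fracs P \<and> frac_eq a s b t"
proof -
  have "u \<otimes> (a \<otimes> t \<ominus> b \<otimes> s) = \<zero> \<longleftrightarrow> u \<otimes> (a \<otimes> t) = u \<otimes> (b \<otimes> s)"
    if "(b, t) \<in> fracs P" "u \<in> homogeneous_elems S" for u
    using that assms by (intro mult_diff_zero_iff) (auto elim!: fracsE intro: homog_carrier)
  then show ?thesis
    unfolding hfrac_def frac_eq_def fracs_def by fastforce
qed

lemma hfrac_eq_iff:
  assumes "(a, s) \<in> fracs P" "(b, t) \<in> fracs P"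
  shows "hfrac S P a s = hfrac S P b t \<longleftrightarrow> frac_eq a s b t"
proof
  assume "hfrac S P a s = hfrac S P b t"
  then show "frac_eq a s b t"
    using mem_hfrac_iff[OF assms(1), of b t] mem_hfrac_iff[OF assms(2), of b t] assms frac_eq_refl by auto
next
  assume *: "frac_eq a s b t"
  have "(c, r) \<in> hfrac S P a s \<longleftrightarrow> (c, r) \<in> hfrac S P b t" for c r
    unfolding mem_hfrac_iff[OF assms(1)] mem_hfrac_iff[OF assms(2)]
    using frac_eq_trans[OF * _ assms] frac_eq_trans[OF frac_eq_sym[OF *] _ assms(2,1)] by metis
  then show "hfrac S P a s = hfrac S P b t"
    by (simp add: set_eq_iff split_paired_all)
qed

lemma hfrac_eqI:
  assumes "(a, s) \<in> fracs P" "(b, t) \<in> fracs P" "a \<otimes> t = b \<otimes> s"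
  shows "hfrac S P a s = hfrac S P b t"
proof -
  have "frac_eq a s b t"
    unfolding frac_eq_def using piece_one one_notin assms(3) by (intro bexI[of _ \<one>]) auto
  then show ?thesis
    using assms by (simp add: hfrac_eq_iff)
qed

lemma hloc_carrierI: "(a, s) \<in> fracs P \<Longrightarrow> hfrac S P a s \<in> carrier (hloc S P)"
  by (auto simp: hloc_def fracs_def)

lemma hloc_carrierE:
  assumes "z \<in> carrier (hloc S P)"
  obtains a s where "(a, s) \<in> fracs P" "z = hfrac S P a s"
  using assms by (auto simp: hloc_def fracs_def)

lemma UN_const_eq:
  assumes "\<And>x. x \<in> A \<Longrightarrow> F x = c" "A \<noteq> {}"
  shows "(\<Union>x\<in>A. F x) = c"
  using assms by auto

text \<open>The union in the definition runs over all representatives; since equivalent factors give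
  equivalent products, every member of the union is the same class.\<close>

lemma hloc_mult:
  assumes as: "(a, s) \<in> fracs P" and bt: "(b, t) \<in> fracs P"
  shows "hfrac S P a s \<otimes>\<^bsub>hloc S P\<^esub> hfrac S P b t = hfrac S P (a \<otimes> b) (s \<otimes> t)"
proof -
  have *: "hfrac S P (a' \<otimes> b') (s' \<otimes> t') = hfrac S P (a \<otimes> b) (s \<otimes> t)"
    if as': "(a', s') \<in> hfrac S P a s" and bt': "(b', t') \<in> hfrac S P b t" for a' s' b' t'
  proof -
    have 1: "(a', s') \<in> fracs P" "frac_eq a s a' s'" "(b', t') \<in> fracs P" "frac_eq b t b' t'"
      using as' bt' as bt by (auto simp: mem_hfrac_iff)
    obtain u where u: "u \<in> homogeneous_elems S" "u \<notin> P" "u \<otimes> (a \<otimes> s') = u \<otimes> (a' \<otimes> s)"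
      using 1 by (auto simp: frac_eq_def)
    obtain v where v: "v \<in> homogeneous_elems S" "v \<notin> P" "v \<otimes> (b \<otimes> t') = v \<otimes> (b' \<otimes> t)"
      using 1 by (auto simp: frac_eq_def)
    have [simp]: "u \<in> carrier S" "v \<in> carrier S" "a \<in> carrier S" "s \<in> carrier S" "b \<in> carrier S"
      "t \<in> carrier S" "a' \<in> carrier S" "s' \<in> carrier S" "b' \<in> carrier S" "t' \<in> carrier S"
      using u v as bt 1 homog_carrier by (auto elim: fracsE)
    have "u \<otimes> v \<otimes> (a \<otimes> b \<otimes> (s' \<otimes> t')) = (u \<otimes> (a \<otimes> s')) \<otimes> (v \<otimes> (b \<otimes> t'))"
      by (simp add: m_ac)
    also have "\<dots> = u \<otimes> v \<otimes> (a' \<otimes> b' \<otimes> (s \<otimes> t))"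
      unfolding u(3) v(3) by (simp add: m_ac)
    finally have "frac_eq (a \<otimes> b) (s \<otimes> t) (a' \<otimes> b') (s' \<otimes> t')"
      unfolding frac_eq_def using u v
      by (intro bexI[of _ "u \<otimes> v"]) (simp_all add: homog_mult mult_notin)
    then show ?thesis
      using as bt 1 by (subst hfrac_eq_iff) (auto intro: fracs_mult frac_eq_sym)
  qed
  have "hfrac S P a s \<noteq> {}" "hfrac S P b t \<noteq> {}"
    using mem_hfrac_iff[OF as, of a s] mem_hfrac_iff[OF bt, of b t] as bt frac_eq_refl by auto
  then show ?thesis
    unfolding hloc_def by (auto intro!: UN_const_eq simp: *)
qed

lemma hloc_add:
  assumes as: "(a, s) \<in> fracs P" and bt: "(b, t) \<in> fracs P"
  shows "hfrac S P a s \<oplus>\<^bsub>hloc S P\<^esub> hfrac S P b t = hfrac S P (a \<otimes> t \<oplus> b \<otimes> s) (s \<otimes> t)"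
proof -
  have *: "hfrac S P (a' \<otimes> t' \<oplus> b' \<otimes> s') (s' \<otimes> t') = hfrac S P (a \<otimes> t \<oplus> b \<otimes> s) (s \<otimes> t)"
    if as': "(a', s') \<in> hfrac S P a s" and bt': "(b', t') \<in> hfrac S P b t" for a' s' b' t'
  proof -
    have 1: "(a', s') \<in> fracs P" "frac_eq a s a' s'" "(b', t') \<in> fracs P" "frac_eq b t b' t'"
      using as' bt' as bt by (auto simp: mem_hfrac_iff)
    obtain u where u: "u \<in> homogeneous_elems S" "u \<notin> P" "u \<otimes> (a \<otimes> s') = u \<otimes> (a' \<otimes> s)"
      using 1 by (auto simp: frac_eq_def)
    obtain v where v: "v \<in> homogeneous_elems S" "v \<notin> P" "v \<otimes> (b \<otimes> t') = v \<otimes> (b' \<otimes> t)"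
      using 1 by (auto simp: frac_eq_def)
    have [simp]: "u \<in> carrier S" "v \<in> carrier S" "a \<in> carrier S" "s \<in> carrier S" "b \<in> carrier S"
      "t \<in> carrier S" "a' \<in> carrier S" "s' \<in> carrier S" "b' \<in> carrier S" "t' \<in> carrier S"
      using u v as bt 1 homog_carrier by (auto elim: fracsE)
    have "u \<otimes> v \<otimes> ((a \<otimes> t \<oplus> b \<otimes> s) \<otimes> (s' \<otimes> t')) =
        v \<otimes> t \<otimes> t' \<otimes> (u \<otimes> (a \<otimes> s')) \<oplus> u \<otimes> s \<otimes> s' \<otimes> (v \<otimes> (b \<otimes> t'))"
      by (simp add: l_distr r_distr m_ac)
    also have "\<dots> = u \<otimes> v \<otimes> ((a' \<otimes> t' \<oplus> b' \<otimes> s') \<otimes> (s \<otimes> t))"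
      unfolding u(3) v(3) by (simp add: l_distr r_distr m_ac)
    finally have "frac_eq (a \<otimes> t \<oplus> b \<otimes> s) (s \<otimes> t) (a' \<otimes> t' \<oplus> b' \<otimes> s') (s' \<otimes> t')"
      unfolding frac_eq_def using u v
      by (intro bexI[of _ "u \<otimes> v"]) (simp_all add: homog_mult mult_notin)
    then show ?thesis
      using as bt 1 by (subst hfrac_eq_iff) (auto intro: fracs_add frac_eq_sym)
  qed
  have "hfrac S P a s \<noteq> {}" "hfrac S P b t \<noteq> {}"
    using mem_hfrac_iff[OF as, of a s] mem_hfrac_iff[OF bt, of b t] as bt frac_eq_refl by auto
  then show ?thesis
    unfolding hloc_def by (auto intro!: UN_const_eq simp: *)
qed

lemma hloc_one: "\<one>\<^bsub>hloc S P\<^esub> = hfrac S P \<one> \<one>"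
  by (simp add: hloc_def)

lemma hloc_pow:
  assumes "(a, s) \<in> fracs P"
  shows "(a [^] r, s [^] r) \<in> fracs P \<and>
    hfrac S P a s [^]\<^bsub>hloc S P\<^esub> (r::nat) = hfrac S P (a [^] r) (s [^] r)"
proof (induction r)
  case 0
  then show ?case
    by (simp add: nat_pow_def hloc_one fracs_one)
next
  case (Suc r)
  have "hfrac S P a s [^]\<^bsub>hloc S P\<^esub> Suc r = hfrac S P a s [^]\<^bsub>hloc S P\<^esub> r \<otimes>\<^bsub>hloc S P\<^esub> hfrac S P a s"
    by (simp add: nat_pow_def)
  with Suc show ?case
    using fracs_mult[of "a [^] r" "s [^] r"] assms by (simp add: hloc_mult)
qed

text \<open>The stalk is local: swapping numerator and denominator inverts a/s when a is outside P,
  and conversely an inverse b/t gives u a b = u s t outside the prime P, which keeps a out of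
  P.\<close>

lemma hloc_unit_iff:
  assumes as: "(a, s) \<in> fracs P"
  shows "hfrac S P a s \<in> Units (hloc S P) \<longleftrightarrow> a \<notin> P"
proof
  assume "a \<notin> P"
  then have sa: "(s, a) \<in> fracs P"
    using as by (auto elim!: fracsE intro: fracsI)
  have [simp]: "a \<in> carrier S" "s \<in> carrier S"
    using as by (auto elim: fracsE)
  have "hfrac S P s a \<otimes>\<^bsub>hloc S P\<^esub> hfrac S P a s = \<one>\<^bsub>hloc S P\<^esub>"
    "hfrac S P a s \<otimes>\<^bsub>hloc S P\<^esub> hfrac S P s a = \<one>\<^bsub>hloc S P\<^esub>"
    unfolding hloc_mult[OF as sa] hloc_mult[OF sa as] hloc_one
    by (rule hfrac_eqI[OF fracs_mult[OF sa as] fracs_one(1)] hfrac_eqI[OF fracs_mult[OF as sa] fracs_one(1)],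
        simp add: m_comm)+
  then show "hfrac S P a s \<in> Units (hloc S P)"
    using as sa hloc_carrierI unfolding Units_def by blast
next
  assume "hfrac S P a s \<in> Units (hloc S P)"
  then obtain z where z: "z \<in> carrier (hloc S P)" "hfrac S P a s \<otimes>\<^bsub>hloc S P\<^esub> z = \<one>\<^bsub>hloc S P\<^esub>"
    by (auto simp: Units_def)
  then obtain b t where bt: "(b, t) \<in> fracs P" "z = hfrac S P b t"
    by (auto elim: hloc_carrierE)
  have carr [simp]: "a \<in> carrier S" "s \<in> carrier S" "b \<in> carrier S" "t \<in> carrier S"
    using as bt by (auto elim: fracsE)
  have "frac_eq (a \<otimes> b) (s \<otimes> t) \<one> \<one>"
    using z as bt fracs_mult[OF as bt(1)] fracs_one
    by (simp add: hloc_mult hloc_one hfrac_eq_iff)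
  then obtain u where u: "u \<in> homogeneous_elems S" "u \<notin> P" "u \<otimes> (a \<otimes> b) = u \<otimes> (s \<otimes> t)"
    by (auto simp: frac_eq_def)
  have "u \<otimes> (s \<otimes> t) \<notin> P"
    using u as bt homog_carrier by (intro mult_notin) (auto elim: fracsE)
  with u show "a \<notin> P"
    using in_mult homog_carrier carr by (metis)
qed

end

section \<open>The Zariski topology and sections of the structure sheaf\<close>

lemma topspace_zariski [simp]: "topspace (zariski S) = proj_points S"
proof -
  have "P \<in> D \<one>" if "P \<in> proj_points S" for P
    using that by (auto simp: D_def one_notin)
  then have "(\<Union>h\<in>homogeneous_elems S. D h) = proj_points S"
    using piece_one by (auto simp: D_def)
  then show ?thesis
    by (simp add: zariski_def topology_generated_by_topspace D_def)
qed

lemma openin_D: "h \<in> homogeneous_elems S \<Longrightarrow> openin (zariski S) (D h)"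
  unfolding zariski_def D_def by (rule topology_generated_by_Basis) auto

lemma openin_points: "openin (zariski S) U \<Longrightarrow> P \<in> U \<Longrightarrow> P \<in> proj_points S"
  using openin_subset[of "zariski S" U] by auto

lemma section_mem:
  assumes "\<sigma> \<in> carrier (proj_sections S U)" "P \<in> U"
  shows "\<sigma> P \<in> carrier (hloc S P)"
  using assms by (auto simp: proj_sections_def)

lemma section_local:
  assumes "\<sigma> \<in> carrier (proj_sections S U)" "P \<in> U"
  obtains W a e s where "openin (zariski S) W" "P \<in> W" "W \<subseteq> U" "a \<in> piece S e" "s \<in> piece S e"
    "W \<subseteq> D s" "\<forall>Q\<in>W. \<sigma> Q = hfrac S Q a s"
proof -
  obtain W e a s where "openin (zariski S) W" "P \<in> W" "W \<subseteq> U" "a \<in> piece S e" "s \<in> piece S e"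
    "\<forall>Q \<in> W. s \<notin> Q \<and> \<sigma> Q = hfrac S Q a s"
    using assms by (auto simp: proj_sections_def)
  then show ?thesis
    using openin_points by (intro that[of W a e s]) (auto simp: D_def)
qed

text \<open>The neighbourhood W may stick out of U; the intersection is taken here once and for
  all.\<close>

lemma section_intro:
  assumes "\<sigma> \<in> extensional U" "openin (zariski S) U"
    and "\<And>P. P \<in> U \<Longrightarrow> \<exists>W e a s. openin (zariski S) W \<and> P \<in> W \<and> a \<in> piece S e \<and> s \<in> piece S e \<and>
      W \<subseteq> D s \<and> (\<forall>Q \<in> W \<inter> U. \<sigma> Q = hfrac S Q a s)"
  shows "\<sigma> \<in> carrier (proj_sections S U)"
proof -
  have *: "\<sigma> P \<in> carrier (hloc S P) \<and> (\<exists>W. openin (zariski S) W \<and> P \<in> W \<and> W \<subseteq> U \<and>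
          (\<exists>e. \<exists>a \<in> piece S e. \<exists>s \<in> piece S e. \<forall>Q \<in> W. s \<notin> Q \<and> \<sigma> Q = hfrac S Q a s))" if PU: "P \<in> U" for P
  proof -
    obtain W e a s where W: "openin (zariski S) W" "P \<in> W" "a \<in> piece S e" "s \<in> piece S e"
      "W \<subseteq> D s" "\<forall>Q \<in> W \<inter> U. \<sigma> Q = hfrac S Q a s"
      using assms(3)[OF PU] by blast
    have "(a, s) \<in> fracs P" "P \<in> proj_points S"
      using W by (auto simp: D_def intro: fracsI)
    then have "\<sigma> P \<in> carrier (hloc S P)"
      using W PU hloc_carrierI[of P a s] by auto
    moreover have "openin (zariski S) (W \<inter> U)"
      using W(1) assms(2) by (rule openin_Int)
    moreover have "\<forall>Q \<in> W \<inter> U. s \<notin> Q \<and> \<sigma> Q = hfrac S Q a s"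
      using W by (auto simp: D_def)
    ultimately show ?thesis
      using W PU by blast
  qed
  have "\<sigma> \<in> (\<Pi>\<^sub>E P \<in> U. carrier (hloc S P))"
    using * assms(1) by (auto simp: PiE_def)
  then show ?thesis
    unfolding proj_sections_def using * by simp
qed

lemma frac_section:
  assumes "a \<in> piece S e" "s \<in> piece S e" "openin (zariski S) U" "U \<subseteq> D s"
  shows "(\<lambda>Q\<in>U. hfrac S Q a s) \<in> carrier (proj_sections S U)"
  using assms by (intro section_intro) (auto intro!: exI[of _ U] exI[of _ e] bexI)

lemma section_restrict:
  assumes "\<sigma> \<in> carrier (proj_sections S U)" "openin (zariski S) V" "V \<subseteq> U"
  shows "restrict \<sigma> V \<in> carrier (proj_sections S V)"
proof (rule section_intro)
  fix P assume "P \<in> V"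
  with assms(3) have "P \<in> U"
    by blast
  then obtain W e a s where "openin (zariski S) W" "P \<in> W" "W \<subseteq> U" "a \<in> piece S e" "s \<in> piece S e"
    "W \<subseteq> D s" "\<forall>Q\<in>W. \<sigma> Q = hfrac S Q a s"
    by (rule section_local[OF assms(1)])
  then show "\<exists>W e a s. openin (zariski S) W \<and> P \<in> W \<and> a \<in> piece S e \<and> s \<in> piece S e \<and>
      W \<subseteq> D s \<and> (\<forall>Q \<in> W \<inter> V. restrict \<sigma> V Q = hfrac S Q a s)"
    by (intro exI[of _ W] exI[of _ e] exI[of _ a] exI[of _ s]) simp
qed (use assms in auto)

text \<open>A fraction a/s makes sense on all of \<open>D s\<close>. This gives access to stalks
  through morphisms, which are defined on sections only.\<close>

lemma section_of_stalk:
  assumes "P \<in> proj_points S" "z \<in> carrier (hloc S P)"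
  obtains U \<sigma> where "openin (zariski S) U" "P \<in> U" "\<sigma> \<in> carrier (proj_sections S U)" "\<sigma> P = z"
proof -
  obtain a s where as: "(a, s) \<in> fracs P" "z = hfrac S P a s"
    using assms by (auto elim: hloc_carrierE)
  then obtain e where e: "a \<in> piece S e" "s \<in> piece S e" "s \<notin> P"
    by (auto elim: fracsE)
  show ?thesis
  proof (rule that)
    show "openin (zariski S) (D s)" "P \<in> D s"
      using e assms by (auto intro!: openin_D) (simp add: D_def)
    show "(\<lambda>Q\<in>D s. hfrac S Q a s) \<in> carrier (proj_sections S (D s))"
      using e by (auto intro: frac_section openin_D)
    show "(\<lambda>Q\<in>D s. hfrac S Q a s) P = z"
      using as e assms by (simp add: D_def)
  qed
qed

text \<open>Equality of two fractions at P is witnessed by a form u outside P, and the same u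
  witnesses it at every point of \<open>D u\<close>.\<close>

lemma sections_agree:
  assumes \<sigma>: "\<sigma> \<in> carrier (proj_sections S U)" and \<tau>: "\<tau> \<in> carrier (proj_sections S V)"
    and P: "P \<in> U" "P \<in> V" and eq: "\<sigma> P = \<tau> P"
  obtains W where "openin (zariski S) W" "P \<in> W" "W \<subseteq> U \<inter> V" "restrict \<sigma> W = restrict \<tau> W"
proof -
  obtain W1 e a s where 1: "openin (zariski S) W1" "P \<in> W1" "W1 \<subseteq> U" "a \<in> piece S e" "s \<in> piece S e"
    "W1 \<subseteq> D s" "\<forall>Q\<in>W1. \<sigma> Q = hfrac S Q a s"
    by (rule section_local[OF \<sigma> P(1)])
  obtain W2 e' b t where 2: "openin (zariski S) W2" "P \<in> W2" "W2 \<subseteq> V" "b \<in> piece S e'" "t \<in> piece S e'"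
    "W2 \<subseteq> D t" "\<forall>Q\<in>W2. \<tau> Q = hfrac S Q b t"
    by (rule section_local[OF \<tau> P(2)])
  have fr: "(a, s) \<in> fracs Q" "(b, t) \<in> fracs Q" "Q \<in> proj_points S" if "Q \<in> W1 \<inter> W2" for Q
    using that 1 2 by (auto simp: D_def intro: fracsI)
  have "hfrac S P a s = hfrac S P b t"
    using 1 2 eq by metis
  then obtain u where u: "u \<in> homogeneous_elems S" "u \<notin> P" "u \<otimes> (a \<otimes> t) = u \<otimes> (b \<otimes> s)"
    using fr[of P] 1 2 by (auto simp: hfrac_eq_iff frac_eq_def)
  define W where "W = W1 \<inter> W2 \<inter> D u"
  have "hfrac S Q a s = hfrac S Q b t" if "Q \<in> W" for Q
    using that fr[of Q] u by (auto simp: hfrac_eq_iff frac_eq_def W_def D_def)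
  then have "restrict \<sigma> W = restrict \<tau> W"
    using 1(7) 2(7) by (intro restrict_ext) (simp add: W_def)
  moreover have "openin (zariski S) W" "P \<in> W" "W \<subseteq> U \<inter> V"
    unfolding W_def using 1(1-3) 2(1-3) u(1,2) fr(3)[of P]
    by (auto intro!: openin_Int openin_D) (auto simp: D_def)
  ultimately show ?thesis
    using that by blast
qed

lemma sections_mult_add:
  assumes \<sigma>: "\<sigma> \<in> carrier (proj_sections S U)" and \<tau>: "\<tau> \<in> carrier (proj_sections S U)"
    and U: "openin (zariski S) U"
  shows "\<sigma> \<otimes>\<^bsub>proj_sections S U\<^esub> \<tau> \<in> carrier (proj_sections S U)"
    and "\<sigma> \<oplus>\<^bsub>proj_sections S U\<^esub> \<tau> \<in> carrier (proj_sections S U)"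
proof -
  have "\<exists>W e a s b e' t. openin (zariski S) W \<and> P \<in> W \<and> W \<subseteq> U \<and> a \<in> piece S e \<and> s \<in> piece S e \<and>
    b \<in> piece S e' \<and> t \<in> piece S e' \<and> W \<subseteq> D (s \<otimes> t) \<and>
    (\<forall>Q\<in>W. (a, s) \<in> fracs Q \<and> (b, t) \<in> fracs Q \<and> \<sigma> Q = hfrac S Q a s \<and> \<tau> Q = hfrac S Q b t)"
    if P: "P \<in> U" for P
  proof -
    obtain W1 e a s where 1: "openin (zariski S) W1" "P \<in> W1" "W1 \<subseteq> U" "a \<in> piece S e" "s \<in> piece S e"
      "W1 \<subseteq> D s" "\<forall>Q\<in>W1. \<sigma> Q = hfrac S Q a s"
      by (rule section_local[OF \<sigma> P])
    obtain W2 e' b t where 2: "openin (zariski S) W2" "P \<in> W2" "W2 \<subseteq> U" "b \<in> piece S e'" "t \<in> piece S e'"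
      "W2 \<subseteq> D t" "\<forall>Q\<in>W2. \<tau> Q = hfrac S Q b t"
      by (rule section_local[OF \<tau> P])
    have "W1 \<inter> W2 \<subseteq> D (s \<otimes> t)"
    proof
      fix Q assume "Q \<in> W1 \<inter> W2"
      then have "Q \<in> proj_points S" "s \<notin> Q" "t \<notin> Q"
        using 1(6) 2(6) by (auto simp: D_def)
      then show "Q \<in> D (s \<otimes> t)"
        using mult_notin piece_carrier[OF 1(5)] piece_carrier[OF 2(5)] by (simp add: D_def)
    qed
    moreover have "openin (zariski S) (W1 \<inter> W2)"
      using 1(1) 2(1) by (rule openin_Int)
    moreover have "(a, s) \<in> fracs Q \<and> (b, t) \<in> fracs Q" if "Q \<in> W1 \<inter> W2" for Q
      using fracsI[OF 1(4,5)] fracsI[OF 2(4,5)] 1(6) 2(6) that by (auto simp: D_def)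
    ultimately show ?thesis
      using 1(2-5,7) 2(2-5,7) by (intro exI[of _ "W1 \<inter> W2"] exI[of _ e] exI[of _ a] exI[of _ s] exI[of _ b]
          exI[of _ e'] exI[of _ t]) (simp add: le_infI1)
  qed
  note loc = this
  show "\<sigma> \<otimes>\<^bsub>proj_sections S U\<^esub> \<tau> \<in> carrier (proj_sections S U)"
  proof (rule section_intro)
    fix P assume "P \<in> U"
    from loc[OF this] obtain W e a s b e' t where W: "openin (zariski S) W" "P \<in> W" "W \<subseteq> U"
      "a \<in> piece S e" "s \<in> piece S e" "b \<in> piece S e'" "t \<in> piece S e'" "W \<subseteq> D (s \<otimes> t)"
      "\<And>Q. Q \<in> W \<Longrightarrow> (a, s) \<in> fracs Q \<and> (b, t) \<in> fracs Q \<and> \<sigma> Q = hfrac S Q a s \<and> \<tau> Q = hfrac S Q b t"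
      by blast
    have "(\<sigma> \<otimes>\<^bsub>proj_sections S U\<^esub> \<tau>) Q = hfrac S Q (a \<otimes> b) (s \<otimes> t)" if "Q \<in> W" for Q
      using W that openin_points[OF W(1)] by (auto simp: proj_sections_def hloc_mult)
    with W show "\<exists>W e a s. openin (zariski S) W \<and> P \<in> W \<and> a \<in> piece S e \<and> s \<in> piece S e \<and>
        W \<subseteq> D s \<and> (\<forall>Q \<in> W \<inter> U. (\<sigma> \<otimes>\<^bsub>proj_sections S U\<^esub> \<tau>) Q = hfrac S Q a s)"
      by (intro exI[of _ W] exI[of _ "e + e'"] exI[of _ "a \<otimes> b"] exI[of _ "s \<otimes> t"]) (auto intro: piece_mult)
  qed (use U in \<open>auto simp: proj_sections_def\<close>)
  show "\<sigma> \<oplus>\<^bsub>proj_sections S U\<^esub> \<tau> \<in> carrier (proj_sections S U)"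
  proof (rule section_intro)
    fix P assume "P \<in> U"
    from loc[OF this] obtain W e a s b e' t where W: "openin (zariski S) W" "P \<in> W" "W \<subseteq> U"
      "a \<in> piece S e" "s \<in> piece S e" "b \<in> piece S e'" "t \<in> piece S e'" "W \<subseteq> D (s \<otimes> t)"
      "\<And>Q. Q \<in> W \<Longrightarrow> (a, s) \<in> fracs Q \<and> (b, t) \<in> fracs Q \<and> \<sigma> Q = hfrac S Q a s \<and> \<tau> Q = hfrac S Q b t"
      by blast
    have "(\<sigma> \<oplus>\<^bsub>proj_sections S U\<^esub> \<tau>) Q = hfrac S Q (a \<otimes> t \<oplus> b \<otimes> s) (s \<otimes> t)" if "Q \<in> W" for Q
      using W that openin_points[OF W(1)] by (auto simp: proj_sections_def hloc_add)
    moreover have "b \<otimes> s \<in> piece S (e + e')"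
      using piece_mult[OF W(6) W(5)] by (simp add: add.commute)
    ultimately show "\<exists>W e a s. openin (zariski S) W \<and> P \<in> W \<and> a \<in> piece S e \<and> s \<in> piece S e \<and>
        W \<subseteq> D s \<and> (\<forall>Q \<in> W \<inter> U. (\<sigma> \<oplus>\<^bsub>proj_sections S U\<^esub> \<tau>) Q = hfrac S Q a s)"
      using W by (intro exI[of _ W] exI[of _ "e + e'"] exI[of _ "a \<otimes> t \<oplus> b \<otimes> s"] exI[of _ "s \<otimes> t"])
        (auto intro: piece_mult piece_add)
  qed (use U in \<open>auto simp: proj_sections_def\<close>)
qed

end


section \<open>Stalks of isomorphic schemes\<close>

lemma Proj_simps [simp]:
  "space (Proj S) = zariski S" "sections (Proj S) = proj_sections S"
  "restr (Proj S) = (\<lambda>U V \<sigma>. restrict \<sigma> V)"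
  "const (Proj S) = (\<lambda>c. \<lambda>P \<in> proj_points S. hfrac S P (scalar S c) \<one>\<^bsub>S\<^esub>)"
  by (simp_all add: Proj_def)

lemma (in graded_cring) points_D_one: "proj_points S \<subseteq> D \<one>"
  by (auto simp: D_def dest: one_notin)

text \<open>The map on stalks at P induced by (f, \<phi>): lift to a section, apply \<phi>, evaluate
  at P. The choice does not affect the result, by \<open>sections_agree\<close> and the naturality
  of \<phi>.\<close>

definition stalk_map ::
  "('a, 'k) graded_algebra \<Rightarrow> ('b set \<Rightarrow> 'a set) \<Rightarrow>
    ('a set set \<Rightarrow> ('a set \<Rightarrow> ('a \<times> 'a) set) \<Rightarrow> 'b set \<Rightarrow> ('b \<times> 'b) set) \<Rightarrow> 'b set \<Rightarrow>
    ('a \<times> 'a) set \<Rightarrow> ('b \<times> 'b) set" where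
  "stalk_map S f \<phi> P z = (SOME y. \<exists>V \<sigma>. openin (zariski S) V \<and> f P \<in> V \<and>
     \<sigma> \<in> carrier (proj_sections S V) \<and> \<sigma> (f P) = z \<and> y = \<phi> V \<sigma> P)"

definition stalk_const :: "('a, 'k) graded_algebra \<Rightarrow> 'a set \<Rightarrow> 'k \<Rightarrow> ('a \<times> 'a) set" where
  "stalk_const S P c = hfrac S P (scalar S c) \<one>\<^bsub>S\<^esub>"

definition algebra_hom :: "('r, 'm) ring_scheme \<Rightarrow> ('k \<Rightarrow> 'r) \<Rightarrow> ('t, 'n) ring_scheme \<Rightarrow> ('k \<Rightarrow> 't) \<Rightarrow> ('r \<Rightarrow> 't) \<Rightarrow> bool" where
  "algebra_hom R \<kappa> T \<mu> h \<longleftrightarrow> h \<in> ring_hom R T \<and> (\<forall>c. h (\<kappa> c) = \<mu> c)"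

lemma stalk_map_hom:
  fixes S :: "('a, 'k) graded_algebra" and T :: "('b, 'k) graded_algebra"
  assumes "graded_cring S" "graded_cring T" and mor: "morphism (Proj T) (Proj S) f \<phi>"
    and P: "P \<in> proj_points T"
  shows "\<And>V \<sigma>. openin (zariski S) V \<Longrightarrow> f P \<in> V \<Longrightarrow> \<sigma> \<in> carrier (proj_sections S V) \<Longrightarrow>
      stalk_map S f \<phi> P (\<sigma> (f P)) = \<phi> V \<sigma> P"
    and "f P \<in> proj_points S"
    and "algebra_hom (hloc S (f P)) (stalk_const S (f P)) (hloc T P) (stalk_const T P) (stalk_map S f \<phi> P)"
proof -
  interpret S: graded_cring S by fact
  interpret T: graded_cring T by fact
  show fP: "f P \<in> proj_points S"
    using mor P by (auto simp: morphism_def continuous_map_def)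
  have hom: "\<phi> V \<in> ring_hom (proj_sections S V) (proj_sections T (preimage (Proj T) f V))"
    if "openin (zariski S) V" for V
    using mor that by (simp add: morphism_def)
  have nat: "\<phi> W (restrict \<sigma> W) = restrict (\<phi> V \<sigma>) (preimage (Proj T) f W)"
    if "openin (zariski S) V" "openin (zariski S) W" "W \<subseteq> V" "\<sigma> \<in> carrier (proj_sections S V)" for V W \<sigma>
    using mor that by (simp add: morphism_def)
  have pre: "P \<in> preimage (Proj T) f V" if "f P \<in> V" for V
    using that P by (simp add: preimage_def)
  \<comment> \<open>Naturality moves the comparison to a neighbourhood on which the two sections
    coincide.\<close>
  have uniq: "\<phi> V \<sigma> P = \<phi> V' \<tau> P"
    if V: "openin (zariski S) V" "f P \<in> V" "\<sigma> \<in> carrier (proj_sections S V)"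
      and V': "openin (zariski S) V'" "f P \<in> V'" "\<tau> \<in> carrier (proj_sections S V')"
      and eq: "\<sigma> (f P) = \<tau> (f P)" for V V' \<sigma> \<tau>
  proof -
    obtain W where W: "openin (zariski S) W" "f P \<in> W" "W \<subseteq> V \<inter> V'" "restrict \<sigma> W = restrict \<tau> W"
      using S.sections_agree[OF V(3) V'(3) V(2) V'(2) eq] by blast
    have "restrict (\<phi> V \<sigma>) (preimage (Proj T) f W) = restrict (\<phi> V' \<tau>) (preimage (Proj T) f W)"
      using nat[OF V(1) W(1) _ V(3)] nat[OF V'(1) W(1) _ V'(3)] W(3,4) by simp
    from fun_cong[OF this, of P] show ?thesis
      using pre[OF W(2)] by simp
  qed
  show eq: "stalk_map S f \<phi> P (\<sigma> (f P)) = \<phi> V \<sigma> P"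
    if "openin (zariski S) V" "f P \<in> V" "\<sigma> \<in> carrier (proj_sections S V)" for V \<sigma>
    unfolding stalk_map_def using uniq[OF that] that by (intro some_equality) blast+
  have mem: "\<phi> V \<sigma> \<in> carrier (proj_sections T (preimage (Proj T) f V))"
    if "openin (zariski S) V" "\<sigma> \<in> carrier (proj_sections S V)" for V \<sigma>
    using hom[OF that(1)] that(2) by (rule ring_hom_closed)
  \<comment> \<open>Two germs are lifted over one common neighbourhood, so that ring operations can
    be carried out on sections.\<close>
  have two: "\<exists>W \<sigma> \<tau>. openin (zariski S) W \<and> f P \<in> W \<and> \<sigma> \<in> carrier (proj_sections S W) \<and>
      \<tau> \<in> carrier (proj_sections S W) \<and> x = \<sigma> (f P) \<and> y = \<tau> (f P)"
    if x: "x \<in> carrier (hloc S (f P))" and y: "y \<in> carrier (hloc S (f P))" for x y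
  proof -
    obtain V \<sigma> where V: "openin (zariski S) V" "f P \<in> V" "\<sigma> \<in> carrier (proj_sections S V)" "\<sigma> (f P) = x"
      using S.section_of_stalk[OF fP x] by blast
    obtain V' \<tau> where V': "openin (zariski S) V'" "f P \<in> V'" "\<tau> \<in> carrier (proj_sections S V')" "\<tau> (f P) = y"
      using S.section_of_stalk[OF fP y] by blast
    have W: "openin (zariski S) (V \<inter> V')"
      using V V' by blast
    show ?thesis
      using S.section_restrict[OF V(3) W] S.section_restrict[OF V'(3) W] V V' W
      by (intro exI[of _ "V \<inter> V'"] exI[of _ "restrict \<sigma> (V \<inter> V')"] exI[of _ "restrict \<tau> (V \<inter> V')"]) auto
  qed
  have "stalk_map S f \<phi> P \<in> ring_hom (hloc S (f P)) (hloc T P)"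
  proof (rule ring_hom_memI)
    fix x assume "x \<in> carrier (hloc S (f P))"
    then obtain V \<sigma> where V: "openin (zariski S) V" "f P \<in> V" "\<sigma> \<in> carrier (proj_sections S V)" "\<sigma> (f P) = x"
      using S.section_of_stalk[OF fP] by blast
    then show "stalk_map S f \<phi> P x \<in> carrier (hloc T P)"
      using eq[OF V(1-3)] T.section_mem[OF mem[OF V(1,3)] pre[OF V(2)]] by simp
  next
    fix x y assume "x \<in> carrier (hloc S (f P))" "y \<in> carrier (hloc S (f P))"
    from two[OF this] obtain W \<sigma> \<tau> where W: "openin (zariski S) W" "f P \<in> W"
      "\<sigma> \<in> carrier (proj_sections S W)" "\<tau> \<in> carrier (proj_sections S W)" and xy: "x = \<sigma> (f P)" "y = \<tau> (f P)"
      by blast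
    note prods = S.sections_mult_add[OF W(3,4,1)]
    have "x \<otimes>\<^bsub>hloc S (f P)\<^esub> y = (\<sigma> \<otimes>\<^bsub>proj_sections S W\<^esub> \<tau>) (f P)"
      "x \<oplus>\<^bsub>hloc S (f P)\<^esub> y = (\<sigma> \<oplus>\<^bsub>proj_sections S W\<^esub> \<tau>) (f P)"
      using W xy by (simp_all add: proj_sections_def)
    moreover have "\<phi> W (\<sigma> \<otimes>\<^bsub>proj_sections S W\<^esub> \<tau>) P = \<phi> W \<sigma> P \<otimes>\<^bsub>hloc T P\<^esub> \<phi> W \<tau> P"
      "\<phi> W (\<sigma> \<oplus>\<^bsub>proj_sections S W\<^esub> \<tau>) P = \<phi> W \<sigma> P \<oplus>\<^bsub>hloc T P\<^esub> \<phi> W \<tau> P"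
      using ring_hom_mult[OF hom[OF W(1)] W(3,4)] ring_hom_add[OF hom[OF W(1)] W(3,4)] pre[OF W(2)]
      by (simp_all add: proj_sections_def[of T])
    ultimately show "stalk_map S f \<phi> P (x \<otimes>\<^bsub>hloc S (f P)\<^esub> y) = stalk_map S f \<phi> P x \<otimes>\<^bsub>hloc T P\<^esub> stalk_map S f \<phi> P y"
      "stalk_map S f \<phi> P (x \<oplus>\<^bsub>hloc S (f P)\<^esub> y) = stalk_map S f \<phi> P x \<oplus>\<^bsub>hloc T P\<^esub> stalk_map S f \<phi> P y"
      using eq[OF W(1,2) prods(1)] eq[OF W(1,2) prods(2)] eq[OF W(1,2,3)] eq[OF W(1,2,4)] xy by simp_all
  next
    let ?X = "proj_points S"
    have X: "openin (zariski S) ?X"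
      using openin_topspace[of "zariski S"] by simp
    have "\<one>\<^bsub>proj_sections S ?X\<^esub> = (\<lambda>Q\<in>?X. hfrac S Q \<one>\<^bsub>S\<^esub> \<one>\<^bsub>S\<^esub>)"
      by (simp add: proj_sections_def S.hloc_one cong: restrict_cong)
    then have one: "\<one>\<^bsub>proj_sections S ?X\<^esub> \<in> carrier (proj_sections S ?X)"
      using S.frac_section[OF S.piece_one S.piece_one X] S.points_D_one by simp
    have "\<one>\<^bsub>hloc S (f P)\<^esub> = \<one>\<^bsub>proj_sections S ?X\<^esub> (f P)"
      using fP by (simp add: proj_sections_def)
    then show "stalk_map S f \<phi> P \<one>\<^bsub>hloc S (f P)\<^esub> = \<one>\<^bsub>hloc T P\<^esub>"
      using eq[OF X fP one] ring_hom_one[OF hom[OF X]] pre[OF fP] by (simp add: proj_sections_def)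
  qed
  moreover have "stalk_map S f \<phi> P (stalk_const S (f P) c) = stalk_const T P c" for c
  proof -
    let ?X = "proj_points S"
    have X: "openin (zariski S) ?X"
      using openin_topspace[of "zariski S"] by simp
    have c: "(\<lambda>Q\<in>?X. hfrac S Q (scalar S c) \<one>\<^bsub>S\<^esub>) \<in> carrier (proj_sections S ?X)"
      using S.frac_section[OF S.piece_scalar S.piece_one X] S.points_D_one by simp
    have "\<phi> ?X (\<lambda>Q\<in>?X. hfrac S Q (scalar S c) \<one>\<^bsub>S\<^esub>) = (\<lambda>Q\<in>proj_points T. hfrac T Q (scalar T c) \<one>\<^bsub>T\<^esub>)"
      using mor unfolding morphism_def by simp
    then show ?thesis
      using eq[OF X fP c] fP P by (simp add: stalk_const_def)
  qed
  ultimately show "algebra_hom (hloc S (f P)) (stalk_const S (f P)) (hloc T P) (stalk_const T P) (stalk_map S f \<phi> P)"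
    by (simp add: algebra_hom_def)
qed

text \<open>The stalk maps of the two morphisms invert each other because the section maps do. An
  isomorphism of hypersurfaces is exploited only through this consequence.\<close>

lemma isomorphic_stalks:
  fixes S :: "('a, 'k) graded_algebra" and T :: "('b, 'k) graded_algebra"
  assumes S: "graded_cring S" and T: "graded_cring T" and iso: "isomorphic (Proj S) (Proj T)"
    and Q: "Q \<in> proj_points T"
  obtains P h where "P \<in> proj_points S"
    "algebra_hom (hloc S P) (stalk_const S P) (hloc T Q) (stalk_const T Q) h"
    "bij_betw h (carrier (hloc S P)) (carrier (hloc T Q))"
proof -
  interpret S: graded_cring S by fact
  interpret T: graded_cring T by fact
  obtain f \<phi> g \<psi> where mor: "morphism (Proj S) (Proj T) f \<phi>" "morphism (Proj T) (Proj S) g \<psi>"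
    and inv: "\<forall>x \<in> proj_points S. g (f x) = x" "\<forall>y \<in> proj_points T. f (g y) = y"
      "\<And>V s. openin (zariski T) V \<Longrightarrow> s \<in> carrier (proj_sections T V) \<Longrightarrow>
           \<psi> (preimage (Proj S) f V) (\<phi> V s) = s"
      "\<And>U s. openin (zariski S) U \<Longrightarrow> s \<in> carrier (proj_sections S U) \<Longrightarrow>
           \<phi> (preimage (Proj T) g U) (\<psi> U s) = s"
    using iso unfolding isomorphic_def by (auto simp: S.topspace_zariski T.topspace_zariski)
  define P where "P = g Q"
  have fP: "f P = Q"
    using inv Q by (simp add: P_def)
  note g = stalk_map_hom[OF S T mor(2) Q, folded P_def]
  have P: "P \<in> proj_points S"
    by (rule g(2))
  note f = stalk_map_hom[OF T S mor(1) P, unfolded fP]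
  have opf: "openin (zariski S) (preimage (Proj S) f V)" if "openin (zariski T) V" for V
    using mor(1) that by (auto simp: morphism_def continuous_map_def preimage_def)
  have opg: "openin (zariski T) (preimage (Proj T) g V)" if "openin (zariski S) V" for V
    using mor(2) that by (auto simp: morphism_def continuous_map_def preimage_def)
  have homf: "\<phi> V \<sigma> \<in> carrier (proj_sections S (preimage (Proj S) f V))"
    if "openin (zariski T) V" "\<sigma> \<in> carrier (proj_sections T V)" for V \<sigma>
  proof -
    have "\<phi> V \<in> ring_hom (proj_sections T V) (proj_sections S (preimage (Proj S) f V))"
      using mor(1) that by (simp add: morphism_def)
    then show ?thesis
      using that(2) by (rule ring_hom_closed)
  qed
  have homg: "\<psi> V \<sigma> \<in> carrier (proj_sections T (preimage (Proj T) g V))"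
    if "openin (zariski S) V" "\<sigma> \<in> carrier (proj_sections S V)" for V \<sigma>
  proof -
    have "\<psi> V \<in> ring_hom (proj_sections S V) (proj_sections T (preimage (Proj T) g V))"
      using mor(2) that by (simp add: morphism_def)
    then show ?thesis
      using that(2) by (rule ring_hom_closed)
  qed
  let ?g = "stalk_map S g \<psi> Q" and ?f = "stalk_map T f \<phi> P"
  have "bij_betw ?g (carrier (hloc S P)) (carrier (hloc T Q))"
  proof (rule bij_betw_byWitness[where f'="?f"])
    show "\<forall>z\<in>carrier (hloc S P). ?f (?g z) = z"
    proof
      fix z assume "z \<in> carrier (hloc S P)"
      then obtain V \<sigma> where V: "openin (zariski S) V" "P \<in> V" "\<sigma> \<in> carrier (proj_sections S V)" "\<sigma> P = z"
        using S.section_of_stalk[OF P] by blast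
      have "?g z = \<psi> V \<sigma> Q"
        using g(1)[OF V(1-3)] V(4) by simp
      also have "?f (\<psi> V \<sigma> Q) = \<phi> (preimage (Proj T) g V) (\<psi> V \<sigma>) P"
        using V(2) Q by (intro f(1) opg homg V) (simp add: preimage_def P_def T.topspace_zariski)
      finally show "?f (?g z) = z"
        using inv(4)[OF V(1,3)] V(4) by simp
    qed
    show "\<forall>z\<in>carrier (hloc T Q). ?g (?f z) = z"
    proof
      fix z assume "z \<in> carrier (hloc T Q)"
      then obtain V \<sigma> where V: "openin (zariski T) V" "Q \<in> V" "\<sigma> \<in> carrier (proj_sections T V)" "\<sigma> Q = z"
        using T.section_of_stalk[OF Q] by blast
      have "?f z = \<phi> V \<sigma> P"
        using f(1)[OF V(1-3)] V(4) by simp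
      also have "?g (\<phi> V \<sigma> P) = \<psi> (preimage (Proj S) f V) (\<phi> V \<sigma>) Q"
        using V(2) P by (intro g(1) opf homf V) (simp add: preimage_def fP S.topspace_zariski)
      finally show "?g (?f z) = z"
        using inv(3)[OF V(1,3)] V(4) by simp
    qed
  qed (use f(3) g(3) in \<open>auto simp: algebra_hom_def dest: ring_hom_closed\<close>)
  with g(3) P show ?thesis
    using that by blast
qed


section \<open>A local invariant\<close>

definition nonunits :: "('r, 'm) ring_scheme \<Rightarrow> 'r set" where
  "nonunits R = carrier R - Units R"

text \<open>In a local ring this is the square of the maximal ideal: scalars can be absorbed into
  one factor, so sums of products suffice. The form without ideals transports easily along bijective
  homomorphisms.\<close>

inductive_set nonunits_square :: "('r, 'm) ring_scheme \<Rightarrow> 'r set" for R where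
  mult: "x \<in> nonunits R \<Longrightarrow> y \<in> nonunits R \<Longrightarrow> x \<otimes>\<^bsub>R\<^esub> y \<in> nonunits_square R"
| add: "x \<in> nonunits_square R \<Longrightarrow> y \<in> nonunits_square R \<Longrightarrow> x \<oplus>\<^bsub>R\<^esub> y \<in> nonunits_square R"

text \<open>The first conjunct says that the residue field is the base field, i.e. that the point is
  rational. The relation says that a product of r + 1 nonzero cotangent vectors, r of them equal,
  vanishes one order deeper than its degree. With \<open>indep\<close>, the vector of v must not be
  a multiple of that of u.\<close>

definition degenerate :: "bool \<Rightarrow> nat \<Rightarrow> ('r, 'm) ring_scheme \<Rightarrow> ('k \<Rightarrow> 'r) \<Rightarrow> bool" where
  "degenerate indep r R \<kappa> \<longleftrightarrow>
    (\<forall>z\<in>carrier R. \<exists>c. \<exists>y\<in>nonunits R. z = \<kappa> c \<oplus>\<^bsub>R\<^esub> y) \<and>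
    (\<exists>u\<in>nonunits R. \<exists>v\<in>nonunits R. \<exists>w\<in>nonunits R. \<exists>g\<in>carrier R.
      u [^]\<^bsub>R\<^esub> r \<otimes>\<^bsub>R\<^esub> v = w [^]\<^bsub>R\<^esub> (r + 2) \<otimes>\<^bsub>R\<^esub> g \<and>
      u \<notin> nonunits_square R \<and> v \<notin> nonunits_square R \<and>
      (indep \<longrightarrow> \<not> (\<exists>c. \<exists>m\<in>nonunits_square R. v = \<kappa> c \<otimes>\<^bsub>R\<^esub> u \<oplus>\<^bsub>R\<^esub> m)))"

text \<open>The property is phrased by ring operations, units and constants; a bijective
  homomorphism preserves and reflects all of these. The transfer runs backwards along
  \<open>h\<close>, and for R only closure of the operations is supplied.\<close>

lemma degenerate_transfer:
  fixes R :: "('r, 'm) ring_scheme" and T :: "('t, 'n) ring_scheme"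
  assumes hom: "algebra_hom R \<kappa> T \<mu> h" and bij: "bij_betw h (carrier R) (carrier T)"
    and R: "\<And>x y. x \<in> carrier R \<Longrightarrow> y \<in> carrier R \<Longrightarrow> x \<otimes>\<^bsub>R\<^esub> y \<in> carrier R"
      "\<And>x y. x \<in> carrier R \<Longrightarrow> y \<in> carrier R \<Longrightarrow> x \<oplus>\<^bsub>R\<^esub> y \<in> carrier R" "\<one>\<^bsub>R\<^esub> \<in> carrier R"
      "\<And>c. \<kappa> c \<in> carrier R"
    and deg: "degenerate i r T \<mu>"
  shows "degenerate i r R \<kappa>"
proof -
  have h: "h \<in> ring_hom R T" "\<And>c. h (\<kappa> c) = \<mu> c"
    using hom by (auto simp: algebra_hom_def)
  have inj: "x = y" if "h x = h y" "x \<in> carrier R" "y \<in> carrier R" for x y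
    using bij that by (auto simp: bij_betw_def inj_on_def)
  have surj: "\<exists>x\<in>carrier R. y = h x" if "y \<in> carrier T" for y
    using bij that by (auto simp: bij_betw_def)
  note [simp] = ring_hom_mult[OF h(1)] ring_hom_add[OF h(1)] ring_hom_one[OF h(1)] ring_hom_closed[OF h(1)] R h(2)
  have unit: "h x \<in> Units T \<longleftrightarrow> x \<in> Units R" if x: "x \<in> carrier R" for x
  proof
    assume "h x \<in> Units T"
    then obtain y where y: "y \<in> carrier T" "y \<otimes>\<^bsub>T\<^esub> h x = \<one>\<^bsub>T\<^esub>" "h x \<otimes>\<^bsub>T\<^esub> y = \<one>\<^bsub>T\<^esub>"
      by (auto simp: Units_def)
    then obtain z where z: "z \<in> carrier R" "y = h z"
      using surj by blast
    have "z \<otimes>\<^bsub>R\<^esub> x = \<one>\<^bsub>R\<^esub>" "x \<otimes>\<^bsub>R\<^esub> z = \<one>\<^bsub>R\<^esub>"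
      using y z x by (auto intro!: inj)
    with x z show "x \<in> Units R"
      by (auto simp: Units_def)
  next
    assume "x \<in> Units R"
    then obtain z where z: "z \<in> carrier R" "z \<otimes>\<^bsub>R\<^esub> x = \<one>\<^bsub>R\<^esub>" "x \<otimes>\<^bsub>R\<^esub> z = \<one>\<^bsub>R\<^esub>"
      by (auto simp: Units_def)
    then have "h z \<otimes>\<^bsub>T\<^esub> h x = \<one>\<^bsub>T\<^esub>" "h x \<otimes>\<^bsub>T\<^esub> h z = \<one>\<^bsub>T\<^esub>"
      using x by (simp_all flip: ring_hom_mult[OF h(1)])
    with x z show "h x \<in> Units T"
      by (auto simp: Units_def)
  qed
  have non: "y \<in> nonunits T \<longleftrightarrow> (\<exists>x\<in>nonunits R. y = h x)" for y
    using surj unit by (auto simp: nonunits_def)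
  have non': "x \<in> carrier R" if "x \<in> nonunits R" for x
    using that by (simp add: nonunits_def)
  have sq_carr: "x \<in> carrier R" if "x \<in> nonunits_square R" for x
    using that by induction (simp_all add: non')
  have sq: "h x \<in> nonunits_square T" if "x \<in> nonunits_square R" for x
    using that
  proof induction
    case (mult x y)
    then have "h x \<in> nonunits T" "h y \<in> nonunits T"
      using non by blast+
    with mult show ?case
      by (simp add: non' nonunits_square.mult)
  next
    case (add x y)
    then show ?case
      by (simp add: sq_carr nonunits_square.add)
  qed
  have pow_carr: "x [^]\<^bsub>R\<^esub> (k::nat) \<in> carrier R" if "x \<in> carrier R" for x k
    using that by (induction k) (simp_all add: nat_pow_def)
  have pow: "h (x [^]\<^bsub>R\<^esub> (k::nat)) = h x [^]\<^bsub>T\<^esub> k" if "x \<in> carrier R" for x k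
  proof (induction k)
    case (Suc k)
    then show ?case
      using pow_carr[OF that, of k] that by (simp add: nat_pow_def)
  qed (simp add: nat_pow_def)
  have "\<exists>c. \<exists>y\<in>nonunits R. z = \<kappa> c \<oplus>\<^bsub>R\<^esub> y" if z: "z \<in> carrier R" for z
  proof -
    have "h z \<in> carrier T"
      using z by simp
    then obtain c y where y: "y \<in> nonunits T" "h z = \<mu> c \<oplus>\<^bsub>T\<^esub> y"
      using deg unfolding degenerate_def by meson
    then obtain x where x: "x \<in> nonunits R" "y = h x"
      using non by blast
    have "z = \<kappa> c \<oplus>\<^bsub>R\<^esub> x"
      using y x z non'[OF x(1)] by (intro inj) simp_all
    with x show ?thesis by blast
  qed
  moreover obtain u v w g where 1: "u \<in> nonunits T" "v \<in> nonunits T" "w \<in> nonunits T" "g \<in> carrier T"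
      and eq: "u [^]\<^bsub>T\<^esub> r \<otimes>\<^bsub>T\<^esub> v = w [^]\<^bsub>T\<^esub> (r + 2) \<otimes>\<^bsub>T\<^esub> g"
      and nsq: "u \<notin> nonunits_square T" "v \<notin> nonunits_square T"
        "i \<longrightarrow> \<not> (\<exists>c. \<exists>m\<in>nonunits_square T. v = \<mu> c \<otimes>\<^bsub>T\<^esub> u \<oplus>\<^bsub>T\<^esub> m)"
    using deg unfolding degenerate_def by meson
  obtain u' v' w' g' where 2: "u' \<in> nonunits R" "u = h u'" "v' \<in> nonunits R" "v = h v'"
      "w' \<in> nonunits R" "w = h w'" "g' \<in> carrier R" "g = h g'"
    using 1 non surj by meson
  note 3 = 2(1)[THEN non'] 2(3)[THEN non'] 2(5)[THEN non'] 2(7)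
  have "u' [^]\<^bsub>R\<^esub> r \<otimes>\<^bsub>R\<^esub> v' = w' [^]\<^bsub>R\<^esub> (r + 2) \<otimes>\<^bsub>R\<^esub> g'"
  proof (rule inj)
    show "h (u' [^]\<^bsub>R\<^esub> r \<otimes>\<^bsub>R\<^esub> v') = h (w' [^]\<^bsub>R\<^esub> (r + 2) \<otimes>\<^bsub>R\<^esub> g')"
      using eq 2 3 pow pow_carr by simp
  qed (use 3 pow_carr in auto)
  moreover have "u' \<notin> nonunits_square R" "v' \<notin> nonunits_square R"
    using sq nsq 2 by auto
  moreover have "\<not> (\<exists>c. \<exists>m\<in>nonunits_square R. v' = \<kappa> c \<otimes>\<^bsub>R\<^esub> u' \<oplus>\<^bsub>R\<^esub> m)" if i
  proof
    assume "\<exists>c. \<exists>m\<in>nonunits_square R. v' = \<kappa> c \<otimes>\<^bsub>R\<^esub> u' \<oplus>\<^bsub>R\<^esub> m"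
    then obtain c m where m: "m \<in> nonunits_square R" "v' = \<kappa> c \<otimes>\<^bsub>R\<^esub> u' \<oplus>\<^bsub>R\<^esub> m"
      by blast
    have "v = \<mu> c \<otimes>\<^bsub>T\<^esub> u \<oplus>\<^bsub>T\<^esub> h m"
      unfolding 2 m(2) using 3 sq_carr[OF m(1)] by simp
    with sq[OF m(1)] nsq that show False by blast
  qed
  ultimately show ?thesis
    unfolding degenerate_def using 2 by blast
qed

lemma (in graded_cring) degenerate_stalk_transfer:
  fixes T :: "('b, 'k) graded_algebra"
  assumes "graded_cring T" "isomorphic (Proj S) (Proj T)" "Q \<in> proj_points T"
    and "degenerate i r (hloc T Q) (stalk_const T Q)"
  obtains P where "P \<in> proj_points S" "degenerate i r (hloc S P) (stalk_const S P)"
proof -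
  obtain P h where P: "P \<in> proj_points S"
    and h: "algebra_hom (hloc S P) (stalk_const S P) (hloc T Q) (stalk_const T Q) h"
      "bij_betw h (carrier (hloc S P)) (carrier (hloc T Q))"
    using isomorphic_stalks[OF graded_cring_axioms assms(1-3)] by blast
  have "degenerate i r (hloc S P) (stalk_const S P)"
  proof (rule degenerate_transfer[OF h _ _ _ _ assms(4)])
    fix x y assume "x \<in> carrier (hloc S P)" "y \<in> carrier (hloc S P)"
    then obtain a s b t where "(a, s) \<in> fracs P" "x = hfrac S P a s" "(b, t) \<in> fracs P" "y = hfrac S P b t"
      using hloc_carrierE[OF P] by metis
    then show "x \<otimes>\<^bsub>hloc S P\<^esub> y \<in> carrier (hloc S P)" "x \<oplus>\<^bsub>hloc S P\<^esub> y \<in> carrier (hloc S P)"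
      using P by (simp_all add: hloc_mult hloc_add hloc_carrierI fracs_mult fracs_add)
  qed (simp_all add: P hloc_one stalk_const_def hloc_carrierI fracs_one)
  with P show ?thesis
    using that by blast
qed


section \<open>Morphisms between hypersurface complements\<close>

lemma poly_alg_simps [simp]:
  "carrier (poly_alg n) = polys n" "mult (poly_alg n) = (*)" "one (poly_alg n) = 1"
  "zero (poly_alg n) = 0" "add (poly_alg n) = (+)" "piece (poly_alg n) = forms n"
  "scalar (poly_alg n) = cst"
  by (simp_all add: poly_alg_def)

lemma cring_poly_alg: "cring (poly_alg n :: ('k::field mpoly, 'k) graded_algebra)"
proof (rule cringI)
  show "abelian_group (poly_alg n :: ('k mpoly, 'k) graded_algebra)"
  proof (rule abelian_groupI)
    fix x :: "'k mpoly" assume "x \<in> carrier (poly_alg n)"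
    then show "\<exists>y\<in>carrier (poly_alg n). y \<oplus>\<^bsub>poly_alg n\<^esub> x = \<zero>\<^bsub>poly_alg n\<^esub>"
      by (intro bexI[of _ "- x"]) auto
  qed (auto simp: algebra_simps)
  show "Group.comm_monoid (poly_alg n :: ('k mpoly, 'k) graded_algebra)"
    by (rule comm_monoidI) (auto simp: algebra_simps)
qed (auto simp: algebra_simps)

interpretation poly: graded_cring "poly_alg n :: ('k::field mpoly, 'k) graded_algebra" for n
proof (rule graded_cring.intro[OF cring_poly_alg], unfold_locales)
qed (auto simp: forms_polys intro: forms_mult)

lemma polys_neg_1 [simp]: "- 1 \<in> (polys n :: 'k::comm_ring_1 mpoly set)"
  using polys_uminus[OF polys_1] .

section \<open>Homogeneous parts and homogeneous primes of the polynomial ring\<close>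

definition homog_part :: "nat \<Rightarrow> 'k::comm_ring_1 mpoly \<Rightarrow> 'k mpoly" where
  "homog_part e p =
    (\<Sum>m \<in> {m \<in> Poly_Mapping.keys p. monom_degree m = e}. Poly_Mapping.single m (Poly_Mapping.lookup p m))"

lemma lookup_homog_part:
  "Poly_Mapping.lookup (homog_part e p) m = (if monom_degree m = e then Poly_Mapping.lookup p m else 0)"
proof -
  have "Poly_Mapping.lookup (homog_part e p) m =
      (\<Sum>m' \<in> {m \<in> Poly_Mapping.keys p. monom_degree m = e}. if m' = m then Poly_Mapping.lookup p m else 0)"
    unfolding homog_part_def lookup_sum by (intro sum.cong) (auto simp: lookup_single)
  then show ?thesis
    by (simp add: in_keys_iff)
qed

lemma homog_part_add: "homog_part e (p + q) = homog_part e p + homog_part e q"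
  by (rule poly_mapping_eqI) (simp add: lookup_homog_part lookup_add)

lemma homog_part_0 [simp]: "homog_part e 0 = 0"
  by (simp add: homog_part_def)

lemma homog_part_sum: "homog_part e (sum F A) = (\<Sum>i\<in>A. homog_part e (F i))"
  by (induction A rule: infinite_finite_induct) (simp_all add: homog_part_add)

lemma homog_part_form: "p \<in> forms n i \<Longrightarrow> homog_part e p = (if e = i then p else 0)"
  by (rule poly_mapping_eqI) (auto simp: lookup_homog_part forms_def in_keys_iff)

lemma sum_in_point:
  assumes "P \<in> proj_points (poly_alg n :: ('k::field mpoly, 'k) graded_algebra)"
    "\<And>i. i \<in> A \<Longrightarrow> F i \<in> P"
  shows "sum F A \<in> P"
  using assms(2)
  by (induction A rule: infinite_finite_induct)
    (use poly.zero_in[OF assms(1)] poly.in_add[OF assms(1)] in auto)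

text \<open>The polynomials all of whose homogeneous parts lie in P form an ideal. It contains the
  homogeneous elements of P, which generate P.\<close>

lemma homog_part_in_point:
  fixes P :: "'k::field mpoly set"
  assumes P: "P \<in> proj_points (poly_alg n)" and p: "p \<in> P"
  shows "homog_part e p \<in> P"
proof -
  define J where "J = {p \<in> polys n. \<forall>e. homog_part e p \<in> P}"
  have J_mult: "q * p \<in> J" if p: "p \<in> J" and q: "q \<in> polys n" for p q
  proof -
    from p have "p \<in> polys n"
      by (simp add: J_def)
    then obtain G M where G': "\<forall>e. G e \<in> forms n e" "p = (\<Sum>e<M. G e)"
      by (rule polys_forms_decomp)
    obtain F N where F': "\<forall>e. F e \<in> forms n e" "q = (\<Sum>e<N. F e)"
      using q by (rule polys_forms_decomp)
    note G = G'(1)[rule_format] G'(2) and F = F'(1)[rule_format] F'(2)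
    have "homog_part j p = G j" if "j < M" for j
      using that unfolding G(2) homog_part_sum by (simp add: homog_part_form[OF G(1)])
    then have GP: "G j \<in> P" if "j < M" for j
      using that p unfolding J_def by (metis (mono_tags, lifting) mem_Collect_eq)
    have "homog_part e (q * p) \<in> P" for e
    proof -
      have "homog_part e (F i * G j) \<in> P" if "j < M" for i j
        using homog_part_form[OF forms_mult[OF F(1)[of i] G(1)[of j] refl], of e]
          poly.in_mult(1)[OF P, of "F i" "G j"] GP[OF that] forms_polys[OF F(1)] poly.zero_in[OF P] by auto
      then show ?thesis
        unfolding F(2) G(2) sum_product homog_part_sum by (intro sum_in_point[OF P]) auto
    qed
    with p q show ?thesis
      by (auto simp: J_def)
  qed
  have "ideal J (poly_alg n)"
  proof (rule idealI)
    show "subgroup J (add_monoid (poly_alg n))"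
    proof (rule poly.add.subgroupI)
      fix a assume "a \<in> J"
      from J_mult[OF this, of "- 1"] have "- a \<in> J"
        by simp
      moreover have "\<ominus>\<^bsub>poly_alg n\<^esub> a = - a"
        using \<open>a \<in> J\<close> by (intro poly.minus_equality) (auto simp: J_def)
      ultimately show "\<ominus>\<^bsub>poly_alg n\<^esub> a \<in> J"
        by simp
    next
      have "0 \<in> J"
        using poly.zero_in[OF P] by (simp add: J_def)
      then show "J \<noteq> {}" by blast
    qed (use poly.in_add[OF P] in \<open>auto simp: J_def homog_part_add\<close>)
  qed (use J_mult in \<open>auto simp: mult.commute poly.ring_axioms\<close>)
  moreover have "P \<inter> homogeneous_elems (poly_alg n) \<subseteq> J"
    using poly.zero_in[OF P] forms_polys
    by (auto simp: homogeneous_elems_def J_def homog_part_form)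
  ultimately have "Idl\<^bsub>poly_alg n\<^esub> (P \<inter> homogeneous_elems (poly_alg n)) \<subseteq> J"
    by (rule poly.genideal_minimal)
  then show ?thesis
    using p P by (auto simp: proj_points_def J_def)
qed

text \<open>The image of the point P under the rational map [A 0 : ... : A n], as the contraction of
  a prime ideal along the substitution.\<close>

definition pullback :: "nat \<Rightarrow> (nat \<Rightarrow> 'k::field mpoly) \<Rightarrow> 'k mpoly set \<Rightarrow> 'k mpoly set" where
  "pullback n A P = {a \<in> polys n. subst cst A a \<in> P}"

lemma prime_pullback:
  fixes A :: "nat \<Rightarrow> 'k::field mpoly"
  assumes A: "\<And>i. i \<le> n \<Longrightarrow> A i \<in> forms n N" and P: "P \<in> proj_points (poly_alg n)"
  shows "primeideal (pullback n A P) (poly_alg n)"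
proof (rule primeidealI)
  have polysA: "subst cst A a \<in> polys n" if "a \<in> polys n" for a
    using that A forms_polys by (intro polys_subst) auto
  show "ideal (pullback n A P) (poly_alg n)"
  proof (rule idealI)
    show "subgroup (pullback n A P) (add_monoid (poly_alg n))"
    proof (rule poly.add.subgroupI)
      fix a assume a: "a \<in> pullback n A P"
      have "subst cst A a \<in> P"
        using a by (simp add: pullback_def)
      from poly.in_mult(1)[OF P _ this, of "- 1"] have "(- 1) * subst cst A a \<in> P"
        by simp
      moreover have "\<ominus>\<^bsub>poly_alg n\<^esub> a = - a"
        using a by (intro poly.minus_equality) (auto simp: pullback_def)
      ultimately show "\<ominus>\<^bsub>poly_alg n\<^esub> a \<in> pullback n A P"
        using a polys_uminus by (auto simp: pullback_def)
    next
      have "0 \<in> pullback n A P"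
        using poly.zero_in[OF P] by (simp add: pullback_def)
      then show "pullback n A P \<noteq> {}" by blast
    qed (use poly.in_add[OF P] in \<open>auto simp: pullback_def\<close>)
  qed (use poly.in_mult[OF P] polysA in \<open>auto simp: pullback_def poly.ring_axioms\<close>)
  show "cring (poly_alg n :: ('k mpoly, 'k) graded_algebra)"
    by (rule cring_poly_alg)
  show "carrier (poly_alg n) \<noteq> pullback n A P"
  proof
    assume "carrier (poly_alg n) = pullback n A P"
    moreover have "1 \<in> carrier (poly_alg n :: ('k mpoly, 'k) graded_algebra)"
      by simp
    ultimately have "1 \<in> pullback n A P"
      by blast
    then show False
      using poly.one_notin[OF P] by (simp add: pullback_def)
  qed
next
  fix a b assume *: "a \<in> carrier (poly_alg n)" "b \<in> carrier (poly_alg n)"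
    "a \<otimes>\<^bsub>poly_alg n\<^esub> b \<in> pullback n A P"
  have polysA: "subst cst A a \<in> polys n" if "a \<in> polys n" for a
    using that A forms_polys by (intro polys_subst) auto
  show "a \<in> pullback n A P \<or> b \<in> pullback n A P"
    using * poly.mult_notin[OF P, of "subst cst A a" "subst cst A b"] polysA by (auto simp: pullback_def)
qed

text \<open>An element is the sum of its homogeneous parts, which are by assumption among the
  homogeneous members of the ideal.\<close>

lemma homogeneous_generated:
  fixes P :: "'k::field mpoly set"
  assumes "ideal P (poly_alg n)" "\<And>a e. a \<in> P \<Longrightarrow> homog_part e a \<in> P"
  shows "P = Idl\<^bsub>poly_alg n\<^esub> (P \<inter> homogeneous_elems (poly_alg n))"
proof
  interpret ideal P "poly_alg n" by fact
  let ?X = "P \<inter> homogeneous_elems (poly_alg n)"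
  have X: "?X \<subseteq> carrier (poly_alg n)"
    using a_subset by auto
  show "Idl\<^bsub>poly_alg n\<^esub> ?X \<subseteq> P"
    by (rule poly.genideal_minimal[OF assms(1)]) auto
  interpret I: ideal "Idl\<^bsub>poly_alg n\<^esub> ?X" "poly_alg n"
    by (rule poly.genideal_ideal[OF X])
  show "P \<subseteq> Idl\<^bsub>poly_alg n\<^esub> ?X"
  proof
    fix a assume a: "a \<in> P"
    then have "a \<in> polys n"
      using a_subset by auto
    then obtain F N where F': "\<forall>e. F e \<in> forms n e" "a = (\<Sum>e<N. F e)"
      by (rule polys_forms_decomp)
    note F = F'(1)[rule_format] F'(2)
    have "F e \<in> Idl\<^bsub>poly_alg n\<^esub> ?X" if "e < N" for e
    proof -
      have "homog_part e a = F e"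
        using that unfolding F(2) homog_part_sum by (simp add: homog_part_form[OF F(1)])
      then have "F e \<in> P"
        using assms(2)[OF a, of e] by simp
      then have "F e \<in> ?X"
        using F(1) by (auto simp: homogeneous_elems_def)
      then show ?thesis
        using poly.genideal_self[OF X] by blast
    qed
    moreover have "sum F K \<in> Idl\<^bsub>poly_alg n\<^esub> ?X" if "\<And>e. e \<in> K \<Longrightarrow> F e \<in> Idl\<^bsub>poly_alg n\<^esub> ?X" for K
      using that by (induction K rule: infinite_finite_induct)
        (use I.zero_closed I.a_closed in auto)
    ultimately show "a \<in> Idl\<^bsub>poly_alg n\<^esub> ?X"
      unfolding F(2) by (meson lessThan_iff)
  qed
qed

text \<open>Where all \<open>A i\<close> vanish, the contraction contains the irrelevant ideal and
  is no point. The form f of positive degree, not vanishing at the image, excludes this.\<close>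

lemma pullback_point:
  fixes A :: "nat \<Rightarrow> 'k::field mpoly"
  assumes A: "\<And>i. i \<le> n \<Longrightarrow> A i \<in> forms n N" and N: "N > 0" and P: "P \<in> proj_points (poly_alg n)"
    and f: "f \<in> forms n d" "d > 0" "subst cst A f \<notin> P"
  shows "pullback n A P \<in> proj_points (poly_alg n)"
proof -
  have polysA: "subst cst A a \<in> polys n" if "a \<in> polys n" for a
    using that A forms_polys by (intro polys_subst) auto
  interpret primeideal "pullback n A P" "poly_alg n"
    using A P by (rule prime_pullback)
  have gen: "pullback n A P = Idl\<^bsub>poly_alg n\<^esub> (pullback n A P \<inter> homogeneous_elems (poly_alg n))"
  proof (rule homogeneous_generated)
    fix a e assume a: "a \<in> pullback n A P"
    then have "a \<in> polys n"
      by (simp add: pullback_def)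
    then obtain F M where F': "\<forall>e. F e \<in> forms n e" "a = (\<Sum>e<M. F e)"
      by (rule polys_forms_decomp)
    note F = F'(1)[rule_format] F'(2)
    have comp: "homog_part e a = (if e < M then F e else 0)"
      unfolding F(2) homog_part_sum by (simp add: homog_part_form[OF F(1)])
    have AF: "subst cst A (F i) \<in> forms n (i * N)" for i
      using forms_subst[OF F(1)] A by blast
    \<comment> \<open>The substitution multiplies degrees by N > 0, so distinct parts of
      \<open>a\<close> land in distinct degrees and can be separated in P.\<close>
    have "homog_part (e * N) (subst cst A a) = (\<Sum>i<M. if e * N = i * N then subst cst A (F i) else 0)"
      unfolding F(2) cst.subst_sum homog_part_sum by (simp add: homog_part_form[OF AF])
    moreover have "homog_part (e * N) (subst cst A a) \<in> P"
      using a by (intro homog_part_in_point[OF P]) (simp add: pullback_def)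
    ultimately have sumP: "(\<Sum>i<M. if e * N = i * N then subst cst A (F i) else 0) \<in> P"
      by simp
    from N have "(\<Sum>i<M. if e * N = i * N then subst cst A (F i) else 0) = (if e < M then subst cst A (F e) else 0)"
      by simp
    with sumP comp show "homog_part e a \<in> pullback n A P"
      using forms_polys[OF F(1)] by (auto simp: pullback_def split: if_splits)
  qed (rule ideal_axioms)
  have "f \<in> irrelevant_ideal (poly_alg n)"
  proof -
    have "f \<in> (\<Union>e \<in> {0<..}. piece (poly_alg n) e)"
      using f(1,2) by auto
    moreover have "(\<Union>e \<in> {0<..}. piece (poly_alg n) e) \<subseteq> carrier (poly_alg n :: ('k mpoly, 'k) graded_algebra)"
      using forms_polys by auto
    ultimately show ?thesis
      unfolding irrelevant_ideal_def using poly.genideal_self by blast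
  qed
  moreover have "f \<notin> pullback n A P"
    using f(3) by (simp add: pullback_def)
  ultimately have "\<not> irrelevant_ideal (poly_alg n) \<subseteq> pullback n A P"
    by blast
  with gen show ?thesis
    unfolding proj_points_def by (intro CollectI conjI primeideal_axioms)
qed

text \<open>As for the operations of \<open>hloc\<close>, a union over representatives;
  \<open>pull_frac_hfrac\<close> shows that all members coincide.\<close>

definition pull_frac :: "nat \<Rightarrow> (nat \<Rightarrow> 'k::field mpoly) \<Rightarrow> 'k mpoly set \<Rightarrow>
    ('k mpoly \<times> 'k mpoly) set \<Rightarrow> ('k mpoly \<times> 'k mpoly) set" where
  "pull_frac n A P z = (\<Union>(a, s) \<in> z. hfrac (poly_alg n) P (subst cst A a) (subst cst A s))"

definition pull_section where
  "pull_section n A f' V \<sigma> =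
    (\<lambda>P \<in> preimage (hypersurface_complement n f') (pullback n A) V. pull_frac n A P (\<sigma> (pullback n A P)))"

lemma complement_simps [simp]:
  fixes f :: "'k::field mpoly"
  shows "sections (hypersurface_complement n f) = proj_sections (poly_alg n)"
    "restr (hypersurface_complement n f) = (\<lambda>U V \<sigma>. restrict \<sigma> V)"
    "space (hypersurface_complement n f) = subtopology (zariski (poly_alg n)) (poly.D n f)"
    "const (hypersurface_complement n f) = (\<lambda>c. \<lambda>P \<in> poly.D n f. hfrac (poly_alg n) P (cst c) 1)"
proof -
  have D: "proj_points (poly_alg n) - {P. f \<in> P} = poly.D n f"
    by (auto simp: poly.D_def)
  moreover have "proj_points (poly_alg n) \<inter> poly.D n f = poly.D n f"
    by (auto simp: poly.D_def)
  ultimately show "sections (hypersurface_complement n f) = proj_sections (poly_alg n)"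
    "restr (hypersurface_complement n f) = (\<lambda>U V \<sigma>. restrict \<sigma> V)"
    "space (hypersurface_complement n f) = subtopology (zariski (poly_alg n)) (poly.D n f)"
    "const (hypersurface_complement n f) = (\<lambda>c. \<lambda>P \<in> poly.D n f. hfrac (poly_alg n) P (cst c) 1)"
    by (auto simp: hypersurface_complement_def open_subspace_def restrict_restrict)
qed

lemma openin_complement:
  fixes f :: "'k::field mpoly"
  assumes "f \<in> forms n d"
  shows "openin (space (hypersurface_complement n f)) U \<longleftrightarrow>
    openin (zariski (poly_alg n)) U \<and> U \<subseteq> poly.D n f"
  using assms by (simp add: openin_open_subtopology poly.openin_D poly.homogI)

lemma preimage_complement:
  "preimage (hypersurface_complement n f) g V = {P \<in> poly.D n f. g P \<in> V}"
  by (auto simp: preimage_def poly.D_def)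

text \<open>Invertibility spreads out: if the section is a/s near P with a outside P, then s/a is an
  inverse on the part of the neighbourhood inside \<open>D a\<close>. This reduces the locality
  condition on morphisms to stalks.\<close>

lemma germ_unit_complement_iff:
  fixes f :: "'k::field mpoly"
  assumes f: "f \<in> forms n d" and U: "openin (space (hypersurface_complement n f)) U"
    and \<sigma>: "\<sigma> \<in> carrier (proj_sections (poly_alg n) U)" and P: "P \<in> U"
  shows "germ_unit (hypersurface_complement n f) U \<sigma> P \<longleftrightarrow> \<sigma> P \<in> Units (hloc (poly_alg n) P)"
proof
  assume "germ_unit (hypersurface_complement n f) U \<sigma> P"
  then obtain W where "P \<in> W" "restrict \<sigma> W \<in> Units (proj_sections (poly_alg n) W)"
    by (auto simp: germ_unit_def)
  then obtain \<tau> where W: "P \<in> W" "restrict \<sigma> W \<in> carrier (proj_sections (poly_alg n) W)"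
    "\<tau> \<in> carrier (proj_sections (poly_alg n) W)"
    and inv: "\<tau> \<otimes>\<^bsub>proj_sections (poly_alg n) W\<^esub> restrict \<sigma> W = \<one>\<^bsub>proj_sections (poly_alg n) W\<^esub>"
      "restrict \<sigma> W \<otimes>\<^bsub>proj_sections (poly_alg n) W\<^esub> \<tau> = \<one>\<^bsub>proj_sections (poly_alg n) W\<^esub>"
    by (auto simp: Units_def)
  have "\<tau> P \<otimes>\<^bsub>hloc (poly_alg n) P\<^esub> \<sigma> P = \<one>\<^bsub>hloc (poly_alg n) P\<^esub>"
    "\<sigma> P \<otimes>\<^bsub>hloc (poly_alg n) P\<^esub> \<tau> P = \<one>\<^bsub>hloc (poly_alg n) P\<^esub>"
    using fun_cong[OF inv(1), of P] fun_cong[OF inv(2), of P] W(1) by (simp_all add: proj_sections_def)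
  moreover have "\<sigma> P \<in> carrier (hloc (poly_alg n) P)" "\<tau> P \<in> carrier (hloc (poly_alg n) P)"
    using poly.section_mem[OF W(2,1)] poly.section_mem[OF W(3,1)] W(1) by simp_all
  ultimately show "\<sigma> P \<in> Units (hloc (poly_alg n) P)"
    by (auto simp: Units_def)
next
  assume unit: "\<sigma> P \<in> Units (hloc (poly_alg n) P)"
  obtain W a e s where W: "openin (zariski (poly_alg n)) W" "P \<in> W" "W \<subseteq> U"
    "a \<in> piece (poly_alg n) e" "s \<in> piece (poly_alg n) e" "W \<subseteq> poly.D n s"
    "\<forall>Q\<in>W. \<sigma> Q = hfrac (poly_alg n) Q a s"
    using \<sigma> P by (rule poly.section_local)
  have "P \<in> proj_points (poly_alg n)" "(a, s) \<in> poly.fracs n P"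
    using W by (auto simp: poly.D_def intro!: poly.fracsI)
  then have "a \<notin> P"
    using unit W by (simp add: poly.hloc_unit_iff)
  define V where "V = W \<inter> poly.D n a"
  have V: "openin (zariski (poly_alg n)) V" "V \<subseteq> U" "P \<in> V" "V \<subseteq> poly.D n a" "V \<subseteq> W"
    unfolding V_def using W \<open>a \<notin> P\<close> \<open>P \<in> proj_points _\<close>
    by (auto intro!: openin_Int poly.openin_D poly.homogI) (auto simp: poly.D_def)
  define \<tau> where "\<tau> = (\<lambda>Q\<in>V. hfrac (poly_alg n) Q s a)"
  have \<tau>: "\<tau> \<in> carrier (proj_sections (poly_alg n) V)"
    unfolding \<tau>_def by (rule poly.frac_section[OF W(5,4) V(1,4)])
  have \<sigma>V: "restrict \<sigma> V \<in> carrier (proj_sections (poly_alg n) V)"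
    by (rule poly.section_restrict[OF \<sigma> V(1,2)])
  have inv: "hfrac (poly_alg n) Q s a \<otimes>\<^bsub>hloc (poly_alg n) Q\<^esub> hfrac (poly_alg n) Q a s = hfrac (poly_alg n) Q 1 1"
    "hfrac (poly_alg n) Q a s \<otimes>\<^bsub>hloc (poly_alg n) Q\<^esub> hfrac (poly_alg n) Q s a = hfrac (poly_alg n) Q 1 1"
    if "Q \<in> V" for Q
  proof -
    have Q: "Q \<in> proj_points (poly_alg n)" "a \<notin> Q" "s \<notin> Q"
      using that V W by (auto simp: poly.D_def)
    have fr: "(a, s) \<in> poly.fracs n Q" "(s, a) \<in> poly.fracs n Q"
      using W Q by (auto intro!: poly.fracsI)
    show "hfrac (poly_alg n) Q s a \<otimes>\<^bsub>hloc (poly_alg n) Q\<^esub> hfrac (poly_alg n) Q a s = hfrac (poly_alg n) Q 1 1"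
      "hfrac (poly_alg n) Q a s \<otimes>\<^bsub>hloc (poly_alg n) Q\<^esub> hfrac (poly_alg n) Q s a = hfrac (poly_alg n) Q 1 1"
      unfolding poly.hloc_mult[OF Q(1) fr] poly.hloc_mult[OF Q(1) fr(2,1)]
      using poly.hfrac_eqI[OF Q(1) poly.fracs_mult[OF Q(1) fr] poly.fracs_one(1)[OF Q(1)]]
        poly.hfrac_eqI[OF Q(1) poly.fracs_mult[OF Q(1) fr(2,1)] poly.fracs_one(1)[OF Q(1)]]
      by (simp_all add: mult.commute)
  qed
  have "\<tau> \<otimes>\<^bsub>proj_sections (poly_alg n) V\<^esub> restrict \<sigma> V = \<one>\<^bsub>proj_sections (poly_alg n) V\<^esub>"
    "restrict \<sigma> V \<otimes>\<^bsub>proj_sections (poly_alg n) V\<^esub> \<tau> = \<one>\<^bsub>proj_sections (poly_alg n) V\<^esub>"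
    using W(7) V(5) inv poly.openin_points[OF V(1)]
    by (auto simp: proj_sections_def \<tau>_def poly.hloc_one subset_iff intro!: restrict_ext)
  with \<tau> \<sigma>V have "restrict \<sigma> V \<in> Units (proj_sections (poly_alg n) V)"
    by (auto simp: Units_def)
  moreover have "openin (space (hypersurface_complement n f)) V"
    using V U unfolding openin_complement[OF f] by blast
  ultimately show "germ_unit (hypersurface_complement n f) U \<sigma> P"
    using V by (auto simp: germ_unit_def)
qed

text \<open>The arrow goes from the complement of f' to the complement of f: the last assumption
  says that a point off f' is sent to a point off f.\<close>

locale complement_map =
  fixes n N d d' :: nat and A :: "nat \<Rightarrow> 'k::field mpoly" and f f' :: "'k mpoly"
  assumes A: "\<And>i. i \<le> n \<Longrightarrow> A i \<in> forms n N" and N: "N > 0"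
    and f: "f \<in> forms n d" "d > 0" and f': "f' \<in> forms n d'"
    and ff': "\<And>P. P \<in> proj_points (poly_alg n) \<Longrightarrow> f' \<notin> P \<Longrightarrow> subst cst A f \<notin> P"
begin

lemma pullback_D: "P \<in> poly.D n f' \<Longrightarrow> pullback n A P \<in> poly.D n f"
  using pullback_point[OF A N _ f] ff' by (auto simp: poly.D_def pullback_def)

lemma subst_piece: "a \<in> forms n e \<Longrightarrow> subst cst A a \<in> forms n (e * N)"
  using forms_subst A by blast

lemma pull_fracs:
  assumes "(a, s) \<in> poly.fracs n (pullback n A P)"
  shows "(subst cst A a, subst cst A s) \<in> poly.fracs n P"
  using assms
  by (elim poly.fracsE) (auto intro!: poly.fracsI subst_piece simp: pullback_def)

lemma pull_frac_hfrac:
  assumes P: "P \<in> poly.D n f'" and as: "(a, s) \<in> poly.fracs n (pullback n A P)"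
  shows "pull_frac n A P (hfrac (poly_alg n) (pullback n A P) a s) =
    hfrac (poly_alg n) P (subst cst A a) (subst cst A s)"
proof -
  have pts: "P \<in> proj_points (poly_alg n)" "pullback n A P \<in> proj_points (poly_alg n)"
    using P pullback_D[OF P] by (auto simp: poly.D_def)
  have "hfrac (poly_alg n) P (subst cst A b) (subst cst A t) = hfrac (poly_alg n) P (subst cst A a) (subst cst A s)"
    if "(b, t) \<in> hfrac (poly_alg n) (pullback n A P) a s" for b t
  proof -
    have bt: "(b, t) \<in> poly.fracs n (pullback n A P)" "poly.frac_eq n (pullback n A P) a s b t"
      using that poly.mem_hfrac_iff[OF pts(2) as] by auto
    obtain u where u: "u \<in> homogeneous_elems (poly_alg n)" "u \<notin> pullback n A P" "u * (a * t) = u * (b * s)"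
      using bt(2) by (auto simp: poly.frac_eq_def[OF pts(2)])
    have "subst cst A u \<in> homogeneous_elems (poly_alg n)" "subst cst A u \<notin> P"
      using u subst_piece poly.homog_carrier[OF u(1)] by (auto simp: homogeneous_elems_def pullback_def)
    moreover have "subst cst A u * (subst cst A a * subst cst A t) = subst cst A u * (subst cst A b * subst cst A s)"
      using arg_cong[OF u(3), of "subst cst A"] by simp
    ultimately have "poly.frac_eq n P (subst cst A a) (subst cst A s) (subst cst A b) (subst cst A t)"
      by (auto simp: poly.frac_eq_def[OF pts(1)])
    then show ?thesis
      using poly.hfrac_eq_iff[OF pts(1) pull_fracs[OF as] pull_fracs[OF bt(1)]] by simp
  qed
  moreover have "(a, s) \<in> hfrac (poly_alg n) (pullback n A P) a s"
    using poly.mem_hfrac_iff[OF pts(2) as] as poly.frac_eq_refl[OF pts(2)] by simp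
  ultimately show ?thesis
    unfolding pull_frac_def by fast
qed

lemma continuous_pullback:
  "continuous_map (space (hypersurface_complement n f')) (space (hypersurface_complement n f)) (pullback n A)"
proof -
  have top: "topspace (subtopology (zariski (poly_alg n)) (poly.D n f')) = poly.D n f'"
    by (auto simp: poly.D_def)
  have "continuous_map (subtopology (zariski (poly_alg n)) (poly.D n f')) (zariski (poly_alg n)) (pullback n A)"
    unfolding zariski_def[of "poly_alg n"]
  proof (rule continuous_on_generated_topo)
    fix U :: "'k mpoly set set"
    assume "U \<in> (\<lambda>h. {P \<in> proj_points (poly_alg n). h \<notin> P}) ` homogeneous_elems (poly_alg n)"
    then obtain h e where h: "h \<in> forms n e" "U = poly.D n h"
      by (auto simp: homogeneous_elems_def poly.D_def)
    have "pullback n A -` U \<inter> poly.D n f' = poly.D n (subst cst A h) \<inter> poly.D n f'"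
      using pullback_D forms_polys[OF h(1)] unfolding h(2) by (auto simp: poly.D_def pullback_def)
    then show "openin (subtopology (topology_generated_by ((\<lambda>h. {P \<in> proj_points (poly_alg n). h \<notin> P}) ` homogeneous_elems (poly_alg n))) (poly.D n f'))
      (pullback n A -` U \<inter> topspace (subtopology (topology_generated_by ((\<lambda>h. {P \<in> proj_points (poly_alg n). h \<notin> P}) ` homogeneous_elems (poly_alg n))) (poly.D n f')))"
      unfolding zariski_def[symmetric] openin_subtopology top
      using poly.openin_D[OF poly.homogI, of "subst cst A h" n "e * N"] subst_piece[OF h(1)]
      by (intro exI[of _ "poly.D n (subst cst A h)"]) simp
  next
    show "pullback n A ` topspace (subtopology (topology_generated_by ((\<lambda>h. {P \<in> proj_points (poly_alg n). h \<notin> P}) ` homogeneous_elems (poly_alg n))) (poly.D n f'))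
      \<subseteq> \<Union> ((\<lambda>h. {P \<in> proj_points (poly_alg n). h \<notin> P}) ` homogeneous_elems (poly_alg n))"
      unfolding zariski_def[symmetric]
    proof
      fix Q assume "Q \<in> pullback n A ` topspace (subtopology (zariski (poly_alg n)) (poly.D n f'))"
      then obtain P where "P \<in> poly.D n f'" "Q = pullback n A P"
        unfolding top by blast
      then have "Q \<in> poly.D n f"
        using pullback_D by blast
      with poly.homogI[of f n d] f(1)
      show "Q \<in> \<Union> ((\<lambda>h. {P \<in> proj_points (poly_alg n). h \<notin> P}) ` homogeneous_elems (poly_alg n))"
        unfolding poly.D_def by simp blast
    qed
  qed
  then show ?thesis
    using pullback_D by (auto simp: continuous_map_in_subtopology poly.D_def)
qed

lemma pull_section_eq:
  assumes "\<sigma> (pullback n A P) = hfrac (poly_alg n) (pullback n A P) a s"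
    and "P \<in> poly.D n f'" "pullback n A P \<in> V" "a \<in> forms n e" "s \<in> forms n e" "s \<notin> pullback n A P"
  shows "pull_section n A f' V \<sigma> P = hfrac (poly_alg n) P (subst cst A a) (subst cst A s)"
  using assms pull_frac_hfrac[OF assms(2)] poly.fracsI[of a n e s "pullback n A P"]
  by (simp add: pull_section_def preimage_complement)

lemma pull_section_carrier:
  assumes V: "openin (space (hypersurface_complement n f)) V"
    and \<sigma>: "\<sigma> \<in> carrier (proj_sections (poly_alg n) V)"
  shows "pull_section n A f' V \<sigma> \<in>
    carrier (proj_sections (poly_alg n) (preimage (hypersurface_complement n f') (pullback n A) V))"
proof -
  let ?pre = "preimage (hypersurface_complement n f') (pullback n A)"
  have pre: "openin (zariski (poly_alg n)) (?pre W)" if "openin (zariski (poly_alg n)) W" for W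
  proof -
    have "openin (space (hypersurface_complement n f)) (W \<inter> poly.D n f)"
      unfolding openin_complement[OF f(1)] using that poly.openin_D[OF poly.homogI, of f n d] f(1)
      by (simp add: openin_Int)
    then have "openin (space (hypersurface_complement n f')) (?pre (W \<inter> poly.D n f))"
      using continuous_pullback unfolding continuous_map_def preimage_def by blast
    moreover have "?pre (W \<inter> poly.D n f) = ?pre W"
      using pullback_D by (auto simp: preimage_complement)
    ultimately show ?thesis
      unfolding openin_complement[OF f'] by simp
  qed
  have Vz: "openin (zariski (poly_alg n)) V"
    using V by (simp only: openin_complement[OF f(1)])
  show ?thesis
  proof (rule poly.section_intro)
    fix P assume "P \<in> ?pre V"
    then have P: "P \<in> poly.D n f'" "pullback n A P \<in> V"
      by (auto simp: preimage_complement)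
    obtain W a e s where W: "openin (zariski (poly_alg n)) W" "pullback n A P \<in> W" "W \<subseteq> V"
      "a \<in> piece (poly_alg n) e" "s \<in> piece (poly_alg n) e" "W \<subseteq> poly.D n s"
      "\<forall>Q\<in>W. \<sigma> Q = hfrac (poly_alg n) Q a s"
      by (rule poly.section_local[OF \<sigma> P(2)])
    have "s \<in> polys n"
      using W forms_polys by auto
    then have "?pre W \<subseteq> poly.D n (subst cst A s)"
      using W(6) by (auto simp: preimage_complement poly.D_def pullback_def)
    moreover have "\<forall>Q \<in> ?pre W \<inter> ?pre V. pull_section n A f' V \<sigma> Q =
        hfrac (poly_alg n) Q (subst cst A a) (subst cst A s)"
    proof
      fix Q assume "Q \<in> ?pre W \<inter> ?pre V"
      then show "pull_section n A f' V \<sigma> Q = hfrac (poly_alg n) Q (subst cst A a) (subst cst A s)"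
        using W by (intro pull_section_eq[of \<sigma> Q a s V e]) (auto simp: preimage_complement poly.D_def)
    qed
    ultimately show "\<exists>W e a s. openin (zariski (poly_alg n)) W \<and> P \<in> W \<and> a \<in> piece (poly_alg n) e \<and>
        s \<in> piece (poly_alg n) e \<and> W \<subseteq> poly.D n s \<and>
        (\<forall>Q \<in> W \<inter> ?pre V. pull_section n A f' V \<sigma> Q = hfrac (poly_alg n) Q a s)"
      using pre[OF W(1)] P W(2,4,5) subst_piece
      by (intro exI[of _ "?pre W"] exI[of _ "e * N"] exI[of _ "subst cst A a"] exI[of _ "subst cst A s"])
        (auto simp: preimage_complement)
  qed (use pre[OF Vz] in \<open>auto simp: pull_section_def\<close>)
qed

lemma pull_section_hom:
  assumes V: "openin (space (hypersurface_complement n f)) V"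
  shows "pull_section n A f' V \<in> ring_hom (proj_sections (poly_alg n) V)
    (proj_sections (poly_alg n) (preimage (hypersurface_complement n f') (pullback n A) V))"
proof (rule ring_hom_memI)
  let ?pre = "preimage (hypersurface_complement n f') (pullback n A) V"
  fix \<sigma> assume \<sigma>: "\<sigma> \<in> carrier (proj_sections (poly_alg n) V)"
  then show "pull_section n A f' V \<sigma> \<in> carrier (proj_sections (poly_alg n) ?pre)"
    by (rule pull_section_carrier[OF V])
  fix \<tau> assume \<tau>: "\<tau> \<in> carrier (proj_sections (poly_alg n) V)"
  have *: "pull_frac n A P (\<sigma> (pullback n A P) \<otimes>\<^bsub>hloc (poly_alg n) (pullback n A P)\<^esub> \<tau> (pullback n A P)) =
      pull_frac n A P (\<sigma> (pullback n A P)) \<otimes>\<^bsub>hloc (poly_alg n) P\<^esub> pull_frac n A P (\<tau> (pullback n A P))"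
    "pull_frac n A P (\<sigma> (pullback n A P) \<oplus>\<^bsub>hloc (poly_alg n) (pullback n A P)\<^esub> \<tau> (pullback n A P)) =
      pull_frac n A P (\<sigma> (pullback n A P)) \<oplus>\<^bsub>hloc (poly_alg n) P\<^esub> pull_frac n A P (\<tau> (pullback n A P))"
    if P: "P \<in> ?pre" for P
  proof -
    have P: "P \<in> poly.D n f'" "pullback n A P \<in> V"
      using P by (auto simp: preimage_complement)
    have pts: "P \<in> proj_points (poly_alg n)" "pullback n A P \<in> proj_points (poly_alg n)"
      using P(1) pullback_D[OF P(1)] by (auto simp: poly.D_def)
    obtain a s where as: "(a, s) \<in> poly.fracs n (pullback n A P)" "\<sigma> (pullback n A P) = hfrac (poly_alg n) (pullback n A P) a s"
      using poly.hloc_carrierE[OF pts(2) poly.section_mem[OF \<sigma> P(2)]] by blast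
    obtain b t where bt: "(b, t) \<in> poly.fracs n (pullback n A P)" "\<tau> (pullback n A P) = hfrac (poly_alg n) (pullback n A P) b t"
      using poly.hloc_carrierE[OF pts(2) poly.section_mem[OF \<tau> P(2)]] by blast
    show "pull_frac n A P (\<sigma> (pullback n A P) \<otimes>\<^bsub>hloc (poly_alg n) (pullback n A P)\<^esub> \<tau> (pullback n A P)) =
      pull_frac n A P (\<sigma> (pullback n A P)) \<otimes>\<^bsub>hloc (poly_alg n) P\<^esub> pull_frac n A P (\<tau> (pullback n A P))"
      using pull_frac_hfrac[OF P(1) poly.fracs_mult[OF pts(2) as(1) bt(1)]]
      by (simp add: as(2) bt(2) poly.hloc_mult[OF pts(2) as(1) bt(1)] pull_frac_hfrac[OF P(1) as(1)]
          pull_frac_hfrac[OF P(1) bt(1)] poly.hloc_mult[OF pts(1) pull_fracs[OF as(1)] pull_fracs[OF bt(1)]])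
    show "pull_frac n A P (\<sigma> (pullback n A P) \<oplus>\<^bsub>hloc (poly_alg n) (pullback n A P)\<^esub> \<tau> (pullback n A P)) =
      pull_frac n A P (\<sigma> (pullback n A P)) \<oplus>\<^bsub>hloc (poly_alg n) P\<^esub> pull_frac n A P (\<tau> (pullback n A P))"
      using pull_frac_hfrac[OF P(1) poly.fracs_add[OF pts(2) as(1) bt(1)]]
      by (simp add: as(2) bt(2) poly.hloc_add[OF pts(2) as(1) bt(1)] pull_frac_hfrac[OF P(1) as(1)]
          pull_frac_hfrac[OF P(1) bt(1)] poly.hloc_add[OF pts(1) pull_fracs[OF as(1)] pull_fracs[OF bt(1)]])
  qed
  have pre: "pullback n A P \<in> V" if "P \<in> ?pre" for P
    using that by (simp add: preimage_complement)
  show "pull_section n A f' V (\<sigma> \<otimes>\<^bsub>proj_sections (poly_alg n) V\<^esub> \<tau>) =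
      pull_section n A f' V \<sigma> \<otimes>\<^bsub>proj_sections (poly_alg n) ?pre\<^esub> pull_section n A f' V \<tau>"
    "pull_section n A f' V (\<sigma> \<oplus>\<^bsub>proj_sections (poly_alg n) V\<^esub> \<tau>) =
      pull_section n A f' V \<sigma> \<oplus>\<^bsub>proj_sections (poly_alg n) ?pre\<^esub> pull_section n A f' V \<tau>"
    using * pre by (auto simp: pull_section_def proj_sections_def intro!: restrict_ext)
next
  let ?pre = "preimage (hypersurface_complement n f') (pullback n A) V"
  have "pull_frac n A P (hfrac (poly_alg n) (pullback n A P) 1 1) = hfrac (poly_alg n) P 1 1"
    if "P \<in> ?pre" for P
  proof -
    have P: "P \<in> poly.D n f'"
      using that by (auto simp: preimage_complement)
    then have pts: "pullback n A P \<in> proj_points (poly_alg n)"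
      using pullback_D[OF P(1)] by (auto simp: poly.D_def)
    show ?thesis
      using pull_frac_hfrac[OF P, of 1 1] poly.fracs_one(1)[OF pts] by simp
  qed
  moreover have "pullback n A P \<in> V \<and> P \<in> proj_points (poly_alg n) \<and> pullback n A P \<in> proj_points (poly_alg n)"
    if "P \<in> ?pre" for P
    using that pullback_D by (auto simp: preimage_complement poly.D_def)
  ultimately show "pull_section n A f' V \<one>\<^bsub>proj_sections (poly_alg n) V\<^esub> = \<one>\<^bsub>proj_sections (poly_alg n) ?pre\<^esub>"
    by (auto simp: pull_section_def proj_sections_def poly.hloc_one intro!: restrict_ext)
qed

lemma pullback_morphism:
  "morphism (hypersurface_complement n f') (hypersurface_complement n f) (pullback n A) (pull_section n A f')"
  unfolding morphism_def
proof (intro conjI allI impI)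
  let ?pre = "preimage (hypersurface_complement n f') (pullback n A)"
  show "continuous_map (space (hypersurface_complement n f')) (space (hypersurface_complement n f)) (pullback n A)"
    by (rule continuous_pullback)
  show "pull_section n A f' V \<in> ring_hom (sections (hypersurface_complement n f) V)
      (sections (hypersurface_complement n f') (?pre V))"
    if "openin (space (hypersurface_complement n f)) V" for V
    using pull_section_hom[OF that] by simp
  show "pull_section n A f' W (restr (hypersurface_complement n f) V W \<sigma>) =
      restr (hypersurface_complement n f') (?pre V) (?pre W) (pull_section n A f' V \<sigma>)"
    if "openin (space (hypersurface_complement n f)) V \<and> openin (space (hypersurface_complement n f)) W \<and>
      W \<subseteq> V \<and> \<sigma> \<in> carrier (sections (hypersurface_complement n f) V)" for V W \<sigma>
  proof
    fix P
    from that have "W \<subseteq> V"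
      by blast
    then show "pull_section n A f' W (restr (hypersurface_complement n f) V W \<sigma>) P =
        restr (hypersurface_complement n f') (?pre V) (?pre W) (pull_section n A f' V \<sigma>) P"
      by (auto simp: pull_section_def restrict_def preimage_complement)
  qed
  show "germ_unit (hypersurface_complement n f) V \<sigma> (pullback n A P)"
    if "openin (space (hypersurface_complement n f)) V \<and> \<sigma> \<in> carrier (sections (hypersurface_complement n f) V) \<and>
      P \<in> ?pre V \<and> germ_unit (hypersurface_complement n f') (?pre V) (pull_section n A f' V \<sigma>) P" for V \<sigma> P
  proof -
    have V: "openin (space (hypersurface_complement n f)) V"
      and \<sigma>: "\<sigma> \<in> carrier (proj_sections (poly_alg n) V)"
      and P: "P \<in> poly.D n f'" "pullback n A P \<in> V" "P \<in> ?pre V"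
      and unit: "germ_unit (hypersurface_complement n f') (?pre V) (pull_section n A f' V \<sigma>) P"
      using that by (auto simp: preimage_complement)
    have pts: "P \<in> proj_points (poly_alg n)" "pullback n A P \<in> proj_points (poly_alg n)"
      using P(1) pullback_D[OF P(1)] by (auto simp: poly.D_def)
    obtain a s where as: "(a, s) \<in> poly.fracs n (pullback n A P)" "\<sigma> (pullback n A P) = hfrac (poly_alg n) (pullback n A P) a s"
      using poly.hloc_carrierE[OF pts(2) poly.section_mem[OF \<sigma> P(2)]] by blast
    have pre: "openin (space (hypersurface_complement n f')) (?pre V)"
      using continuous_pullback V unfolding continuous_map_def preimage_def by blast
    have "pull_section n A f' V \<sigma> P \<in> Units (hloc (poly_alg n) P)"
      using unit germ_unit_complement_iff[OF f' pre pull_section_carrier[OF V \<sigma>] P(3)] by simp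
    then have "subst cst A a \<notin> P"
      using poly.hloc_unit_iff[OF pts(1) pull_fracs[OF as(1)]] P pull_frac_hfrac[OF P(1) as(1)] as(2)
      by (simp add: pull_section_def)
    then have "a \<notin> pullback n A P"
      by (simp add: pullback_def)
    then show ?thesis
      using germ_unit_complement_iff[OF f(1) V \<sigma> P(2)] poly.hloc_unit_iff[OF pts(2) as(1)] as(2) by simp
  qed
  show "pull_section n A f' (topspace (space (hypersurface_complement n f))) (const (hypersurface_complement n f) c) =
      const (hypersurface_complement n f') c" for c
  proof -
    have "topspace (space (hypersurface_complement n f)) = poly.D n f"
      by (auto simp: poly.D_def)
    moreover have "?pre (poly.D n f) = poly.D n f'"
      using pullback_D by (auto simp: preimage_complement)
    moreover have "pull_frac n A P (hfrac (poly_alg n) (pullback n A P) (cst c) 1) = hfrac (poly_alg n) P (cst c) 1"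
      if "P \<in> poly.D n f'" for P
    proof -
      have pts: "pullback n A P \<in> proj_points (poly_alg n)"
        using pullback_D[OF that] by (auto simp: poly.D_def)
      show ?thesis
        using pull_frac_hfrac[OF that, of "cst c" 1] poly.fracs_one(3)[OF pts] by simp
    qed
    ultimately show ?thesis
      using pullback_D by (auto simp: pull_section_def intro!: restrict_ext)
  qed
qed

end

text \<open>On forms of degree e the composite substitution is multiplication by f'^(r e), which
  lies outside P. So both primes contain the same forms, and homogeneous primes are generated by
  these.\<close>

lemma pullback_pullback:
  fixes A B :: "nat \<Rightarrow> 'k::field mpoly"
  assumes B: "\<And>i. i \<le> n \<Longrightarrow> B i \<in> forms n N'"
    and AB: "\<And>i. i \<le> n \<Longrightarrow> subst cst A (B i) = f' ^ r * var i"
    and f': "f' \<in> polys n"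
    and P: "P \<in> proj_points (poly_alg n)" "f' \<notin> P"
    and Q: "pullback n B (pullback n A P) \<in> proj_points (poly_alg n)"
  shows "pullback n B (pullback n A P) = P"
    and "a \<in> forms n e \<Longrightarrow> subst cst A (subst cst B a) = f' ^ (r * e) * a"
proof -
  have *: "subst cst A (subst cst B a) = f' ^ (r * e) * a" if "a \<in> forms n e" for a e
  proof -
    have "subst cst A (subst cst B a) = subst cst (\<lambda>i. f' ^ r * var i) a"
      unfolding cst.subst_subst using AB by (intro cst.subst_cong[OF forms_polys[OF that]]) auto
    also have "\<dots> = f' ^ (r * e) * a"
      unfolding cst.subst_scale[OF that] by (simp add: power_mult)
    finally show ?thesis .
  qed
  then show "a \<in> forms n e \<Longrightarrow> subst cst A (subst cst B a) = f' ^ (r * e) * a" .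
  have pow: "f' ^ j \<in> polys n \<and> f' ^ j \<notin> P" for j
  proof (induction j)
    case (Suc j)
    then show ?case
      using poly.mult_notin[OF P(1), of f' "f' ^ j"] P(2) f' by auto
  qed (use poly.one_notin[OF P(1)] in simp_all)
  have polysB: "subst cst B a \<in> polys n" if "a \<in> polys n" for a
    using that B forms_polys by (intro polys_subst) auto
  have "pullback n B (pullback n A P) \<inter> homogeneous_elems (poly_alg n) = P \<inter> homogeneous_elems (poly_alg n)"
  proof -
    have "a \<in> pullback n B (pullback n A P) \<longleftrightarrow> a \<in> P" if a: "a \<in> forms n e" for a e
    proof -
      have "a \<in> pullback n B (pullback n A P) \<longleftrightarrow> f' ^ (r * e) * a \<in> P"
        using *[OF a] polysB forms_polys[OF a] by (simp add: pullback_def)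
      also have "\<dots> \<longleftrightarrow> a \<in> P"
        using poly.mult_notin[OF P(1), of "f' ^ (r * e)" a] poly.in_mult(1)[OF P(1), of "f' ^ (r * e)" a]
          pow[of "r * e"] forms_polys[OF a] by auto
      finally show ?thesis .
    qed
    then show ?thesis
      by (auto simp: homogeneous_elems_def)
  qed
  with P(1) Q show "pullback n B (pullback n A P) = P"
    unfolding proj_points_def by auto
qed

text \<open>The composites are the identity up to the common factors f'^r and f^r', which are
  harmless where f' and f are invertible.\<close>

theorem isomorphic_complements:
  fixes A B :: "nat \<Rightarrow> 'k::field mpoly"
  assumes A: "\<And>i. i \<le> n \<Longrightarrow> A i \<in> forms n N" "N > 0" and B: "\<And>i. i \<le> n \<Longrightarrow> B i \<in> forms n N'" "N' > 0"
    and f: "f \<in> forms n d" "d > 0" and f': "f' \<in> forms n d'" "d' > 0"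
    and Af: "subst cst A f = f' ^ k" and Bf': "subst cst B f' = f ^ k'"
    and AB: "\<And>i. i \<le> n \<Longrightarrow> subst cst A (B i) = f' ^ r * var i"
    and BA: "\<And>i. i \<le> n \<Longrightarrow> subst cst B (A i) = f ^ r' * var i"
  shows "isomorphic (hypersurface_complement n f) (hypersurface_complement n f')"
proof -
  have pow: "g ^ j \<notin> P" if "P \<in> proj_points (poly_alg n)" "g \<notin> P" "g \<in> polys n" for g j and P :: "'k mpoly set"
  proof -
    have "g ^ j \<in> polys n \<and> g ^ j \<notin> P"
    proof (induction j)
      case (Suc j)
      then show ?case
        using poly.mult_notin[OF that(1), of g "g ^ j"] that by auto
    qed (use poly.one_notin[OF that(1)] in simp_all)
    then show ?thesis by blast
  qed
  interpret a: complement_map n N d d' A f f'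
    by unfold_locales (use A f f' pow[of _ f'] forms_polys[OF f'(1)] Af in auto)
  interpret b: complement_map n N' d' d B f' f
    by unfold_locales (use B f f' pow[of _ f] forms_polys[OF f(1)] Bf' in auto)
  have ba: "pullback n B (pullback n A P) = P" "e \<in> forms n i \<Longrightarrow> subst cst A (subst cst B e) = f' ^ (r * i) * e"
    if "P \<in> poly.D n f'" for P e i
    using pullback_pullback[OF B(1) AB forms_polys[OF f'(1)]] b.pullback_D[OF a.pullback_D[OF that]] that
    by (auto simp: poly.D_def)
  have ab: "pullback n A (pullback n B P) = P" "e \<in> forms n i \<Longrightarrow> subst cst B (subst cst A e) = f ^ (r' * i) * e"
    if "P \<in> poly.D n f" for P e i
    using pullback_pullback[OF A(1) BA forms_polys[OF f(1)]] a.pullback_D[OF b.pullback_D[OF that]] that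
    by (auto simp: poly.D_def)
  \<comment> \<open>Stated for arbitrary data so that it serves both composites, with A, B and f, f'
    exchanged.\<close>
  have section_inverse: "pull_section n B g (preimage (hypersurface_complement n g') (pullback n A) V) (pull_section n A g' V \<sigma>) = \<sigma>"
    if "complement_map n N' l' l B g' g" "complement_map n N l l' A g g'"
      and inv: "\<And>P. P \<in> poly.D n g \<Longrightarrow> pullback n A (pullback n B P) = P"
        "\<And>P e i. P \<in> poly.D n g \<Longrightarrow> e \<in> forms n i \<Longrightarrow> subst cst B (subst cst A e) = g ^ (q * i) * e"
      and V: "openin (space (hypersurface_complement n g)) V" "\<sigma> \<in> carrier (sections (hypersurface_complement n g) V)"
    for A B :: "nat \<Rightarrow> 'k mpoly" and N N' l l' g g' V \<sigma> q
  proof -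
    interpret a: complement_map n N l l' A g g' by fact
    interpret b: complement_map n N' l' l B g' g by fact
    have Vz: "openin (zariski (poly_alg n)) V" "V \<subseteq> poly.D n g"
      using V by (simp_all only: openin_complement[OF a.f(1)])
    let ?V' = "preimage (hypersurface_complement n g') (pullback n A) V"
    have dom: "preimage (hypersurface_complement n g) (pullback n B) ?V' = V"
      using b.pullback_D inv Vz(2) by (auto simp: preimage_complement subset_iff)
    have pt: "pull_section n B g ?V' (pull_section n A g' V \<sigma>) P = \<sigma> P" if P: "P \<in> V" for P
    proof -
      have PD: "P \<in> poly.D n g" "pullback n B P \<in> poly.D n g'" and pts: "P \<in> proj_points (poly_alg n)"
        using P Vz(2) b.pullback_D by (auto simp: poly.D_def)
      obtain W a e s where W: "openin (zariski (poly_alg n)) W" "P \<in> W" "W \<subseteq> V"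
        "a \<in> piece (poly_alg n) e" "s \<in> piece (poly_alg n) e" "W \<subseteq> poly.D n s"
        "\<forall>Q\<in>W. \<sigma> Q = hfrac (poly_alg n) Q a s"
        using V(2) P unfolding complement_simps by (rule poly.section_local)
      have fr: "a \<in> forms n e" "s \<in> forms n e" "s \<notin> P" "\<sigma> P = hfrac (poly_alg n) P a s"
        using W by (auto simp: poly.D_def)
      have 1: "pull_section n A g' V \<sigma> (pullback n B P) =
          hfrac (poly_alg n) (pullback n B P) (subst cst A a) (subst cst A s)"
        using fr P inv(1)[OF PD(1)] by (intro a.pull_section_eq[OF _ PD(2)]) auto
      have gs: "g ^ (q * e) * s \<notin> P"
        using poly.mult_notin[OF pts, of "g ^ (q * e)" s] pow[OF pts, of g "q * e"] PD(1) forms_polys[OF fr(2)]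
          forms_polys[OF a.f(1)] fr(3) by (auto simp: poly.D_def)
      have "pull_section n B g ?V' (pull_section n A g' V \<sigma>) P =
          hfrac (poly_alg n) P (subst cst B (subst cst A a)) (subst cst B (subst cst A s))"
        using 1 fr a.subst_piece
      proof (intro b.pull_section_eq[OF _ PD(1)])
        show "pullback n B P \<in> ?V'"
          using PD inv P by (simp add: preimage_complement)
        show "subst cst A s \<notin> pullback n B P"
          using gs inv(2)[OF PD(1) fr(2)] by (simp add: pullback_def)
      qed auto
      also have "\<dots> = hfrac (poly_alg n) P (g ^ (q * e) * a) (g ^ (q * e) * s)"
        using inv(2)[OF PD(1)] fr by simp
      also have "\<dots> = hfrac (poly_alg n) P a s"
      proof (rule poly.hfrac_eqI[OF pts])
        have "g ^ (q * e) \<in> forms n (q * e * l)"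
          using a.f by (auto intro: forms_power)
        then show "(g ^ (q * e) * a, g ^ (q * e) * s) \<in> poly.fracs n P"
          using fr gs by (intro poly.fracsI[where e="q * e * l + e"]) (auto intro: forms_mult)
        show "(a, s) \<in> poly.fracs n P"
          using fr by (intro poly.fracsI) auto
      qed (simp add: mult.left_commute mult.assoc)
      finally show ?thesis
        using fr by simp
    qed
    have "pull_section n B g ?V' (pull_section n A g' V \<sigma>) \<in> extensional V" "\<sigma> \<in> extensional V"
      using V(2) by (auto simp: pull_section_def dom proj_sections_def PiE_def)
    then show ?thesis
      using pt by (rule extensionalityI)
  qed
  show ?thesis
    unfolding isomorphic_def
  proof (intro exI conjI)
    show "morphism (hypersurface_complement n f) (hypersurface_complement n f') (pullback n B) (pull_section n B f)"
      by (rule b.pullback_morphism)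
    show "morphism (hypersurface_complement n f') (hypersurface_complement n f) (pullback n A) (pull_section n A f')"
      by (rule a.pullback_morphism)
    show "\<forall>x\<in>topspace (space (hypersurface_complement n f)). pullback n A (pullback n B x) = x"
      using ab(1) by simp
    show "\<forall>x\<in>topspace (space (hypersurface_complement n f')). pullback n B (pullback n A x) = x"
      using ba(1) by simp
    show "\<forall>V s. openin (space (hypersurface_complement n f')) V \<and> s \<in> carrier (sections (hypersurface_complement n f') V) \<longrightarrow>
        pull_section n A f' (preimage (hypersurface_complement n f) (pullback n B) V) (pull_section n B f V s) = s"
      using section_inverse[where q=r, OF a.complement_map_axioms b.complement_map_axioms] ba by blast
    show "\<forall>V s. openin (space (hypersurface_complement n f)) V \<and> s \<in> carrier (sections (hypersurface_complement n f) V) \<longrightarrow>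
        pull_section n B f (preimage (hypersurface_complement n f') (pullback n A) V) (pull_section n A f' V s) = s"
      using section_inverse[where q=r', OF b.complement_map_axioms a.complement_map_axioms] ab by blast
  qed
qed


section \<open>An automorphism trick modulo powers of a variable\<close>

text \<open>First w' = w - (C/F) z^\<epsilon>. Then s = z + w' is kept while (C/F) s^\<epsilon> is
  moved from z to w'. \<open>fz\<close> and \<open>fw\<close> are the new coordinates multiplied by
  F^(\<epsilon>+1).\<close>

definition fz :: "nat \<Rightarrow> 'a::comm_ring_1 \<Rightarrow> 'a \<Rightarrow> 'a \<Rightarrow> 'a \<Rightarrow> 'a" where
  "fz \<epsilon> C F z w = F ^ Suc \<epsilon> * z - C * (F * (z + w) - C * z ^ \<epsilon>) ^ \<epsilon>"

definition fw :: "nat \<Rightarrow> 'a::comm_ring_1 \<Rightarrow> 'a \<Rightarrow> 'a \<Rightarrow> 'a \<Rightarrow> 'a" where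
  "fw \<epsilon> C F z w = F ^ \<epsilon> * (F * w - C * z ^ \<epsilon>) + C * (F * (z + w) - C * z ^ \<epsilon>) ^ \<epsilon>"

text \<open>The inverse shears in reverse order, with the denominator F^(\<epsilon>+1) cleared as
  well.\<close>

definition gz :: "nat \<Rightarrow> 'a::comm_ring_1 \<Rightarrow> 'a \<Rightarrow> 'a \<Rightarrow> 'a \<Rightarrow> 'a" where
  "gz \<epsilon> C F z w = F ^ \<epsilon> * (F * z + C * (z + w) ^ \<epsilon>)"

definition gw :: "nat \<Rightarrow> 'a::comm_ring_1 \<Rightarrow> 'a \<Rightarrow> 'a \<Rightarrow> 'a \<Rightarrow> 'a" where
  "gw \<epsilon> C F z w = F ^ Suc \<epsilon> * w - F ^ \<epsilon> * C * (z + w) ^ \<epsilon> + C * (F * z + C * (z + w) ^ \<epsilon>) ^ \<epsilon>"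

context
  fixes C F z w t T Q C' F' :: "'a::comm_ring_1" and \<epsilon> e :: nat
  assumes \<epsilon>: "\<epsilon> = Suc e"
    and C': "C' = T * Q * C" and F': "F' = T * t ^ e * Q * F ^ (\<epsilon> * \<epsilon>)"
begin

text \<open>Here C' and F' stand for the values of C and F after the first map, and t for an extra
  factor on its z- and w-coordinates. These carry t F^(\<epsilon>+1), so the shears are undone if
  (C'/F') (t F^(\<epsilon>+1))^e = C/F, and the assumed shapes of C' and F' give this; T and Q are
  free cofactors.\<close>

lemma gz_fz:
  "gz \<epsilon> C' F' (t * fz \<epsilon> C F z w) (t * fw \<epsilon> C F z w) = F' ^ \<epsilon> * (T * Q * t ^ \<epsilon> * F ^ (\<epsilon> * \<epsilon>)) * F ^ Suc \<epsilon> * z"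
  and gw_fw:
  "gw \<epsilon> C' F' (t * fz \<epsilon> C F z w) (t * fw \<epsilon> C F z w) = F' ^ \<epsilon> * (T * Q * t ^ \<epsilon> * F ^ (\<epsilon> * \<epsilon>)) * F ^ Suc \<epsilon> * w"
proof -
  define L where "L = F * (z + w) - C * z ^ \<epsilon>"
  define E where "E = T * Q * t ^ \<epsilon> * F ^ (\<epsilon> * \<epsilon>)"
  \<comment> \<open>The second shear preserves the sum of the coordinates, so the power of L
    cancels.\<close>
  have sum: "t * fz \<epsilon> C F z w + t * fw \<epsilon> C F z w = t * F ^ \<epsilon> * L"
    by (simp add: fz_def fw_def L_def algebra_simps)
  have 1: "F' * (t * fz \<epsilon> C F z w) + C' * (t * F ^ \<epsilon> * L) ^ \<epsilon> = E * F ^ Suc \<epsilon> * z"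
  proof -
    have "C' * (t * F ^ \<epsilon> * L) ^ \<epsilon> = E * (C * L ^ \<epsilon>)"
      by (simp add: C' E_def power_mult_distrib power_mult algebra_simps)
    moreover have "F' * (t * fz \<epsilon> C F z w) = E * (F ^ Suc \<epsilon> * z - C * L ^ \<epsilon>)"
      by (simp add: F' E_def fz_def L_def \<epsilon> algebra_simps)
    ultimately show ?thesis
      by (simp add: algebra_simps)
  qed
  show "gz \<epsilon> C' F' (t * fz \<epsilon> C F z w) (t * fw \<epsilon> C F z w) = F' ^ \<epsilon> * (T * Q * t ^ \<epsilon> * F ^ (\<epsilon> * \<epsilon>)) * F ^ Suc \<epsilon> * z"
    unfolding gz_def sum 1 by (simp add: E_def algebra_simps)
  \<comment> \<open>With z restored up to a factor, this is the term by which \<open>gw\<close>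
    undoes the first shear.\<close>
  have 2: "F' ^ \<epsilon> * E * F ^ \<epsilon> * C * z ^ \<epsilon> = C' * (E * F ^ Suc \<epsilon> * z) ^ \<epsilon>"
  proof -
    have "C' * (E * F ^ Suc \<epsilon> * z) ^ \<epsilon> = T * Q * C * E ^ \<epsilon> * F ^ (Suc \<epsilon> * \<epsilon>) * z ^ \<epsilon>"
      unfolding C' power_mult_distrib power_mult by (simp only: mult.assoc mult.commute mult.left_commute)
    also have "E ^ \<epsilon> = F' ^ \<epsilon> * t ^ \<epsilon>"
    proof -
      have "E = F' * t"
        by (simp add: E_def F' \<epsilon> algebra_simps)
      then show ?thesis
        by (simp add: power_mult_distrib)
    qed
    also have "T * Q * C * (F' ^ \<epsilon> * t ^ \<epsilon>) * F ^ (Suc \<epsilon> * \<epsilon>) * z ^ \<epsilon> =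
        F' ^ \<epsilon> * (T * Q * t ^ \<epsilon> * F ^ (Suc \<epsilon> * \<epsilon>)) * C * z ^ \<epsilon>"
      by (simp only: mult.assoc mult.commute mult.left_commute)
    also have "T * Q * t ^ \<epsilon> * F ^ (Suc \<epsilon> * \<epsilon>) = E * F ^ \<epsilon>"
      by (simp add: E_def power_add algebra_simps)
    finally show ?thesis
      by (simp only: mult.assoc)
  qed
  have "gw \<epsilon> C' F' (t * fz \<epsilon> C F z w) (t * fw \<epsilon> C F z w) =
      F' ^ \<epsilon> * (F' * (t * fw \<epsilon> C F z w) - C' * (t * F ^ \<epsilon> * L) ^ \<epsilon>) + C' * (E * F ^ Suc \<epsilon> * z) ^ \<epsilon>"
    unfolding gw_def sum 1 by (simp add: algebra_simps)
  also have "F' * (t * fw \<epsilon> C F z w) - C' * (t * F ^ \<epsilon> * L) ^ \<epsilon> = E * (F ^ \<epsilon> * (F * w - C * z ^ \<epsilon>))"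
  proof -
    have "C' * (t * F ^ \<epsilon> * L) ^ \<epsilon> = E * (C * L ^ \<epsilon>)"
      by (simp add: C' E_def power_mult_distrib power_mult algebra_simps)
    moreover have "F' * (t * fw \<epsilon> C F z w) = E * (F ^ \<epsilon> * (F * w - C * z ^ \<epsilon>) + C * L ^ \<epsilon>)"
      by (simp add: F' E_def fw_def L_def \<epsilon> algebra_simps)
    ultimately show ?thesis
      by (simp add: algebra_simps)
  qed
  also have "F' ^ \<epsilon> * (E * (F ^ \<epsilon> * (F * w - C * z ^ \<epsilon>))) + C' * (E * F ^ Suc \<epsilon> * z) ^ \<epsilon> =
      F' ^ \<epsilon> * E * F ^ Suc \<epsilon> * w"
    unfolding 2[symmetric] by (simp add: algebra_simps)
  finally show "gw \<epsilon> C' F' (t * fz \<epsilon> C F z w) (t * fw \<epsilon> C F z w) = F' ^ \<epsilon> * (T * Q * t ^ \<epsilon> * F ^ (\<epsilon> * \<epsilon>)) * F ^ Suc \<epsilon> * w"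
    by (simp only: E_def)
qed

text \<open>The same computation in the other order: now z + w is restored first (fact
  \<open>L\<close>), and z and w follow from it.\<close>

lemma fz_gz:
  "fz \<epsilon> C' F' (t * gz \<epsilon> C F z w) (t * gw \<epsilon> C F z w) = F' ^ \<epsilon> * (T * Q * t ^ \<epsilon> * F ^ (\<epsilon> * \<epsilon>)) * F ^ Suc \<epsilon> * z"
  and fw_gw:
  "fw \<epsilon> C' F' (t * gz \<epsilon> C F z w) (t * gw \<epsilon> C F z w) = F' ^ \<epsilon> * (T * Q * t ^ \<epsilon> * F ^ (\<epsilon> * \<epsilon>)) * F ^ Suc \<epsilon> * w"
proof -
  define Z where "Z = F * z + C * (z + w) ^ \<epsilon>"
  define E where "E = T * Q * t ^ \<epsilon> * F ^ (\<epsilon> * \<epsilon>)"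
  have E: "E = F' * t"
    by (simp add: E_def F' \<epsilon> algebra_simps)
  have sum: "t * gz \<epsilon> C F z w + t * gw \<epsilon> C F z w = t * (F ^ Suc \<epsilon> * (z + w) + C * Z ^ \<epsilon>)"
    by (simp add: gz_def gw_def Z_def algebra_simps)
  have CZ: "C' * (t * gz \<epsilon> C F z w) ^ \<epsilon> = E * (C * Z ^ \<epsilon>)"
    unfolding gz_def Z_def[symmetric] C' E_def power_mult_distrib power_mult
    by (simp only: mult.assoc mult.commute mult.left_commute)
  have L: "F' * (t * gz \<epsilon> C F z w + t * gw \<epsilon> C F z w) - C' * (t * gz \<epsilon> C F z w) ^ \<epsilon> = E * F ^ Suc \<epsilon> * (z + w)"
    unfolding sum CZ by (simp add: E algebra_simps)
  have key: "C' * (E * F ^ Suc \<epsilon> * (z + w)) ^ \<epsilon> = F' ^ \<epsilon> * E * F ^ \<epsilon> * (C * (z + w) ^ \<epsilon>)"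
  proof -
    have "C' * (E * F ^ Suc \<epsilon> * (z + w)) ^ \<epsilon> = T * Q * C * E ^ \<epsilon> * F ^ (Suc \<epsilon> * \<epsilon>) * (z + w) ^ \<epsilon>"
      unfolding C' power_mult_distrib power_mult by (simp only: mult.assoc mult.commute mult.left_commute)
    also have "E ^ \<epsilon> = F' ^ \<epsilon> * t ^ \<epsilon>"
      by (simp add: E power_mult_distrib)
    also have "T * Q * C * (F' ^ \<epsilon> * t ^ \<epsilon>) * F ^ (Suc \<epsilon> * \<epsilon>) * (z + w) ^ \<epsilon> =
        F' ^ \<epsilon> * (T * Q * t ^ \<epsilon> * F ^ (Suc \<epsilon> * \<epsilon>)) * (C * (z + w) ^ \<epsilon>)"
      by (simp only: mult.assoc mult.commute mult.left_commute)
    also have "T * Q * t ^ \<epsilon> * F ^ (Suc \<epsilon> * \<epsilon>) = E * F ^ \<epsilon>"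
      by (simp add: E_def power_add algebra_simps)
    finally show ?thesis
      by (simp only: mult.assoc)
  qed
  have "fz \<epsilon> C' F' (t * gz \<epsilon> C F z w) (t * gw \<epsilon> C F z w) =
      F' ^ \<epsilon> * E * F ^ \<epsilon> * Z - F' ^ \<epsilon> * E * F ^ \<epsilon> * (C * (z + w) ^ \<epsilon>)"
    unfolding fz_def L key by (simp add: gz_def Z_def E algebra_simps)
  also have "\<dots> = F' ^ \<epsilon> * E * F ^ Suc \<epsilon> * z"
    by (simp add: Z_def algebra_simps)
  finally show "fz \<epsilon> C' F' (t * gz \<epsilon> C F z w) (t * gw \<epsilon> C F z w) =
      F' ^ \<epsilon> * (T * Q * t ^ \<epsilon> * F ^ (\<epsilon> * \<epsilon>)) * F ^ Suc \<epsilon> * z"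
    by (simp only: E_def)
  have "fw \<epsilon> C' F' (t * gz \<epsilon> C F z w) (t * gw \<epsilon> C F z w) =
      F' ^ \<epsilon> * (F' * (t * gw \<epsilon> C F z w) - E * (C * Z ^ \<epsilon>)) + F' ^ \<epsilon> * E * F ^ \<epsilon> * (C * (z + w) ^ \<epsilon>)"
    unfolding fw_def L key unfolding CZ by (rule refl)
  also have "F' * (t * gw \<epsilon> C F z w) - E * (C * Z ^ \<epsilon>) = E * (F ^ Suc \<epsilon> * w - F ^ \<epsilon> * C * (z + w) ^ \<epsilon>)"
    by (simp add: gw_def Z_def E algebra_simps)
  also have "F' ^ \<epsilon> * (E * (F ^ Suc \<epsilon> * w - F ^ \<epsilon> * C * (z + w) ^ \<epsilon>)) + F' ^ \<epsilon> * E * F ^ \<epsilon> * (C * (z + w) ^ \<epsilon>) =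
      F' ^ \<epsilon> * E * F ^ Suc \<epsilon> * w"
    by (simp add: algebra_simps)
  finally show "fw \<epsilon> C' F' (t * gz \<epsilon> C F z w) (t * gw \<epsilon> C F z w) =
      F' ^ \<epsilon> * (T * Q * t ^ \<epsilon> * F ^ (\<epsilon> * \<epsilon>)) * F ^ Suc \<epsilon> * w"
    by (simp only: E_def)
qed

end

section \<open>Congruences modulo a ring element\<close>

definition cg :: "'a::comm_ring_1 \<Rightarrow> 'a \<Rightarrow> 'a \<Rightarrow> bool" where
  "cg M a b \<longleftrightarrow> M dvd a - b"

lemma cg_refl [simp]: "cg M a a"
  by (simp add: cg_def)

lemma cg_sym: "cg M a b \<Longrightarrow> cg M b a"
  unfolding cg_def using dvd_minus_iff[of M "a - b"] by simp

lemma cg_trans [trans]: "cg M a b \<Longrightarrow> cg M b c \<Longrightarrow> cg M a c"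
  unfolding cg_def using dvd_add[of M "a - b" "b - c"] by simp

lemma cg_add: "cg M a b \<Longrightarrow> cg M a' b' \<Longrightarrow> cg M (a + a') (b + b')"
  unfolding cg_def using dvd_add[of M "a - b" "a' - b'"] by (simp add: algebra_simps)

lemma cg_diff: "cg M a b \<Longrightarrow> cg M a' b' \<Longrightarrow> cg M (a - a') (b - b')"
  unfolding cg_def using dvd_diff[of M "a - b" "a' - b'"] by (simp add: algebra_simps)

lemma cg_mult:
  assumes "cg M a b" "cg M a' b'"
  shows "cg M (a * a') (b * b')"
proof -
  have "a * a' - b * b' = (a - b) * a' + b * (a' - b')"
    by (simp add: algebra_simps)
  then show ?thesis
    using assms by (simp add: cg_def)
qed

lemma cg_power: "cg M a b \<Longrightarrow> cg M (a ^ r) (b ^ r)"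
  by (induction r) (simp_all add: cg_mult)

lemma cg_dvd: "cg M a b \<Longrightarrow> N dvd M \<Longrightarrow> cg N a b"
  by (auto simp: cg_def intro: dvd_trans)

lemma cg_mult_dvd: "cg M a b \<Longrightarrow> cg (c * M) (c * a) (c * b)"
  unfolding cg_def by (metis mult_dvd_mono dvd_refl right_diff_distrib)

lemma cg_binomial: "cg (b * b) ((a + b) ^ Suc k) (a ^ Suc k + of_nat (Suc k) * a ^ k * b)"
proof (induction k)
  case (Suc k)
  have "cg (b * b) ((a + b) ^ Suc k * (a + b)) ((a ^ Suc k + of_nat (Suc k) * a ^ k * b) * (a + b))"
    by (rule cg_mult[OF Suc]) simp
  also have "(a ^ Suc k + of_nat (Suc k) * a ^ k * b) * (a + b) =
      a ^ Suc (Suc k) + of_nat (Suc (Suc k)) * a ^ Suc k * b + b * b * (of_nat (Suc k) * a ^ k)"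
    by (simp add: algebra_simps)
  also have "cg (b * b) (a ^ Suc (Suc k) + of_nat (Suc (Suc k)) * a ^ Suc k * b + b * b * (of_nat (Suc k) * a ^ k))
      (a ^ Suc (Suc k) + of_nat (Suc (Suc k)) * a ^ Suc k * b)"
    by (simp add: cg_def)
  finally show ?case
    by (simp add: mult.commute)
qed simp

section \<open>The first-order effect of the shears on the equation\<close>

context
  fixes x y z w \<kappa> \<alpha> \<beta> q C p0 :: "'a::comm_ring_1" and k \<epsilon> :: nat
  assumes k: "k \<ge> 1" and C: "C = x ^ k * \<kappa>" and p0: "p0 = w ^ Suc k * (\<alpha> * z + \<beta> * w)"
    and id: "of_nat (Suc k) * w ^ k * ((z + w) ^ \<epsilon> - z ^ \<epsilon>) * (\<alpha> * z + \<beta> * w) +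
      w ^ Suc k * (\<beta> * ((z + w) ^ \<epsilon> - z ^ \<epsilon>) - \<alpha> * (z + w) ^ \<epsilon>) = p0 * q"
begin

text \<open>From k \<ge> 1 follows 2 k \<ge> k + 1. Hence only terms of first order in C survive
  modulo x^(k+1).\<close>

lemma CC_dvd: "x ^ Suc k dvd C * C"
proof -
  have "x ^ Suc k dvd x ^ (k + k)"
    using k by (intro le_imp_power_dvd) simp
  moreover have "C * C = x ^ (k + k) * (\<kappa> * \<kappa>)"
    by (simp add: C power_add algebra_simps)
  ultimately show ?thesis
    by simp
qed

text \<open>The left side of \<open>id\<close> is the w-derivative of p0 times (z + w)^\<epsilon> -
  z^\<epsilon>, minus the z-derivative of p0 times (z + w)^\<epsilon>. The sign s is 1 for
  \<open>fz\<close>, \<open>fw\<close> and -1 for the inverse, so one computation serves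
  both.\<close>

lemma leading_terms:
  assumes W: "cg (x ^ Suc k) W (F ^ \<epsilon> * (F * w + s * C * ((z + w) ^ \<epsilon> - z ^ \<epsilon>)))"
    and Z: "cg (x ^ Suc k) Z (F ^ \<epsilon> * (F * z - s * C * (z + w) ^ \<epsilon>))"
  shows "cg (x ^ Suc k) (W ^ Suc k * (\<alpha> * Z + \<beta> * W)) (F ^ (\<epsilon> * (k + 2)) * (F ^ Suc k * (F * p0 + s * C * p0 * q)))"
proof -
  define \<delta> where "\<delta> = (z + w) ^ \<epsilon> - z ^ \<epsilon>"
  define l where "l = (z + w) ^ \<epsilon>"
  let ?M = "x ^ Suc k"
  let ?c = "s * C"
  have cc: "cg (?c * ?c) a b \<Longrightarrow> cg ?M a b" for a b
  proof (rule cg_dvd[of "?c * ?c"])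
    have "?c * ?c = C * C * (s * s)"
      by (simp only: mult.assoc mult.commute mult.left_commute)
    then show "?M dvd ?c * ?c"
      using dvd_mult2[OF CC_dvd, of "s * s"] by (simp only:)
  qed
  have "cg ?M (W ^ Suc k * (\<alpha> * Z + \<beta> * W))
      ((F ^ \<epsilon> * (F * w + ?c * \<delta>)) ^ Suc k * (\<alpha> * (F ^ \<epsilon> * (F * z - ?c * l)) + \<beta> * (F ^ \<epsilon> * (F * w + ?c * \<delta>))))"
    using W Z unfolding \<delta>_def l_def by (intro cg_mult cg_power cg_add) simp_all
  also have "\<dots> = F ^ (\<epsilon> * (k + 2)) * ((F * w + ?c * \<delta>) ^ Suc k *
      (F * (\<alpha> * z + \<beta> * w) + ?c * (\<beta> * \<delta> - \<alpha> * l)))"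
  proof -
    have "F ^ (\<epsilon> * (k + 2)) = (F ^ \<epsilon>) ^ Suc k * F ^ \<epsilon>"
      by (simp add: power_add power_mult algebra_simps)
    moreover have "\<alpha> * (F ^ \<epsilon> * (F * z - ?c * l)) + \<beta> * (F ^ \<epsilon> * (F * w + ?c * \<delta>)) =
        F ^ \<epsilon> * (F * (\<alpha> * z + \<beta> * w) + ?c * (\<beta> * \<delta> - \<alpha> * l))"
      by (simp add: algebra_simps)
    ultimately show ?thesis
      by (simp only: power_mult_distrib mult.assoc mult.left_commute mult.commute)
  qed
  also have "cg ?M \<dots> (F ^ (\<epsilon> * (k + 2)) * (((F * w) ^ Suc k + of_nat (Suc k) * (F * w) ^ k * (?c * \<delta>)) *
      (F * (\<alpha> * z + \<beta> * w) + ?c * (\<beta> * \<delta> - \<alpha> * l))))"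
  proof (intro cg_mult cg_refl cc cg_dvd[OF cg_binomial])
    have "?c * \<delta> * (?c * \<delta>) = ?c * ?c * (\<delta> * \<delta>)"
      by (simp only: mult.assoc mult.commute mult.left_commute)
    then show "?c * ?c dvd ?c * \<delta> * (?c * \<delta>)"
      by (simp only: dvd_triv_left)
  qed
  also have "\<dots> = F ^ (\<epsilon> * (k + 2)) * (F ^ Suc k * (F * p0 + ?c * p0 * q) +
      ?c * ?c * (of_nat (Suc k) * (F * w) ^ k * \<delta> * (\<beta> * \<delta> - \<alpha> * l)))"
  proof -
    have "((F * w) ^ Suc k + of_nat (Suc k) * (F * w) ^ k * (?c * \<delta>)) *
        (F * (\<alpha> * z + \<beta> * w) + ?c * (\<beta> * \<delta> - \<alpha> * l)) =
        F ^ Suc k * (F * (w ^ Suc k * (\<alpha> * z + \<beta> * w)) +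
          ?c * (of_nat (Suc k) * w ^ k * \<delta> * (\<alpha> * z + \<beta> * w) + w ^ Suc k * (\<beta> * \<delta> - \<alpha> * l))) +
        ?c * ?c * (of_nat (Suc k) * (F * w) ^ k * \<delta> * (\<beta> * \<delta> - \<alpha> * l))"
      by (simp add: power_mult_distrib algebra_simps)
    also have "of_nat (Suc k) * w ^ k * \<delta> * (\<alpha> * z + \<beta> * w) + w ^ Suc k * (\<beta> * \<delta> - \<alpha> * l) = p0 * q"
      using id unfolding \<delta>_def l_def .
    finally show ?thesis
      by (simp only: p0[symmetric] mult.assoc)
  qed
  also have "cg ?M \<dots> (F ^ (\<epsilon> * (k + 2)) * (F ^ Suc k * (F * p0 + ?c * p0 * q)))"
    by (intro cg_mult cg_refl cc) (simp add: cg_def)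
  finally show ?thesis
    by simp
qed

text \<open>Modulo x^(k+1) one has p0 = F - C q and C^2 = 0, so F p0 + C p0 q = (F - C q) (F + C q)
  = F^2.\<close>

lemma forward_dvd:
  assumes F: "F = x ^ Suc k * y + p0 + C * q"
  shows "x ^ Suc k dvd F ^ (Suc \<epsilon> * (k + 2) + 1) - fw \<epsilon> C F z w ^ Suc k * (\<alpha> * fz \<epsilon> C F z w + \<beta> * fw \<epsilon> C F z w)"
proof -
  let ?M = "x ^ Suc k"
  have CM: "cg (C * C) a b \<Longrightarrow> cg ?M a b" for a b
    by (rule cg_dvd[OF _ CC_dvd])
  have L: "cg ?M (C * (F * (z + w) - C * z ^ \<epsilon>) ^ \<epsilon>) (C * (F ^ \<epsilon> * (z + w) ^ \<epsilon>))"
    unfolding power_mult_distrib[symmetric] by (intro CM cg_mult_dvd cg_power) (simp add: cg_def)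
  have W: "cg ?M (fw \<epsilon> C F z w) (F ^ \<epsilon> * (F * w + 1 * C * ((z + w) ^ \<epsilon> - z ^ \<epsilon>)))"
    unfolding fw_def using cg_add[OF cg_refl L, of "F ^ \<epsilon> * (F * w - C * z ^ \<epsilon>)"]
    by (simp add: algebra_simps)
  have Z: "cg ?M (fz \<epsilon> C F z w) (F ^ \<epsilon> * (F * z - 1 * C * (z + w) ^ \<epsilon>))"
    unfolding fz_def using cg_diff[OF cg_refl L, of "F ^ Suc \<epsilon> * z"]
    by (simp add: algebra_simps)
  have "cg ?M (fw \<epsilon> C F z w ^ Suc k * (\<alpha> * fz \<epsilon> C F z w + \<beta> * fw \<epsilon> C F z w))
      (F ^ (\<epsilon> * (k + 2)) * (F ^ Suc k * (F * p0 + 1 * C * p0 * q)))"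
    by (rule leading_terms[OF W Z])
  also have "cg ?M \<dots> (F ^ (\<epsilon> * (k + 2)) * (F ^ Suc k * (F * F)))"
  proof (intro cg_mult cg_refl)
    have "F * p0 + 1 * C * p0 * q - F * F = - ((x ^ Suc k * y) * (F + C * q) + C * C * (q * q))"
      by (simp add: F algebra_simps)
    moreover have "?M dvd (x ^ Suc k * y) * (F + C * q) + C * C * (q * q)"
      using CC_dvd by (intro dvd_add) (auto intro: dvd_mult2)
    ultimately show "cg ?M (F * p0 + 1 * C * p0 * q) (F * F)"
      unfolding cg_def by (simp only: dvd_minus_iff)
  qed
  also have "F ^ (\<epsilon> * (k + 2)) * (F ^ Suc k * (F * F)) = F ^ (Suc \<epsilon> * (k + 2) + 1)"
    by (simp add: power_add[symmetric] mult.assoc[symmetric] power_Suc[symmetric] del: power_Suc)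
      (simp add: power_add algebra_simps)
  finally show ?thesis
    using cg_sym unfolding cg_def by blast
qed

text \<open>Modulo x^(k+1) now F = p0, so the first-order loss C p0 q is made up by F C q, the
  contribution of the extra term of the other equation. That contribution enters as q', known only
  up to congruence.\<close>

lemma backward_dvd:
  assumes F: "F = x ^ Suc k * y + p0"
    and q': "cg (x ^ Suc k) q' (F ^ (Suc \<epsilon> * (k + 2)) * (C * q))"
  shows "x ^ Suc k dvd F ^ (Suc \<epsilon> * (k + 2) + 1) -
    (gw \<epsilon> C F z w ^ Suc k * (\<alpha> * gz \<epsilon> C F z w + \<beta> * gw \<epsilon> C F z w) + q')"
proof -
  let ?M = "x ^ Suc k"
  have CM: "cg (C * C) a b \<Longrightarrow> cg ?M a b" for a b
    by (rule cg_dvd[OF _ CC_dvd])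
  have L: "cg ?M (C * (F * z + C * (z + w) ^ \<epsilon>) ^ \<epsilon>) (C * (F ^ \<epsilon> * z ^ \<epsilon>))"
    unfolding power_mult_distrib[symmetric] by (intro CM cg_mult_dvd cg_power) (simp add: cg_def)
  have W: "cg ?M (gw \<epsilon> C F z w) (F ^ \<epsilon> * (F * w + (- 1) * C * ((z + w) ^ \<epsilon> - z ^ \<epsilon>)))"
    unfolding gw_def using cg_add[OF cg_refl L, of "F ^ Suc \<epsilon> * w - F ^ \<epsilon> * C * (z + w) ^ \<epsilon>"]
    by (simp add: algebra_simps)
  have Z: "cg ?M (gz \<epsilon> C F z w) (F ^ \<epsilon> * (F * z - (- 1) * C * (z + w) ^ \<epsilon>))"
    unfolding gz_def by simp
  have "cg ?M (gw \<epsilon> C F z w ^ Suc k * (\<alpha> * gz \<epsilon> C F z w + \<beta> * gw \<epsilon> C F z w) + q')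
      (F ^ (\<epsilon> * (k + 2)) * (F ^ Suc k * (F * p0 + (- 1) * C * p0 * q)) + F ^ (Suc \<epsilon> * (k + 2)) * (C * q))"
    by (intro cg_add leading_terms[OF W Z] q')
  also have "F ^ (Suc \<epsilon> * (k + 2)) * (C * q) = F ^ (\<epsilon> * (k + 2)) * (F ^ Suc k * (F * (C * q)))"
    by (simp add: power_add algebra_simps)
  also have "F ^ (\<epsilon> * (k + 2)) * (F ^ Suc k * (F * p0 + (- 1) * C * p0 * q)) +
      F ^ (\<epsilon> * (k + 2)) * (F ^ Suc k * (F * (C * q))) =
      F ^ (\<epsilon> * (k + 2)) * (F ^ Suc k * (F * p0 + (F - p0) * (C * q)))"
    by (simp add: algebra_simps)
  also have "cg ?M \<dots> (F ^ (\<epsilon> * (k + 2)) * (F ^ Suc k * (F * F)))"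
  proof (intro cg_mult cg_refl)
    have "F * p0 + (F - p0) * (C * q) - F * F = x ^ Suc k * (y * (C * q - F))"
      by (simp add: F algebra_simps)
    then show "cg ?M (F * p0 + (F - p0) * (C * q)) (F * F)"
      unfolding cg_def by simp
  qed
  also have "F ^ (\<epsilon> * (k + 2)) * (F ^ Suc k * (F * F)) = F ^ (Suc \<epsilon> * (k + 2) + 1)"
    by (simp add: power_add algebra_simps)
  finally show ?thesis
    using cg_sym unfolding cg_def by blast
qed

end


section \<open>Two families of hypersurfaces with isomorphic complements\<close>

lemma lookup_single_mult:
  fixes p :: "'k::comm_ring_1 mpoly"
  shows "Poly_Mapping.lookup (Poly_Mapping.single m0 1 * p) (m0 + m) = Poly_Mapping.lookup p m"
  by (induction p rule: mpoly_terms_induct)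
    (simp_all add: mult_single lookup_single lookup_add distrib_left when_def)

text \<open>Multiplication by a power of a variable shifts monomials without merging them. It gives
  the degree of the y-coordinate, which is obtained only as a quotient.\<close>

lemma forms_var_power_cancel:
  fixes p :: "'k::comm_ring_1 mpoly"
  assumes "var i ^ r * p \<in> forms n e'" "e' = r + e"
  shows "p \<in> forms n e"
proof -
  let ?m = "Poly_Mapping.single i r :: nat \<Rightarrow>\<^sub>0 nat"
  have "?m + m \<in> Poly_Mapping.keys (var i ^ r * p)" if "m \<in> Poly_Mapping.keys p" for m
    using that by (simp add: var_power in_keys_iff lookup_single_mult)
  then have *: "monom_degree (?m + m) = r + e" "Poly_Mapping.keys (?m + m) \<subseteq> {..n}"
    if "m \<in> Poly_Mapping.keys p" for m
    using assms that by (auto simp: forms_def polys_def)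
  have "monom_degree m = e \<and> Poly_Mapping.keys m \<subseteq> {..n}" if "m \<in> Poly_Mapping.keys p" for m
    using *[OF that] by (simp add: monom_degree_add keys_add_nat)
  then show ?thesis
    by (auto simp: forms_def polys_def)
qed

lemma forms_var_Suc [simp]: "i \<le> n \<Longrightarrow> var i \<in> forms n (Suc 0)"
  using forms_var[of i n] by simp

lemma var_nonzero [simp]: "var i \<noteq> (0 :: 'k::comm_ring_1 mpoly)"
  unfolding var_def by (metis lookup_single_eq lookup_zero zero_neq_one)

text \<open>Two choices are possible: c = 0, e = 2, used for d \<ge> 4, and c = 1, e = 1, used for
  cubics. The second involves the variable v of index 4, hence n \<ge> 4.\<close>

locale family =
  fixes n k c e :: nat and \<alpha> \<beta> a b g :: "'k::field"
  assumes k: "k \<ge> 1" and ce: "c + e = 2" "e \<ge> 1" and n: "n \<ge> 3" "c = 0 \<or> n \<ge> 4"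
begin

abbreviation x :: "'k mpoly" where "x \<equiv> var 0"
abbreviation y :: "'k mpoly" where "y \<equiv> var 1"
abbreviation z :: "'k mpoly" where "z \<equiv> var 2"
abbreviation w :: "'k mpoly" where "w \<equiv> var 3"
abbreviation v :: "'k mpoly" where "v \<equiv> var 4"

definition p0 :: "'k mpoly" where
  "p0 = w ^ Suc k * (cst \<alpha> * z + cst \<beta> * w)"

definition C :: "'k mpoly" where
  "C = x ^ k * v ^ c"

text \<open>For e = 1 the second and the third monomial are both w, and the coefficient of w is b +
  g.\<close>

definition q :: "'k mpoly" where
  "q = cst a * z ^ e + cst b * (z ^ (e - 1) * w) + cst g * w ^ e"

definition f0 :: "'k mpoly" where
  "f0 = x ^ Suc k * y + p0"

definition f1 :: "'k mpoly" where
  "f1 = f0 + C * q"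

lemma C_form: "C \<in> forms n (k + c)"
proof -
  have "v ^ c \<in> forms n c"
    using n(2) forms_power[OF forms_var, of 4 n c c] by (cases "c = 0") simp_all
  from forms_mult[OF forms_power[OF forms_var[of 0 n], of k k] this refl] show ?thesis
    by (simp add: C_def)
qed

lemma p0_form: "p0 \<in> forms n (k + 2)"
  unfolding p0_def using n
  by (intro forms_mult[OF forms_power[OF forms_var refl]] forms_add forms_scale forms_var) auto

lemma q_form: "q \<in> forms n e"
  unfolding q_def using n ce
  by (intro forms_add forms_scale forms_power[OF forms_var] forms_mult[OF forms_power[OF forms_var refl] forms_var]) auto

lemma f0_form: "f0 \<in> forms n (k + 2)"
  unfolding f0_def using n p0_form
  by (intro forms_add forms_mult[OF forms_power[OF forms_var refl] forms_var]) auto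

lemma f1_form: "f1 \<in> forms n (k + 2)"
  unfolding f1_def using ce by (intro forms_add f0_form forms_mult[OF C_form q_form]) simp

end

locale modification = family n k c e \<alpha> \<beta> a b g
  for n k c e :: nat and \<alpha> \<beta> a b g :: "'k::field" +
  assumes id: "of_nat (Suc k) * w ^ k * ((z + w) ^ Suc e - z ^ Suc e) * (cst \<alpha> * z + cst \<beta> * w) +
      w ^ Suc k * (cst \<beta> * ((z + w) ^ Suc e - z ^ Suc e) - cst \<alpha> * (z + w) ^ Suc e) = p0 * q"
begin

text \<open>Affinely, the map sends z, w to Z / F^K, W / F^K and gives y a denominator F^(K d).
  Multiplying all coordinates by F^(K d) leaves F^j in front of Z and W, as K d = j + K, and
  produces forms of degree N.\<close>

definition "d = k + 2"
definition "K = e + 2"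
definition "j = K * Suc k"
definition "N = K * d ^ 2 + 1"

lemma cases_ce: "(c = 0 \<and> e = 2) \<or> (c = 1 \<and> e = 1)"
  using ce by arith

text \<open>The first line equalizes the degrees of the coordinates and the factors in the equation.
  The fourth identity writes F^N in the shape that the shear identities require of F'. The last two
  compute the factor common to all coordinates of the composites.\<close>

lemma exponents:
  shows "j + K = K * d" "K * d * Suc k = j * d" "j * d + (K * d + 1) = N"
    and "K * d * (k + c) + j * e + Suc e * Suc e = N"
    and "N * j + (N * Suc e + (K * d * (k + c) + j * Suc e + Suc e * Suc e) + Suc (Suc e)) = K * d * (N + 1)"
    and "K * d * (N + 1) * d + 1 = N * N"
proof -
  show "j + K = K * d" "K * d * Suc k = j * d" "j * d + (K * d + 1) = N"
    by (simp_all add: j_def N_def K_def d_def algebra_simps power2_eq_square)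
  show "K * d * (N + 1) * d + 1 = N * N"
    by (simp add: N_def algebra_simps power2_eq_square)
  show "K * d * (k + c) + j * e + Suc e * Suc e = N"
    "N * j + (N * Suc e + (K * d * (k + c) + j * Suc e + Suc e * Suc e) + Suc (Suc e)) = K * d * (N + 1)"
    unfolding j_def N_def K_def d_def using cases_ce
    by (elim disjE conjE; simp only:; simp add: algebra_simps power2_eq_square)+
qed

lemma unscaled_forms:
  fixes F :: "'k mpoly"
  assumes "F \<in> forms n d"
  shows "fz (Suc e) C F z w \<in> forms n (K * d + 1)" "fw (Suc e) C F z w \<in> forms n (K * d + 1)"
    "gz (Suc e) C F z w \<in> forms n (K * d + 1)" "gw (Suc e) C F z w \<in> forms n (K * d + 1)"
proof -
  have C: "C \<in> forms n (k + c)"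
    by (rule C_form)
  have zw: "z \<in> forms n 1" "w \<in> forms n 1" "z + w \<in> forms n 1"
    using n by (auto intro!: forms_add forms_var)
  have deg: "d + 1 = k + c + Suc e * 1"
    using ce by (simp add: d_def)
  have Fzw: "F * z \<in> forms n (d + 1)" "F * w \<in> forms n (d + 1)" "F * (z + w) \<in> forms n (d + 1)"
    using forms_mult[OF assms _ refl] zw by blast+
  have Cz: "C * z ^ Suc e \<in> forms n (d + 1)" "C * (z + w) ^ Suc e \<in> forms n (d + 1)"
    using forms_mult[OF C forms_power[OF zw(1) refl] deg] forms_mult[OF C forms_power[OF zw(3) refl] deg] by auto
  have deg': "K * d + 1 = k + c + Suc e * (d + 1)" "K * d + 1 = Suc (Suc e) * d + 1"
    "K * d + 1 = Suc e * d + (d + 1)"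
    using deg ce by (auto simp: K_def algebra_simps)
  note L = forms_mult[OF C forms_power[OF forms_diff[OF Fzw(3) Cz(1)] refl] deg'(1)]
    forms_mult[OF C forms_power[OF forms_add[OF Fzw(1) Cz(2)] refl] deg'(1)]
  note FK = forms_mult[OF forms_power[OF assms refl] zw(1) deg'(2)] forms_mult[OF forms_power[OF assms refl] zw(2) deg'(2)]
  note FC = forms_mult[OF forms_power[OF assms refl] forms_diff[OF Fzw(2) Cz(1)] deg'(3)]
    forms_mult[OF forms_power[OF assms refl] Cz(2) deg'(3)]
    forms_mult[OF forms_power[OF assms refl] forms_add[OF Fzw(1) Cz(2)] deg'(3)]
  show "fz (Suc e) C F z w \<in> forms n (K * d + 1)" "fw (Suc e) C F z w \<in> forms n (K * d + 1)"
    "gz (Suc e) C F z w \<in> forms n (K * d + 1)" "gw (Suc e) C F z w \<in> forms n (K * d + 1)"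
    unfolding fz_def fw_def gz_def gw_def mult.assoc[of "F ^ Suc e" C]
    by (rule forms_add forms_diff L FK FC)+
qed

lemma scaled_form:
  fixes F Z :: "'k mpoly"
  assumes "F \<in> forms n d" "Z \<in> forms n (K * d + 1)"
  shows "F ^ j * Z \<in> forms n N"
  by (rule forms_mult[OF forms_power[OF assms(1) refl] assms(2)]) (use exponents(3) in simp)

definition qq :: "'k mpoly \<Rightarrow> 'k mpoly \<Rightarrow> 'k mpoly" where
  "qq Z W = cst a * Z ^ e + cst b * (Z ^ (e - 1) * W) + cst g * W ^ e"

definition pp :: "'k mpoly \<Rightarrow> 'k mpoly \<Rightarrow> 'k mpoly" where
  "pp Z W = W ^ Suc k * (cst \<alpha> * Z + cst \<beta> * W)"

lemma qq_form:
  assumes "Z \<in> forms n r" "W \<in> forms n r"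
  shows "qq Z W \<in> forms n (e * r)"
proof -
  have e: "e * r = (e - 1) * r + r"
    using ce(2) by (cases e) simp_all
  show ?thesis
    unfolding qq_def
    by (intro forms_add forms_scale forms_power[OF assms(1) refl] forms_power[OF assms(2) refl]
        forms_mult[OF forms_power[OF assms(1) refl] assms(2) e])
qed

lemma pp_form: "Z \<in> forms n r \<Longrightarrow> W \<in> forms n r \<Longrightarrow> pp Z W \<in> forms n (d * r)"
  unfolding pp_def by (rule forms_mult[OF forms_power[OF _ refl] forms_add[OF forms_scale forms_scale]])
    (auto simp: d_def algebra_simps)

lemma qq_scale: "qq (s * Z) (s * W) = s ^ e * qq Z W"
proof -
  have "s ^ e = s ^ (e - 1) * s"
    using ce(2) by (cases e) simp_all
  then show ?thesis
    by (simp add: qq_def power_mult_distrib algebra_simps)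
qed

lemma pp_scale: "pp (s * Z) (s * W) = s ^ d * pp Z W"
  by (simp add: pp_def d_def power_mult_distrib algebra_simps)

lemma pq: "p0 = pp z w" "q = qq z w"
  by (simp_all add: p0_def pp_def q_def qq_def)

text \<open>The equation is linear in y with coefficient x^(k+1), so y becomes a quotient G. Its
  degree is d (K d + 1) - (k + 1) = N, and scaling x by F^(K d) costs the same factor F^(j d) as
  scaling Z and W by F^j.\<close>

lemma chart_map:
  fixes F S :: "'k mpoly"
  assumes F: "F \<in> forms n d" and S: "S \<in> forms n (d * (K * d + 1))"
    and dvd: "x ^ Suc k dvd F ^ (K * d + 1) - S"
  obtains G where "G \<in> forms n N" "(F ^ (K * d) * x) ^ Suc k * G + F ^ (j * d) * S = F ^ N"
proof -
  obtain G where G: "F ^ (K * d + 1) - S = x ^ Suc k * G"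
    using dvd by (auto elim: dvdE)
  show ?thesis
  proof (rule that)
    have "x ^ Suc k * G \<in> forms n (d * (K * d + 1))"
      unfolding G[symmetric] by (rule forms_diff[OF forms_power[OF F] S]) (rule mult.commute)
    then show "G \<in> forms n N"
      by (rule forms_var_power_cancel) (simp add: N_def d_def algebra_simps power2_eq_square)
    have "(F ^ (K * d) * x) ^ Suc k * G = F ^ (j * d) * (x ^ Suc k * G)"
      unfolding power_mult_distrib power_mult[symmetric] exponents(2) by (simp only: mult.assoc)
    also have "\<dots> + F ^ (j * d) * S = F ^ (j * d) * F ^ (K * d + 1)"
      unfolding G[symmetric] by (simp only: distrib_left[symmetric] diff_add_cancel)
    also have "\<dots> = F ^ N"
      by (simp only: power_add[symmetric] exponents(3))
    finally show "(F ^ (K * d) * x) ^ Suc k * G + F ^ (j * d) * S = F ^ N" .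
  qed
qed

text \<open>The inverse map is F^K times the identity modulo C. Hence the term C q is altered, apart
  from scaling, only by multiples of C^2.\<close>

lemma gz_cg: "cg C (gz (Suc e) C F z w) (F ^ K * z)" "cg C (gw (Suc e) C F z w) (F ^ K * w)"
proof -
  have "gz (Suc e) C F z w - F ^ K * z = C * (F ^ Suc e * (z + w) ^ Suc e)"
    unfolding gz_def K_def distrib_left by simp
  then show "cg C (gz (Suc e) C F z w) (F ^ K * z)"
    by (simp add: cg_def)
  have "gw (Suc e) C F z w - F ^ K * w =
      C * ((F * z + C * (z + w) ^ Suc e) ^ Suc e - F ^ Suc e * (z + w) ^ Suc e)"
    unfolding gw_def K_def right_diff_distrib by (simp add: mult.left_commute)
  then show "cg C (gw (Suc e) C F z w) (F ^ K * w)"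
    by (simp add: cg_def)
qed

text \<open>
  The coordinate with index 1 is chosen last, by dividing by the power of \<open>x\<close> that occurs with it.
\<close>

lemma map_exists:
  fixes F :: "'k mpoly" and Z W S :: "'k mpoly"
  assumes F: "F \<in> forms n d" and ZW: "Z \<in> forms n (K * d + 1)" "W \<in> forms n (K * d + 1)"
    and S: "S \<in> forms n (d * (K * d + 1))" "x ^ Suc k dvd F ^ (K * d + 1) - S"
  obtains A where "\<forall>i\<le>n. A i \<in> forms n N" "A 2 = F ^ j * Z" "A 3 = F ^ j * W"
    "\<forall>i. i \<notin> {1, 2, 3} \<longrightarrow> A i = F ^ (K * d) * var i"
    "A 0 ^ Suc k * A 1 + F ^ (j * d) * S = F ^ N"
proof -
  obtain G where G: "G \<in> forms n N" "(F ^ (K * d) * x) ^ Suc k * G + F ^ (j * d) * S = F ^ N"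
    using F S by (rule chart_map)
  define A where "A i = (if i = 1 then G else if i = 2 then F ^ j * Z else if i = 3 then F ^ j * W
    else F ^ (K * d) * var i)" for i
  have Fx: "F ^ (K * d) * var i \<in> forms n N" if "i \<le> n" for i
    by (rule forms_mult[OF forms_power[OF F refl] forms_var[OF that]]) (simp add: N_def power2_eq_square)
  have "A i \<in> forms n N" if "i \<le> n" for i
    using that G(1) Fx scaled_form[OF F ZW(1)] scaled_form[OF F ZW(2)] by (simp add: A_def)
  then show ?thesis
    using G(2) by (intro that[of A]) (simp_all add: A_def)
qed

lemma subst_C:
  assumes "\<forall>i. i \<notin> {1, 2, 3} \<longrightarrow> A i = F ^ (K * d) * var i"
  shows "subst cst A C = F ^ (K * d * (k + c)) * C"
proof -
  have "subst cst A C = (F ^ (K * d) * x) ^ k * (F ^ (K * d) * v) ^ c"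
    using assms by (simp add: C_def)
  also have "\<dots> = F ^ (K * d * (k + c)) * C"
    unfolding power_mult_distrib power_mult[symmetric] distrib_left power_add C_def
    by (simp only: mult.assoc mult.left_commute mult.commute)
  finally show ?thesis .
qed

text \<open>Serves both composites. The assumptions on Z' and W' are the shear identities with t =
  F^j, T = F^(j (k + c)) and Q = F^(K (k + c)).\<close>

lemma composite:
  fixes F F' Z W Z' W' :: "'k mpoly" and A B :: "nat \<Rightarrow> 'k mpoly"
  assumes A: "A 2 = F ^ j * Z" "A 3 = F ^ j * W" "\<forall>i. i \<notin> {1, 2, 3} \<longrightarrow> A i = F ^ (K * d) * var i"
    and F': "subst cst A F' = F ^ N"
    and B: "B 2 = F' ^ j * Z'" "B 3 = F' ^ j * W'" "\<forall>i. i \<notin> {1, 2, 3} \<longrightarrow> B i = F' ^ (K * d) * var i"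
    and Z': "subst cst A Z' = (F ^ N) ^ Suc e * (F ^ (j * (k + c)) * F ^ (K * (k + c)) * (F ^ j) ^ Suc e *
        F ^ (Suc e * Suc e)) * F ^ Suc (Suc e) * z"
    and W': "subst cst A W' = (F ^ N) ^ Suc e * (F ^ (j * (k + c)) * F ^ (K * (k + c)) * (F ^ j) ^ Suc e *
        F ^ (Suc e * Suc e)) * F ^ Suc (Suc e) * w"
    and i: "i \<noteq> 1"
  shows "subst cst A (B i) = F ^ (K * d * (N + 1)) * var i"
proof -
  have const: "(F ^ N) ^ j * ((F ^ N) ^ Suc e * (F ^ (j * (k + c)) * F ^ (K * (k + c)) * (F ^ j) ^ Suc e *
      F ^ (Suc e * Suc e)) * F ^ Suc (Suc e)) = F ^ (K * d * (N + 1))"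
  proof -
    have "K * d * (k + c) = j * (k + c) + K * (k + c)"
      using exponents(1) by (metis distrib_right)
    then show ?thesis
      unfolding exponents(5)[symmetric] power_mult[symmetric] power_add[symmetric]
      by (simp add: algebra_simps)
  qed
  consider "i = 2" | "i = 3" | "i \<notin> {1, 2, 3}"
    using i by blast
  then show ?thesis
  proof cases
    case 1
    have "subst cst A (B 2) = (F ^ N) ^ j * subst cst A Z'"
      by (simp add: B(1) F')
    then show ?thesis
      unfolding Z' const[symmetric] using 1 by (simp only: mult.assoc)
  next
    case 2
    have "subst cst A (B 3) = (F ^ N) ^ j * subst cst A W'"
      by (simp add: B(2) F')
    then show ?thesis
      unfolding W' const[symmetric] using 2 by (simp only: mult.assoc)
  next
    case 3
    then show ?thesis
      using A(3) B(3) F' by (simp add: power_mult[symmetric] power_add algebra_simps)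
  qed
qed

text \<open>The y-coordinate is recovered indirectly: the composite reproduces the whole equation
  and its part R without y up to the same factor, so x^(k+1) y is what remains, and the power of x
  cancels.\<close>

lemma composite_y:
  fixes F R :: "'k mpoly" and A B :: "nat \<Rightarrow> 'k mpoly"
  assumes x: "subst cst A (B 0) = F ^ (K * d * (N + 1)) * x"
    and total: "subst cst A (B 0 ^ Suc k * B 1 + R) = F ^ (N * N)"
    and R: "subst cst A R = (F ^ (K * d * (N + 1))) ^ d * (F - x ^ Suc k * y)"
    and F0: "F \<noteq> 0"
  shows "subst cst A (B 1) = F ^ (K * d * (N + 1)) * y"
proof -
  let ?s = "F ^ (K * d * (N + 1))"
  have "(?s * x) ^ Suc k * subst cst A (B 1) + ?s ^ d * (F - x ^ Suc k * y) = ?s ^ d * F"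
  proof -
    have "F ^ (N * N) = ?s ^ d * F"
      unfolding exponents(6)[symmetric] by (simp add: power_mult)
    then show ?thesis
      using total unfolding cst.subst_add R cst.subst_mult cst.subst_power x by simp
  qed
  moreover have "?s ^ d = ?s ^ Suc k * ?s"
    by (simp add: d_def mult.commute)
  ultimately have "(?s * x) ^ Suc k * subst cst A (B 1) = (?s * x) ^ Suc k * (?s * y)"
    by (simp add: power_mult_distrib algebra_simps)
  then show ?thesis
    using F0 by simp
qed

lemma subst_pp_qq: "subst cst A p0 = pp (A 2) (A 3)" "subst cst A q = qq (A 2) (A 3)"
  by (simp_all add: p0_def pp_def q_def qq_def)

lemma f_nonzero: "f0 \<noteq> 0" "f1 \<noteq> 0"
proof -
  \<comment> \<open>The point with x = y = 1 and all other coordinates 0 lies off both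
    hypersurfaces.\<close>
  define h :: "nat \<Rightarrow> 'k mpoly" where "h i = (if i = 0 \<or> i = 1 then 1 else 0)" for i
  have "subst cst h f0 = 1" "subst cst h f1 = 1"
    using ce(2) by (simp_all add: f1_def f0_def p0_def q_def C_def h_def power_0_left)
  then show "f0 \<noteq> 0" "f1 \<noteq> 0"
    by auto
qed

theorem isomorphic_complements_f:
  "isomorphic (hypersurface_complement n f0) (hypersurface_complement n f1)"
proof -
  have Nd: "Suc (Suc e) * (k + 2) + 1 = K * d + 1"
    by (simp add: K_def d_def)
  have F: "f0 \<in> forms n d" "f1 \<in> forms n d"
    using f0_form f1_form by (simp_all add: d_def)
  note pf = unscaled_forms[OF F(2)] and pg = unscaled_forms[OF F(1)]
  note id' = id[unfolded p0_def, folded p0_def]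
  have dvdA: "x ^ Suc k dvd f1 ^ (K * d + 1) - pp (fz (Suc e) C f1 z w) (fw (Suc e) C f1 z w)"
    unfolding pp_def Nd[symmetric]
    by (rule forward_dvd[OF k C_def p0_def id]) (simp add: f1_def f0_def)
  obtain A where A: "\<forall>i\<le>n. A i \<in> forms n N" "A 2 = f1 ^ j * fz (Suc e) C f1 z w" "A 3 = f1 ^ j * fw (Suc e) C f1 z w"
    "\<forall>i. i \<notin> {1, 2, 3} \<longrightarrow> A i = f1 ^ (K * d) * var i"
    "A 0 ^ Suc k * A 1 + f1 ^ (j * d) * pp (fz (Suc e) C f1 z w) (fw (Suc e) C f1 z w) = f1 ^ N"
    using F(2) pf(1,2) pp_form[OF pf(1,2)] dvdA by (rule map_exists)
  \<comment> \<open>The image of C q under the map B, after the factor f0^(j d) common to all terms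
    of the equation is split off; see \<open>Bq\<close>.\<close>
  define q' where "q' = f0 ^ (K * (k + c)) * C * qq (gz (Suc e) C f0 z w) (gw (Suc e) C f0 z w)"
  have kc: "k + c + e = d"
    using ce by (simp add: d_def)
  have "cg C (qq (gz (Suc e) C f0 z w) (gw (Suc e) C f0 z w)) (qq (f0 ^ K * z) (f0 ^ K * w))"
    unfolding qq_def using gz_cg by (intro cg_add cg_mult cg_power cg_refl)
  then have "cg (C * C) (C * qq (gz (Suc e) C f0 z w) (gw (Suc e) C f0 z w)) (C * ((f0 ^ K) ^ e * q))"
    unfolding qq_scale pq(2)[symmetric] by (rule cg_mult_dvd)
  then have "cg (x ^ Suc k) (C * qq (gz (Suc e) C f0 z w) (gw (Suc e) C f0 z w)) (C * ((f0 ^ K) ^ e * q))"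
    using CC_dvd[OF k C_def p0_def id] by (rule cg_dvd)
  then have "cg (x ^ Suc k) (f0 ^ (K * (k + c)) * (C * qq (gz (Suc e) C f0 z w) (gw (Suc e) C f0 z w)))
      (f0 ^ (K * (k + c)) * (C * ((f0 ^ K) ^ e * q)))"
    by (rule cg_mult[OF cg_refl])
  also have "f0 ^ (K * (k + c)) * (C * ((f0 ^ K) ^ e * q)) = f0 ^ (K * d) * (C * q)"
  proof -
    have "f0 ^ (K * (k + c)) * (f0 ^ K) ^ e = f0 ^ (K * d)"
      by (simp only: power_mult[symmetric] power_add[symmetric] distrib_left[symmetric] kc)
    moreover have "f0 ^ (K * (k + c)) * (C * ((f0 ^ K) ^ e * q)) = f0 ^ (K * (k + c)) * (f0 ^ K) ^ e * (C * q)"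
      by (simp only: mult.assoc mult.left_commute mult.commute)
    ultimately show ?thesis
      by (simp only:)
  qed
  finally have q': "cg (x ^ Suc k) q' (f0 ^ (Suc (Suc e) * (k + 2)) * (C * q))"
    unfolding q'_def by (simp add: K_def d_def mult.assoc)
  have dvdB: "x ^ Suc k dvd f0 ^ (K * d + 1) - (pp (gz (Suc e) C f0 z w) (gw (Suc e) C f0 z w) + q')"
    unfolding pp_def Nd[symmetric]
    by (rule backward_dvd[OF k C_def p0_def id _ q']) (simp add: f0_def)
  have "q' \<in> forms n (d * (K * d + 1))"
  proof -
    have "d * (K * d + 1) = (k + c + e) * (K * d + 1)"
      by (simp only: kc)
    also have "\<dots> = K * (k + c) * d + (k + c) + e * (K * d + 1)"
      by (simp add: algebra_simps)
    finally show ?thesis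
      unfolding q'_def
      by (intro forms_mult[OF forms_mult[OF forms_power[OF F(1) refl] C_form refl] qq_form[OF pg(3,4)]])
  qed
  then obtain B where B: "\<forall>i\<le>n. B i \<in> forms n N" "B 2 = f0 ^ j * gz (Suc e) C f0 z w" "B 3 = f0 ^ j * gw (Suc e) C f0 z w"
    "\<forall>i. i \<notin> {1, 2, 3} \<longrightarrow> B i = f0 ^ (K * d) * var i"
    "B 0 ^ Suc k * B 1 + f0 ^ (j * d) * (pp (gz (Suc e) C f0 z w) (gw (Suc e) C f0 z w) + q') = f0 ^ N"
    using map_exists[OF F(1) pg(3,4) forms_add[OF pp_form[OF pg(3,4)]] dvdB] by blast
  have Af0: "subst cst A f0 = f1 ^ N"
    using A(5) unfolding f0_def cst.subst_add cst.subst_mult cst.subst_power subst_pp_qq cst.subst_var A(2,3) pp_scale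
    by (simp add: power_mult)
  have Bq: "subst cst B C * subst cst B q = f0 ^ (j * d) * q'"
  proof -
    have "subst cst B C * subst cst B q = f0 ^ (K * d * (k + c)) * C * ((f0 ^ j) ^ e * qq (gz (Suc e) C f0 z w) (gw (Suc e) C f0 z w))"
      unfolding subst_C[OF B(4)] subst_pp_qq B(2,3) qq_scale by simp
    moreover have "f0 ^ (K * d * (k + c)) * (f0 ^ j) ^ e = f0 ^ (j * d) * f0 ^ (K * (k + c))"
    proof -
      have "K * d * (k + c) + j * e = j * d + K * (k + c)"
      proof -
        have "K * d * (k + c) + j * e = (j + K) * (k + c) + j * e"
          by (simp only: exponents(1))
        also have "\<dots> = j * (k + c + e) + K * (k + c)"
          by (simp add: algebra_simps)
        finally show ?thesis
          by (simp only: kc)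
      qed
      then show ?thesis
        by (simp only: power_mult[symmetric] power_add[symmetric])
    qed
    moreover have "a * C * (b * Q) = a * b * (C * Q)" for a b Q :: "'k mpoly"
      by (simp only: mult.assoc mult.left_commute mult.commute)
    moreover have "f0 ^ (j * d) * f0 ^ (K * (k + c)) * (C * Q) = f0 ^ (j * d) * (f0 ^ (K * (k + c)) * C * Q)" for Q
      by (simp only: mult.assoc)
    ultimately show ?thesis
      unfolding q'_def by metis
  qed
  have Bf0: "subst cst B f0 = B 0 ^ Suc k * B 1 + f0 ^ (j * d) * pp (gz (Suc e) C f0 z w) (gw (Suc e) C f0 z w)"
    unfolding f0_def[of] cst.subst_add cst.subst_mult cst.subst_power subst_pp_qq cst.subst_var B(2,3) pp_scale
    by (simp add: power_mult)
  have Bf1: "subst cst B f1 = f0 ^ N"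
    unfolding f1_def cst.subst_add cst.subst_mult Bf0 Bq using B(5) by (simp add: algebra_simps)
  \<comment> \<open>The next two facts split the powers of F into the cofactors T, Q and t of the
    shear identities.\<close>
  have CQ: "F ^ (K * d * (k + c)) * C = F ^ (j * (k + c)) * F ^ (K * (k + c)) * C" for F :: "'k mpoly"
    by (simp add: exponents(1)[symmetric] power_add distrib_right)
  have FN: "F ^ N = F ^ (j * (k + c)) * (F ^ j) ^ e * F ^ (K * (k + c)) * F ^ (Suc e * Suc e)" for F :: "'k mpoly"
    unfolding exponents(4)[symmetric] exponents(1)[symmetric]
    by (simp add: power_add power_mult[symmetric] distrib_right algebra_simps)
  note inst = refl CQ FN
  have Agz: "subst cst A (gz (Suc e) C f0 z w) = gz (Suc e) (subst cst A C) (subst cst A f0) (A 2) (A 3)"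
    "subst cst A (gw (Suc e) C f0 z w) = gw (Suc e) (subst cst A C) (subst cst A f0) (A 2) (A 3)"
    by (simp_all add: gz_def gw_def)
  have Bfz: "subst cst B (fz (Suc e) C f1 z w) = fz (Suc e) (subst cst B C) (subst cst B f1) (B 2) (B 3)"
    "subst cst B (fw (Suc e) C f1 z w) = fw (Suc e) (subst cst B C) (subst cst B f1) (B 2) (B 3)"
    by (simp_all add: fz_def fw_def)
  have AB: "subst cst A (B i) = f1 ^ (K * d * (N + 1)) * var i" if "i \<noteq> 1" for i
  proof (rule composite[OF A(2-4) Af0 B(2-4) _ _ that])
    show "subst cst A (gz (Suc e) C f0 z w) = (f1 ^ N) ^ Suc e * (f1 ^ (j * (k + c)) * f1 ^ (K * (k + c)) * (f1 ^ j) ^ Suc e *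
        f1 ^ (Suc e * Suc e)) * f1 ^ Suc (Suc e) * z"
      unfolding Agz subst_C[OF A(4)] Af0 A(2,3) by (rule gz_fz[OF refl CQ FN])
    show "subst cst A (gw (Suc e) C f0 z w) = (f1 ^ N) ^ Suc e * (f1 ^ (j * (k + c)) * f1 ^ (K * (k + c)) * (f1 ^ j) ^ Suc e *
        f1 ^ (Suc e * Suc e)) * f1 ^ Suc (Suc e) * w"
      unfolding Agz subst_C[OF A(4)] Af0 A(2,3) by (rule gw_fw[OF refl CQ FN])
  qed
  have BA: "subst cst B (A i) = f0 ^ (K * d * (N + 1)) * var i" if "i \<noteq> 1" for i
  proof (rule composite[OF B(2-4) Bf1 A(2-4) _ _ that])
    show "subst cst B (fz (Suc e) C f1 z w) = (f0 ^ N) ^ Suc e * (f0 ^ (j * (k + c)) * f0 ^ (K * (k + c)) * (f0 ^ j) ^ Suc e *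
        f0 ^ (Suc e * Suc e)) * f0 ^ Suc (Suc e) * z"
      unfolding Bfz subst_C[OF B(4)] Bf1 B(2,3) by (rule fz_gz[OF refl CQ FN])
    show "subst cst B (fw (Suc e) C f1 z w) = (f0 ^ N) ^ Suc e * (f0 ^ (j * (k + c)) * f0 ^ (K * (k + c)) * (f0 ^ j) ^ Suc e *
        f0 ^ (Suc e * Suc e)) * f0 ^ Suc (Suc e) * w"
      unfolding Bfz subst_C[OF B(4)] Bf1 B(2,3) by (rule fw_gw[OF refl CQ FN])
  qed
  have AB1: "subst cst A (B 1) = f1 ^ (K * d * (N + 1)) * y"
  proof (rule composite_y[where R = "pp (B 2) (B 3) + subst cst B C * qq (B 2) (B 3)"])
    let ?s = "f1 ^ (K * d * (N + 1))"
    have "subst cst B f1 = B 0 ^ Suc k * B 1 + (pp (B 2) (B 3) + subst cst B C * qq (B 2) (B 3))"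
      unfolding f1_def f0_def by (simp only: cst.subst_add cst.subst_mult cst.subst_power cst.subst_var subst_pp_qq add.assoc)
    moreover have "subst cst A (subst cst B f1) = f1 ^ (N * N)"
      by (simp only: Bf1 cst.subst_power Af0 power_mult)
    ultimately show "subst cst A (B 0 ^ Suc k * B 1 + (pp (B 2) (B 3) + subst cst B C * qq (B 2) (B 3))) = f1 ^ (N * N)"
      by (simp only:)
    have "subst cst A (subst cst B C) = ?s ^ (k + c) * C"
      unfolding subst_C[OF B(4)] cst.subst_mult cst.subst_power subst_C[OF A(4)] Af0
      by (simp add: power_mult[symmetric] power_add[symmetric] mult.assoc[symmetric]) (simp add: algebra_simps)
    moreover have "subst cst A (pp (B 2) (B 3)) = ?s ^ d * p0" "subst cst A (qq (B 2) (B 3)) = ?s ^ e * q"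
    proof -
      have "subst cst A (pp (B 2) (B 3)) = pp (subst cst A (B 2)) (subst cst A (B 3))"
        "subst cst A (qq (B 2) (B 3)) = qq (subst cst A (B 2)) (subst cst A (B 3))"
        by (simp_all add: pp_def qq_def)
      then show "subst cst A (pp (B 2) (B 3)) = ?s ^ d * p0" "subst cst A (qq (B 2) (B 3)) = ?s ^ e * q"
        by (simp_all only: AB[of 2, simplified] AB[of 3, simplified] pp_scale qq_scale pq[symmetric])
          (simp_all add: AB pp_scale qq_scale pq)
    qed
    ultimately have "subst cst A (pp (B 2) (B 3) + subst cst B C * qq (B 2) (B 3)) = ?s ^ d * p0 + ?s ^ (k + c) * C * (?s ^ e * q)"
      by simp
    also have "\<dots> = ?s ^ d * (p0 + C * q)"
      unfolding kc[symmetric] power_add by (simp add: algebra_simps)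
    also have "p0 + C * q = f1 - x ^ Suc k * y"
      by (simp add: f1_def f0_def)
    finally show "subst cst A (pp (B 2) (B 3) + subst cst B C * qq (B 2) (B 3)) = ?s ^ d * (f1 - x ^ Suc k * y)" .
  qed (use AB f_nonzero in auto)
  have BA1: "subst cst B (A 1) = f0 ^ (K * d * (N + 1)) * y"
  proof (rule composite_y[where R = "pp (A 2) (A 3)"])
    let ?s = "f0 ^ (K * d * (N + 1))"
    have "subst cst A f0 = A 0 ^ Suc k * A 1 + pp (A 2) (A 3)"
      unfolding f0_def by (simp only: cst.subst_add cst.subst_mult cst.subst_power cst.subst_var subst_pp_qq)
    moreover have "subst cst B (subst cst A f0) = f0 ^ (N * N)"
      by (simp only: Af0 cst.subst_power Bf1 power_mult)
    ultimately show "subst cst B (A 0 ^ Suc k * A 1 + pp (A 2) (A 3)) = f0 ^ (N * N)"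
      by (simp only:)
    have "subst cst B (pp (A 2) (A 3)) = pp (subst cst B (A 2)) (subst cst B (A 3))"
      by (simp add: pp_def)
    also have "\<dots> = ?s ^ d * p0"
      by (simp add: BA pp_scale pq)
    also have "p0 = f0 - x ^ Suc k * y"
      by (simp add: f0_def)
    finally show "subst cst B (pp (A 2) (A 3)) = ?s ^ d * (f0 - x ^ Suc k * y)" .
  qed (use BA f_nonzero in auto)
  show ?thesis
  proof (rule isomorphic_complements[where A=A and B=B])
    show "subst cst A (B i) = f1 ^ (K * d * (N + 1)) * var i" for i
      using AB AB1 by (cases "i = 1") auto
    show "subst cst B (A i) = f0 ^ (K * d * (N + 1)) * var i" for i
      using BA BA1 by (cases "i = 1") auto
    show "N > 0" "N > 0"
      by (simp_all add: N_def)
    show "k + 2 > 0" "k + 2 > 0"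
      by simp_all
  qed (use A(1) B(1) Af0 Bf1 f0_form f1_form in auto)
qed

end


section \<open>Homogeneous coordinate rings\<close>

lemma (in coeff_hom) hom_subst:
  fixes \<phi> :: "'b \<Rightarrow> 'c::comm_ring_1"
  assumes "\<phi> 0 = 0" "\<phi> 1 = 1" "\<And>a b. \<phi> (a + b) = \<phi> a + \<phi> b" "\<And>a b. \<phi> (a * b) = \<phi> a * \<phi> b"
  shows "\<phi> (subst h g p) = subst (\<lambda>a. \<phi> (h a)) (\<lambda>i. \<phi> (g i)) p"
proof -
  have pow: "\<phi> (x ^ r) = \<phi> x ^ r" for x r
    by (induction r) (simp_all add: assms)
  have prod: "\<phi> (prod F A) = (\<Prod>x\<in>A. \<phi> (F x))" for F :: "nat \<Rightarrow> 'b" and A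
    by (induction A rule: infinite_finite_induct) (simp_all add: assms)
  have sum: "\<phi> (sum F A) = (\<Sum>x\<in>A. \<phi> (F x))" for F :: "(nat \<Rightarrow>\<^sub>0 nat) \<Rightarrow> 'b" and A
    by (induction A rule: infinite_finite_induct) (simp_all add: assms)
  show ?thesis
    by (simp add: subst_def monom_eval_def sum prod pow assms)
qed

interpretation ev: coeff_hom "id :: 'k::comm_ring_1 \<Rightarrow> 'k"
  by unfold_locales simp_all

text \<open>The univariate indeterminate serves as a formal parameter T: it marks the order at a
  point, and later it separates the variable y from the others.\<close>

interpretation pol: coeff_hom "\<lambda>a::'k::comm_ring_1. [:cst a:]"
proof (rule coeff_hom.intro)
  fix a b :: 'k
  show "[:cst (0::'k):] = 0"
    by simp
  show "[:cst (1::'k):] = 1"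
    by (simp only: single_one pCons_one)
  have "[:cst a * cst b:] = [:cst a:] * [:cst b:]"
    by simp
  then show "[:cst (a * b):] = [:cst a:] * [:cst b:]"
    by (simp only: mult_single add_0)
  show "[:cst (a + b):] = [:cst a:] + [:cst b:]"
    by (simp only: single_add add_pCons add_0)
qed

abbreviation coord_ring :: "nat \<Rightarrow> 'k::field mpoly \<Rightarrow> ('k mpoly set, 'k) graded_algebra" where
  "coord_ring n f \<equiv> graded_quotient (poly_alg n) (PIdl\<^bsub>poly_alg n\<^esub> f)"

definition proj_class :: "nat \<Rightarrow> 'k::field mpoly \<Rightarrow> 'k mpoly \<Rightarrow> 'k mpoly set" where
  "proj_class n f a = (PIdl\<^bsub>poly_alg n\<^esub> f) +>\<^bsub>poly_alg n\<^esub> a"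

locale hyp =
  fixes n d :: nat and f :: "'k::field mpoly"
  assumes f: "f \<in> forms n d"
begin

abbreviation Q :: "('k mpoly set, 'k) graded_algebra" where "Q \<equiv> coord_ring n f"
abbreviation cls :: "'k mpoly \<Rightarrow> 'k mpoly set" where "cls \<equiv> proj_class n f"

lemma ideal_f: "ideal (PIdl\<^bsub>poly_alg n\<^esub> f) (poly_alg n)"
  using forms_polys[OF f] by (intro poly.cgenideal_ideal) simp

lemma minus_poly [simp]: "b \<in> polys n \<Longrightarrow> a \<ominus>\<^bsub>poly_alg n\<^esub> b = a - (b :: 'k mpoly)"
proof -
  assume b: "b \<in> polys n"
  have "\<ominus>\<^bsub>poly_alg n\<^esub> b = - b"
    by (rule poly.minus_equality) (simp_all add: b polys_uminus)
  then show ?thesis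
    by (simp add: a_minus_def)
qed

lemma cls_eq_iff:
  assumes "a \<in> polys n" "b \<in> polys n"
  shows "cls a = cls b \<longleftrightarrow> (\<exists>h\<in>polys n. a - b = h * f)"
proof -
  interpret ideal "PIdl\<^bsub>poly_alg n\<^esub> f" "poly_alg n"
    by (rule ideal_f)
  have "cls a = cls b \<longleftrightarrow> a - b \<in> PIdl\<^bsub>poly_alg n\<^esub> f"
    using poly.quotient_eq_iff_same_a_r_cos[OF ideal_f, of a b] assms
    unfolding proj_class_def by simp
  then show ?thesis
    by (auto simp: cgenideal_def)
qed

lemma Q_simps:
  shows "carrier Q = cls ` polys n"
    and "one Q = cls 1" "zero Q = cls 0"
    and "a \<in> polys n \<Longrightarrow> b \<in> polys n \<Longrightarrow> cls a \<otimes>\<^bsub>Q\<^esub> cls b = cls (a * b)"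
    and "a \<in> polys n \<Longrightarrow> b \<in> polys n \<Longrightarrow> cls a \<oplus>\<^bsub>Q\<^esub> cls b = cls (a + b)"
    and "piece Q i = cls ` forms n i" "scalar Q t = cls (cst t)"
proof -
  interpret I: ideal "PIdl\<^bsub>poly_alg n\<^esub> f" "poly_alg n"
    by (rule ideal_f)
  have ext: "carrier Q = carrier (poly_alg n Quot PIdl\<^bsub>poly_alg n\<^esub> f)" "mult Q = mult (poly_alg n Quot PIdl\<^bsub>poly_alg n\<^esub> f)"
    "one Q = one (poly_alg n Quot PIdl\<^bsub>poly_alg n\<^esub> f)" "zero Q = zero (poly_alg n Quot PIdl\<^bsub>poly_alg n\<^esub> f)"
    "add Q = add (poly_alg n Quot PIdl\<^bsub>poly_alg n\<^esub> f)"
    "piece Q i = cls ` forms n i" "scalar Q t = cls (cst t)"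
    by (simp_all add: graded_quotient_def ring.extend_def graded_algebra.fields_def proj_class_def[abs_def])
  show "carrier Q = cls ` polys n"
    unfolding ext by (auto simp: FactRing_def A_RCOSETS_def' proj_class_def)
  show "one Q = cls 1"
    unfolding ext by (simp add: FactRing_def proj_class_def)
  show "zero Q = cls 0"
    unfolding ext using I.a_rcos_const[OF I.zero_closed] by (simp add: FactRing_def proj_class_def)
  show "a \<in> polys n \<Longrightarrow> b \<in> polys n \<Longrightarrow> cls a \<otimes>\<^bsub>Q\<^esub> cls b = cls (a * b)"
    unfolding ext using I.rcoset_mult_add[of a b] by (simp add: FactRing_def proj_class_def)
  show "a \<in> polys n \<Longrightarrow> b \<in> polys n \<Longrightarrow> cls a \<oplus>\<^bsub>Q\<^esub> cls b = cls (a + b)"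
    unfolding ext using I.a_rcos_sum[of a b] by (simp add: FactRing_def proj_class_def)
  show "piece Q i = cls ` forms n i" "scalar Q t = cls (cst t)"
    by (rule ext)+
qed

lemma cring_Q: "cring Q"
proof (rule cringI)
  show "abelian_group Q"
  proof (rule abelian_groupI)
    fix x assume "x \<in> carrier Q"
    then obtain a where "x = cls a" "a \<in> polys n"
      by (auto simp: Q_simps)
    then show "\<exists>y\<in>carrier Q. y \<oplus>\<^bsub>Q\<^esub> x = \<zero>\<^bsub>Q\<^esub>"
      by (intro bexI[of _ "cls (- a)"]) (auto simp: Q_simps polys_uminus)
  qed (auto simp: Q_simps polys_add algebra_simps)
  show "Group.comm_monoid Q"
    by (rule comm_monoidI) (auto simp: Q_simps polys_mult algebra_simps)
qed (auto simp: Q_simps polys_add polys_mult algebra_simps)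

sublocale Q: graded_cring Q
proof (rule graded_cring.intro[OF cring_Q], unfold_locales)
  show "a \<oplus>\<^bsub>Q\<^esub> b \<in> piece Q i" if ab: "a \<in> piece Q i" "b \<in> piece Q i" for a b i
  proof -
    obtain a' b' where "a = cls a'" "b = cls b'" "a' \<in> forms n i" "b' \<in> forms n i"
      using ab by (auto simp: Q_simps)
    then show ?thesis
      using forms_add[of a' n i b'] Q_simps(5)[OF forms_polys forms_polys, of a' i b' i] by (simp add: Q_simps(6))
  qed
  show "a \<otimes>\<^bsub>Q\<^esub> b \<in> piece Q (i + l)" if ab: "a \<in> piece Q i" "b \<in> piece Q l" for a b i l
  proof -
    obtain a' b' where "a = cls a'" "b = cls b'" "a' \<in> forms n i" "b' \<in> forms n l"
      using ab by (auto simp: Q_simps)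
    then show ?thesis
      using forms_mult[of a' n i b' l] Q_simps(4)[OF forms_polys forms_polys, of a' i b' l] by (simp add: Q_simps(6))
  qed
qed (use forms_polys in \<open>auto simp: Q_simps\<close>)

lemma cls_f [simp]: "cls f = cls 0"
  using forms_polys[OF f] by (subst cls_eq_iff) (auto intro: bexI[of _ 1])

end

text \<open>A rational point \<open>P\<close> with homogeneous coordinates \<open>c\<close>.\<close>

locale kpoint = hyp +
  fixes P :: "'a mpoly set set" and j :: nat and c :: "nat \<Rightarrow> 'a"
  assumes P: "P \<in> proj_points (coord_ring n f)" and j: "j \<le> n" "c j = 1"
    and mem: "\<And>a e. a \<in> forms n e \<Longrightarrow> proj_class n f a \<in> P \<longleftrightarrow> subst id c a = 0"


section \<open>Taylor expansion at a rational point\<close>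

inductive_set lin_span :: "nat \<Rightarrow> (nat \<Rightarrow> 'k::comm_ring_1 mpoly) \<Rightarrow> 'k mpoly set" for n t where
  zero: "0 \<in> lin_span n t"
| gen: "i \<le> n \<Longrightarrow> b \<in> polys n \<Longrightarrow> t i * b \<in> lin_span n t"
| add: "p \<in> lin_span n t \<Longrightarrow> q \<in> lin_span n t \<Longrightarrow> p + q \<in> lin_span n t"

text \<open>The cofactors range over a set \<open>B\<close>: first all polynomials, and after taking
  homogeneous parts the forms of one degree.\<close>

inductive_set sq_span :: "'k mpoly set \<Rightarrow> nat \<Rightarrow> (nat \<Rightarrow> 'k::comm_ring_1 mpoly) \<Rightarrow> 'k mpoly set" for B n t where
  zero: "0 \<in> sq_span B n t"
| gen: "i \<le> n \<Longrightarrow> l \<le> n \<Longrightarrow> b \<in> B \<Longrightarrow> t i * (t l * b) \<in> sq_span B n t"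
| add: "p \<in> sq_span B n t \<Longrightarrow> q \<in> sq_span B n t \<Longrightarrow> p + q \<in> sq_span B n t"

lemma lin_span_mult: "p \<in> lin_span n t \<Longrightarrow> q \<in> polys n \<Longrightarrow> q * p \<in> lin_span n t"
proof (induction rule: lin_span.induct)
  case (gen i b)
  then show ?case
    using lin_span.gen[OF _ polys_mult[of q n b], of i t] by (simp add: mult.left_commute)
qed (auto simp: distrib_left intro: lin_span.zero lin_span.add)

lemma sq_span_mult: "p \<in> sq_span (polys n) n t \<Longrightarrow> q \<in> polys n \<Longrightarrow> q * p \<in> sq_span (polys n) n t"
proof (induction rule: sq_span.induct)
  case (gen i l b)
  then show ?case
    using sq_span.gen[OF _ _ polys_mult[of q n b], of i n l t] by (simp add: mult.left_commute)
qed (auto simp: distrib_left intro: sq_span.zero sq_span.add)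

lemma lin_span_prod:
  assumes p: "p \<in> lin_span n t" and q: "q \<in> lin_span n t"
  shows "p * q \<in> sq_span (polys n) n t"
  using p
proof (induction rule: lin_span.induct)
  case outer: (gen i b)
  show ?case
    using q
  proof (induction rule: lin_span.induct)
    case (gen l b')
    then show ?case
      using sq_span.gen[OF outer(1) gen(1) polys_mult[OF outer(2) gen(2)], of t]
      by (simp add: mult.left_commute mult.assoc)
  qed (auto simp: distrib_left intro: sq_span.zero sq_span.add)
qed (auto simp: distrib_right intro: sq_span.zero sq_span.add)

lemma sq_span_sum: "(\<And>i. i \<in> A \<Longrightarrow> F i \<in> sq_span B n t) \<Longrightarrow> sum F A \<in> sq_span B n t"
  by (induction A rule: infinite_finite_induct) (auto intro: sq_span.zero sq_span.add)

text \<open>Expand p(u + T t): each occurrence of T brings one factor \<open>t i\<close>, and by the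
  product rule this survives multiplication of polynomials.\<close>

lemma taylor_coeffs:
  fixes p :: "'k::comm_ring_1 mpoly"
  assumes p: "p \<in> polys n" and ut: "\<And>i. i \<le> n \<Longrightarrow> u i \<in> polys n \<and> t i \<in> polys n"
  shows "(\<forall>r. coeff (subst (\<lambda>a. [:cst a:]) (\<lambda>i. [:u i, t i:]) p) r \<in> polys n) \<and>
    coeff (subst (\<lambda>a. [:cst a:]) (\<lambda>i. [:u i, t i:]) p) 1 \<in> lin_span n t \<and>
    (\<forall>r\<ge>2. coeff (subst (\<lambda>a. [:cst a:]) (\<lambda>i. [:u i, t i:]) p) r \<in> sq_span (polys n) n t)"
  using p
proof (induction p rule: polys_induct)
  case (cst c)
  then show ?case
    by (auto simp: coeff_pCons split: nat.splits intro: lin_span.zero sq_span.zero)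
next
  case (var i)
  then show ?case
    using ut[of i] lin_span.gen[of i n 1 t]
    by (auto simp: coeff_pCons split: nat.splits intro: lin_span.zero sq_span.zero)
next
  case (add p q)
  then show ?case
    by (auto intro: lin_span.add sq_span.add)
next
  case (mult p q)
  let ?p = "subst (\<lambda>a. [:cst a:]) (\<lambda>i. [:u i, t i:]) p"
  let ?q = "subst (\<lambda>a. [:cst a:]) (\<lambda>i. [:u i, t i:]) q"
  have "coeff (?p * ?q) r \<in> polys n" for r
    unfolding coeff_mult using mult by (auto intro!: polys_sum polys_mult)
  moreover have "coeff (?p * ?q) 1 \<in> lin_span n t"
  proof -
    have "coeff (?p * ?q) 1 = coeff ?p 0 * coeff ?q 1 + coeff ?q 0 * coeff ?p 1"
      by (simp add: coeff_mult mult.commute)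
    then show ?thesis
      using mult by (auto intro!: lin_span.add lin_span_mult)
  qed
  moreover have "coeff (?p * ?q) r \<in> sq_span (polys n) n t" if r: "r \<ge> 2" for r
    unfolding coeff_mult
  proof (rule sq_span_sum)
    fix i assume "i \<in> {..r}"
    then consider "i \<ge> 2" | "i = 0" | "i = 1" "r - i = 1" | "i = 1" "r - i \<ge> 2"
      using r by force
    then show "coeff ?p i * coeff ?q (r - i) \<in> sq_span (polys n) n t"
    proof cases
      case 1
      then show ?thesis
        using mult sq_span_mult[of "coeff ?p i" n t "coeff ?q (r - i)"] by (simp add: mult.commute)
    next
      case 3
      then show ?thesis
        using mult by (auto intro!: lin_span_prod)
    qed (use mult r in \<open>auto intro!: sq_span_mult\<close>)
  qed
  ultimately show ?case
    by simp
qed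

lemma homog_part_mult:
  fixes g p :: "'k::comm_ring_1 mpoly"
  assumes g: "g \<in> forms n r" and p: "p \<in> polys n"
  shows "homog_part (r + e) (g * p) = g * homog_part e p" "i < r \<Longrightarrow> homog_part i (g * p) = 0"
proof -
  obtain F N where F: "\<forall>e. F e \<in> forms n e" "p = (\<Sum>e<N. F e)"
    using p by (rule polys_forms_decomp)
  have gF: "g * F l \<in> forms n (r + l)" for l
    using forms_mult[OF g F(1)[rule_format] refl] .
  have *: "homog_part i (g * p) = (\<Sum>l<N. if i = r + l then g * F l else 0)" for i
    unfolding F(2) sum_distrib_left homog_part_sum homog_part_form[OF gF] ..
  have "homog_part e p = (\<Sum>l<N. if e = l then F l else 0)"
    unfolding F(2) homog_part_sum homog_part_form[OF F(1)[rule_format]] ..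
  then show "homog_part (r + e) (g * p) = g * homog_part e p"
    unfolding * by (simp add: sum_distrib_left if_distrib cong: if_cong)
  show "homog_part i (g * p) = 0" if "i < r"
    unfolding * using that by (intro sum.neutral) auto
qed

lemma homog_part_forms: "p \<in> polys n \<Longrightarrow> homog_part e p \<in> forms n e"
  by (auto simp: forms_def polys_def in_keys_iff lookup_homog_part split: if_splits)

text \<open>The clause e \<ge> 2 empties the set of cofactors in low degree, where the truncated
  difference e - 2 would be wrong.\<close>

lemma sq_span_homog:
  fixes t :: "nat \<Rightarrow> 'k::comm_ring_1 mpoly"
  assumes "p \<in> sq_span (polys n) n t" and t: "\<And>i. i \<le> n \<Longrightarrow> t i \<in> forms n 1"
  shows "homog_part e p \<in> sq_span {b \<in> forms n (e - 2). e \<ge> 2} n t"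
  using assms(1)
proof (induction rule: sq_span.induct)
  case (gen i l b)
  have tt: "t i * t l \<in> forms n 2"
    using forms_mult[OF t[OF gen(1)] t[OF gen(2)], of 2] by simp
  show ?case
  proof (cases "e \<ge> 2")
    case True
    then have "homog_part e (t i * (t l * b)) = t i * (t l * homog_part (e - 2) b)"
      using homog_part_mult(1)[OF tt gen(3), of "e - 2"] le_add_diff_inverse[OF True] by (metis mult.assoc)
    then show ?thesis
      using True gen homog_part_forms by (auto intro!: sq_span.gen)
  next
    case False
    then have "homog_part e (t i * (t l * b)) = 0"
      using homog_part_mult(2)[OF tt gen(3), of e] by (simp add: mult.assoc)
    then show ?thesis
      by (simp add: sq_span.zero)
  qed
qed (auto simp: homog_part_add intro: sq_span.zero sq_span.add)

text \<open>Compare coefficients of T^(r+1): the first product contributes K(0) l1^r l2 with the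
  linear parts l1, l2, while everything else is divisible by T^(r+2).\<close>

lemma linear_parts_product:
  fixes p1 p2 p3 K :: "'k::idom poly"
  assumes "coeff p1 0 = 0" "coeff p2 0 = 0" "coeff p3 0 = 0" "coeff K 0 \<noteq> 0"
    and F: "monom 1 (r + 2) dvd F" and eq: "K * (p1 ^ r * p2) - p3 ^ (r + 2) * G = H * F"
  shows "coeff p1 1 = 0 \<or> coeff p2 1 = 0"
proof -
  define T where "T = monom (1 :: 'k) 1"
  have split: "\<exists>q. p = T * q" if "coeff p 0 = 0" for p
  proof -
    have "T dvd p"
      unfolding T_def monom_1_dvd_iff' using that by (metis less_one)
    then show ?thesis
      by (rule dvdE) blast
  qed
  obtain q1 q2 q3 where q: "p1 = T * q1" "p2 = T * q2" "p3 = T * q3"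
    using split[OF assms(1)] split[OF assms(2)] split[OF assms(3)] by blast
  have "monom (1 :: 'k) (r + 2) = T ^ (r + 2)"
    unfolding T_def monom_power by simp
  then obtain F' where F': "F = T ^ (r + 2) * F'"
    using F by (metis dvdE)
  have "T ^ Suc r * (K * (q1 ^ r * q2)) = T ^ Suc r * (T * (q3 ^ (r + 2) * G + H * F'))"
  proof -
    have "K * (p1 ^ r * p2) = T ^ Suc r * (K * (q1 ^ r * q2))"
      unfolding q by (simp add: power_mult_distrib algebra_simps)
    moreover have "K * (p1 ^ r * p2) = p3 ^ (r + 2) * G + H * F"
      using eq by (simp add: algebra_simps)
    moreover have "p3 ^ (r + 2) * G + H * F = T ^ Suc r * (T * (q3 ^ (r + 2) * G + H * F'))"
      unfolding q F' by (simp add: power_mult_distrib algebra_simps)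
    ultimately show ?thesis by simp
  qed
  moreover have "T ^ Suc r \<noteq> 0"
    unfolding T_def by (simp add: monom_power)
  ultimately have "K * (q1 ^ r * q2) = T * (q3 ^ (r + 2) * G + H * F')"
    by (metis mult_cancel_left)
  then have "poly (K * (q1 ^ r * q2)) 0 = 0"
    by (simp add: poly_monom T_def)
  then have "poly K 0 * (poly q1 0 ^ r * poly q2 0) = 0"
    by simp
  moreover have "poly K 0 \<noteq> 0"
    using assms(4) by (simp add: poly_0_coeff_0)
  moreover have "poly q1 0 = coeff p1 1" "poly q2 0 = coeff p2 1"
    unfolding q T_def by (simp_all add: coeff_monom_mult poly_0_coeff_0)
  ultimately show ?thesis
    by auto
qed

lemma cst_eq_0_iff [simp]: "cst s = (0 :: 'k::comm_ring_1 mpoly) \<longleftrightarrow> s = 0"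
  by (metis lookup_single_eq lookup_zero single_zero)

section \<open>Taylor expansion and products of nonunits at a rational point\<close>

context kpoint
begin

abbreviation ev :: "'a mpoly \<Rightarrow> 'a" where "ev \<equiv> subst id c"

text \<open>Taylor expansion in the chart where the j-th coordinate is 1: x_i becomes c_i + T x_i,
  so the coefficient of T^r is the part of order r at the point.\<close>

definition tau :: "'a mpoly \<Rightarrow> 'a mpoly poly" where
  "tau = subst (\<lambda>a. [:cst a:]) (\<lambda>i. if i = j then 1 else [:cst (c i), var i:])"

lemma tau_simps [simp]:
  "tau 0 = 0" "tau 1 = 1" "tau (a + b) = tau a + tau b" "tau (a - b) = tau a - tau b" "tau (- a) = - tau a"
  "tau (a * b) = tau a * tau b" "tau (a ^ r) = tau a ^ r" "tau (cst s) = [:cst s:]"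
  by (simp_all add: tau_def)

lemma tau_var: "tau (var i) = (if i = j then 1 else [:cst (c i), var i:])"
  by (simp add: tau_def)

lemma tau_0: "coeff (tau a) 0 = cst (ev a)"
proof -
  have "poly (tau a) 0 = subst (\<lambda>a. poly [:cst a:] 0) (\<lambda>i. poly (if i = j then 1 else [:cst (c i), var i:]) 0) a"
    unfolding tau_def by (rule pol.hom_subst) simp_all
  also have "(\<lambda>i. poly (if i = j then 1 else [:cst (c i), var i:]) 0) = (\<lambda>i. cst (c i) :: 'a mpoly)"
    using j by (auto simp: fun_eq_iff)
  also have "(\<lambda>a. poly [:cst a:] 0) = (\<lambda>a. cst (id a) :: 'a mpoly)"
    by simp
  also have "subst (\<lambda>a. cst (id a)) (\<lambda>i. cst (c i)) a = cst (ev a)"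
    by (rule ev.hom_subst[symmetric]) (simp_all add: single_add mult_single)
  finally show ?thesis
    by (simp add: poly_0_coeff_0)
qed

lemma lin_mult: "coeff (tau (a * b)) 1 = cst (ev a) * coeff (tau b) 1 + cst (ev b) * coeff (tau a) 1"
  by (simp add: coeff_mult tau_0 mult.commute)

text \<open>The linear part is a linear form, so x_0 occurs in it with a constant coefficient; the
  product rule preserves this shape.\<close>

lemma lin_var_0:
  assumes "a \<in> polys n"
  shows "\<exists>s. coeff (tau a) 1 = cst s * var 0 + subst cst (\<lambda>i. if i = 0 then 0 else var i) (coeff (tau a) 1)"
  using assms
proof (induction a rule: polys_induct)
  case (cst s)
  then show ?case by (intro exI[of _ 0]) simp
next
  case (var i)
  show ?case
  proof (cases "i = j")
    case True
    then have "coeff (tau (var i)) 1 = 0"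
      by (simp add: tau_var)
    then show ?thesis
      by (intro exI[of _ 0]) simp
  next
    case False
    then have *: "coeff (tau (var i)) 1 = var i"
      by (simp add: tau_var)
    show ?thesis
      unfolding * by (cases "i = 0") (auto intro: exI[of _ 0] exI[of _ 1])
  qed
next
  case (add p q)
  then obtain s s' where s: "coeff (tau p) 1 = cst s * var 0 + subst cst (\<lambda>i. if i = 0 then 0 else var i) (coeff (tau p) 1)"
    "coeff (tau q) 1 = cst s' * var 0 + subst cst (\<lambda>i. if i = 0 then 0 else var i) (coeff (tau q) 1)"
    by blast
  show ?case
    by (rule exI[of _ "s + s'"], simp only: tau_simps coeff_add cst.subst_add, subst s(1), subst s(2))
      (simp add: single_add algebra_simps)
next
  case (mult p q)
  then obtain s s' where s: "coeff (tau p) 1 = cst s * var 0 + subst cst (\<lambda>i. if i = 0 then 0 else var i) (coeff (tau p) 1)"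
    "coeff (tau q) 1 = cst s' * var 0 + subst cst (\<lambda>i. if i = 0 then 0 else var i) (coeff (tau q) 1)"
    by blast
  have "cst (ev p) * coeff (tau q) 1 + cst (ev q) * coeff (tau p) 1 =
      cst (ev p) * (cst s' * var 0 + subst cst (\<lambda>i. if i = 0 then 0 else var i) (coeff (tau q) 1)) +
      cst (ev q) * (cst s * var 0 + subst cst (\<lambda>i. if i = 0 then 0 else var i) (coeff (tau p) 1))"
    using s by metis
  also have "\<dots> = cst (ev p * s' + ev q * s) * var 0 +
      subst cst (\<lambda>i. if i = 0 then 0 else var i) (cst (ev p) * coeff (tau q) 1 + cst (ev q) * coeff (tau p) 1)"
    by (simp add: single_add algebra_simps cst.h_mult)
  finally show ?case
    unfolding lin_mult by blast
qed

abbreviation shift :: "nat \<Rightarrow> 'a mpoly" where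
  "shift i \<equiv> var i - cst (c i) * var j"

lemma shift_form: "i \<le> n \<Longrightarrow> shift i \<in> forms n 1"
  using j by (intro forms_diff forms_scale) auto

lemma ev_shift: "ev (shift i) = 0"
  using j by simp

text \<open>Expand the form along x_i = c_i x_j + T * shift i and set T = 1. The coefficients of
  order 0 and 1 vanish by comparison with \<open>tau\<close>, and each higher one contains two
  shifts.\<close>

lemma sq_span_of_tau:
  assumes a: "a \<in> forms n e" and zero: "ev a = 0" "coeff (tau a) 1 = 0"
  shows "a \<in> sq_span {b \<in> forms n (e - 2). e \<ge> 2} n shift"
proof -
  have yp: "shift i \<in> polys n" if "i \<le> n" for i
    using shift_form[OF that] by (rule forms_polys)
  have ap: "a \<in> polys n"
    using a by (rule forms_polys)
  let ?A = "subst (\<lambda>a. [:cst a:]) (\<lambda>i. [:cst (c i) * var j, shift i:])"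
  let ?B = "subst (\<lambda>a. [:cst a:]) (\<lambda>i. [:var j:] * [:cst (c i), shift i:])"
  let ?C = "subst (\<lambda>a. [:cst a:]) (\<lambda>i. [:cst (c i), shift i:])"
  \<comment> \<open>\<open>?B\<close> is the expansion \<open>?A\<close> with T replaced by x_j
    T.\<close>
  have B: "coeff (?B p) r = var j ^ r * coeff (?A p) r" if "p \<in> polys n" for p r
    using that
  proof (induction p arbitrary: r rule: polys_induct)
    case (cst s)
    then show ?case by (cases r) simp_all
  next
    case (var i)
    then show ?case by (auto simp: coeff_pCons mult.commute split: nat.splits)
  next
    case (mult p q)
    have "coeff (?B p * ?B q) r = (\<Sum>i\<le>r. var j ^ i * coeff (?A p) i * (var j ^ (r - i) * coeff (?A q) (r - i)))"
      unfolding coeff_mult mult ..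
    also have "\<dots> = (\<Sum>i\<le>r. var j ^ r * (coeff (?A p) i * coeff (?A q) (r - i)))"
    proof (rule sum.cong)
      fix i assume "i \<in> {..r}"
      then have "var j ^ r = var j ^ i * (var j ^ (r - i) :: 'a mpoly)"
        by (simp flip: power_add)
      then show "var j ^ i * coeff (?A p) i * (var j ^ (r - i) * coeff (?A q) (r - i)) =
          var j ^ r * (coeff (?A p) i * coeff (?A q) (r - i))"
        by (simp only: mult.assoc mult.left_commute mult.commute)
    qed simp
    finally show ?case
      by (simp add: coeff_mult sum_distrib_left)
  qed (simp add: distrib_left)
  have C: "coeff (?C p) r = subst cst shift (coeff (tau p) r)" if "p \<in> polys n" for p r
    using that
  proof (induction p arbitrary: r rule: polys_induct)
    case (cst s)
    then show ?case by (cases r) simp_all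
  next
    case (var i)
    then show ?case
      using j by (auto simp: tau_var coeff_pCons split: nat.splits)
  next
    case (mult p q)
    then show ?case
      by (simp add: coeff_mult cst.subst_sum)
  qed simp
  \<comment> \<open>Homogeneity extracts x_j^e. Thus the low coefficients of \<open>?A\<close> are,
    up to powers of x_j, those of \<open>tau a\<close> with the shifts put in.\<close>
  have "?B a = [:var j:] ^ e * ?C a"
    by (rule pol.subst_scale[OF a])
  also have "[:var j:] ^ e = [:var j ^ e:]"
    by (simp add: poly_const_pow)
  finally have "coeff (?B a) 1 = var j ^ e * coeff (?C a) 1"
    by simp
  then have "var j * coeff (?A a) 1 = 0"
    using B[OF ap, of 1] C[OF ap, of 1] zero by simp
  then have A1: "coeff (?A a) 1 = 0"
    by simp
  have A0: "coeff (?A a) 0 = 0"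
  proof -
    have "coeff (?B a) 0 = 0"
      using \<open>?B a = [:var j:] ^ e * ?C a\<close> C[OF ap, of 0] zero tau_0[of a]
      by (simp add: coeff_mult)
    then show ?thesis
      using B[OF ap, of 0] by simp
  qed
  have coeffs: "\<forall>r\<ge>2. coeff (?A a) r \<in> sq_span (polys n) n shift"
  proof -
    have "cst (c i) * var j \<in> polys n \<and> shift i \<in> polys n" if "i \<le> n" for i
      using yp[OF that] polys_mult[OF polys_cst polys_var[OF j(1)]] by blast
    from taylor_coeffs[OF ap, of "\<lambda>i. cst (c i) * var j" shift, OF this] show ?thesis
      by blast
  qed
  have "poly (?A a) 1 = subst (\<lambda>a. poly [:cst a:] 1) (\<lambda>i. poly [:cst (c i) * var j, shift i:] 1) a"
    by (rule pol.hom_subst) simp_all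
  then have "a = poly (?A a) 1"
    by simp
  also have "\<dots> = (\<Sum>r\<le>degree (?A a). coeff (?A a) r)"
    by (simp add: poly_altdef)
  also have "\<dots> \<in> sq_span (polys n) n shift"
  proof (rule sq_span_sum)
    fix r
    show "coeff (?A a) r \<in> sq_span (polys n) n shift"
    proof (cases "r \<ge> 2")
      case False
      then have "r = 0 \<or> r = 1" by auto
      then show ?thesis
        using A0 A1 by (auto intro: sq_span.zero)
    qed (use coeffs in simp)
  qed
  \<comment> \<open>The form \<open>a\<close> is its own part of degree e; passing to this part
    turns the cofactors into forms of degree e - 2.\<close>
  finally have "homog_part e a \<in> sq_span {b \<in> forms n (e - 2). e \<ge> 2} n shift"
    by (rule sq_span_homog) (rule shift_form)
  then show ?thesis
    using homog_part_form[OF a, of e] by simp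
qed

section \<open>Computing in the stalk with polynomial representatives\<close>

lemma fracs_cls:
  assumes "a \<in> forms n e" "s \<in> forms n e" "ev s \<noteq> 0"
  shows "(cls a, cls s) \<in> Q.fracs P"
proof (rule Q.fracsI)
  show "cls a \<in> piece Q e" "cls s \<in> piece Q e"
    unfolding Q_simps(6) using assms by auto
  show "cls s \<notin> P"
    using mem[OF assms(2)] assms(3) by simp
qed

lemma stalk_element:
  assumes "z \<in> carrier (hloc Q P)"
  obtains a s e where "a \<in> forms n e" "s \<in> forms n e" "ev s \<noteq> 0" "z = hfrac Q P (cls a) (cls s)"
proof -
  obtain A S where AS: "(A, S) \<in> Q.fracs P" "z = hfrac Q P A S"
    using assms by (rule Q.hloc_carrierE[OF P])
  obtain e where e: "A \<in> piece Q e" "S \<in> piece Q e" "S \<notin> P"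
    using AS(1) by (rule Q.fracsE)
  obtain a where a: "A = cls a" "a \<in> forms n e"
    using e(1) unfolding Q_simps(6) by (rule imageE)
  obtain s where s: "S = cls s" "s \<in> forms n e"
    using e(2) unfolding Q_simps(6) by (rule imageE)
  have "ev s \<noteq> 0"
    using mem[OF s(2)] e(3) s(1) by simp
  then show ?thesis
    using that[OF a(2) s(2)] AS(2) a(1) s(1) by blast
qed

lemma nonunit_iff:
  assumes "a \<in> forms n e" "s \<in> forms n e" "ev s \<noteq> 0"
  shows "hfrac Q P (cls a) (cls s) \<in> nonunits (hloc Q P) \<longleftrightarrow> ev a = 0"
  using Q.hloc_unit_iff[OF P fracs_cls[OF assms]] Q.hloc_carrierI[OF P fracs_cls[OF assms]] mem[OF assms(1)]
  by (simp add: nonunits_def)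

lemma frac_eqD:
  assumes "a \<in> forms n e" "s \<in> forms n e" "ev s \<noteq> 0" "b \<in> forms n e'" "t \<in> forms n e'" "ev t \<noteq> 0"
    and "hfrac Q P (cls a) (cls s) = hfrac Q P (cls b) (cls t)"
  obtains u i h where "u \<in> forms n i" "ev u \<noteq> 0" "h \<in> polys n" "u * (a * t) - u * (b * s) = h * f"
proof -
  have "Q.frac_eq P (cls a) (cls s) (cls b) (cls t)"
    using assms(7) Q.hfrac_eq_iff[OF P fracs_cls[OF assms(1-3)] fracs_cls[OF assms(4-6)]] by simp
  then obtain U where U: "U \<in> homogeneous_elems Q" "U \<notin> P"
    "U \<otimes>\<^bsub>Q\<^esub> (cls a \<otimes>\<^bsub>Q\<^esub> cls t) = U \<otimes>\<^bsub>Q\<^esub> (cls b \<otimes>\<^bsub>Q\<^esub> cls s)"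
    unfolding Q.frac_eq_def[OF P] by blast
  from U(1) obtain i where "U \<in> piece Q i"
    unfolding homogeneous_elems_def by blast
  then obtain u where u: "u \<in> forms n i" "U = cls u"
    unfolding Q_simps(6) by blast
  note pol = forms_polys[OF assms(1)] forms_polys[OF assms(2)] forms_polys[OF assms(4)] forms_polys[OF assms(5)] forms_polys[OF u(1)]
  have "cls (u * (a * t)) = cls (u * (b * s))"
    using U(3) pol unfolding u(2) by (simp add: Q_simps polys_mult)
  then obtain h where "h \<in> polys n" "u * (a * t) - u * (b * s) = h * f"
    using cls_eq_iff[of "u * (a * t)" "u * (b * s)"] pol by (auto simp: polys_mult)
  then show ?thesis
    using that u U(2) mem[OF u(1)] by blast
qed

lemma frac_eqI:
  assumes "a \<in> forms n e" "s \<in> forms n e" "ev s \<noteq> 0" "b \<in> forms n e'" "t \<in> forms n e'" "ev t \<noteq> 0"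
    and "h \<in> polys n" "a * t - b * s = h * f"
  shows "hfrac Q P (cls a) (cls s) = hfrac Q P (cls b) (cls t)"
proof (rule Q.hfrac_eqI[OF P fracs_cls[OF assms(1-3)] fracs_cls[OF assms(4-6)]])
  note pol = forms_polys[OF assms(1)] forms_polys[OF assms(2)] forms_polys[OF assms(4)] forms_polys[OF assms(5)]
  show "cls a \<otimes>\<^bsub>Q\<^esub> cls t = cls b \<otimes>\<^bsub>Q\<^esub> cls s"
    using cls_eq_iff[of "a * t" "b * s"] assms(7,8) pol by (simp add: Q_simps polys_mult) blast
qed

lemma hloc_mult_cls:
  assumes "a \<in> forms n e" "s \<in> forms n e" "ev s \<noteq> 0" "b \<in> forms n e'" "t \<in> forms n e'" "ev t \<noteq> 0"
  shows "hfrac Q P (cls a) (cls s) \<otimes>\<^bsub>hloc Q P\<^esub> hfrac Q P (cls b) (cls t) = hfrac Q P (cls (a * b)) (cls (s * t))"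
    and "hfrac Q P (cls a) (cls s) \<oplus>\<^bsub>hloc Q P\<^esub> hfrac Q P (cls b) (cls t) = hfrac Q P (cls (a * t + b * s)) (cls (s * t))"
  using Q.hloc_mult[OF P fracs_cls[OF assms(1-3)] fracs_cls[OF assms(4-6)]]
    Q.hloc_add[OF P fracs_cls[OF assms(1-3)] fracs_cls[OF assms(4-6)]]
    forms_polys[OF assms(1)] forms_polys[OF assms(2)] forms_polys[OF assms(4)] forms_polys[OF assms(5)]
  by (simp_all add: Q_simps polys_mult)

lemma cls_pow: "a \<in> polys n \<Longrightarrow> cls a [^]\<^bsub>Q\<^esub> (r::nat) = cls (a ^ r)"
  by (induction r) (simp_all add: nat_pow_def Q_simps polys_power mult.commute)

lemma hloc_pow_cls:
  assumes "a \<in> forms n e" "s \<in> forms n e" "ev s \<noteq> 0"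
  shows "hfrac Q P (cls a) (cls s) [^]\<^bsub>hloc Q P\<^esub> (r::nat) = hfrac Q P (cls (a ^ r)) (cls (s ^ r))"
  using Q.hloc_pow[OF P fracs_cls[OF assms], of r] cls_pow forms_polys[OF assms(1)] forms_polys[OF assms(2)]
  by simp

text \<open>By \<open>sq_span_of_tau\<close> the numerator is a sum of terms shift_i shift_l b, and
  such a term over s is the product of the nonunits shift_i / x_j and shift_l b x_j / s.\<close>

lemma square_mem:
  assumes a: "a \<in> forms n e" and s: "s \<in> forms n e" "ev s \<noteq> 0" and zero: "ev a = 0" "coeff (tau a) 1 = 0"
  shows "hfrac Q P (cls a) (cls s) \<in> nonunits_square (hloc Q P)"
proof -
  have "b \<in> forms n e \<and> hfrac Q P (cls b) (cls s) \<in> nonunits_square (hloc Q P)"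
    if "b \<in> sq_span {b \<in> forms n (e - 2). e \<ge> 2} n shift" for b
    using that
  proof (induction rule: sq_span.induct)
    case zero
    have 0: "hfrac Q P (cls 0) (cls 1) \<in> nonunits (hloc Q P)"
      by (subst nonunit_iff[of _ 0]) simp_all
    have "hfrac Q P (cls 0) (cls s) = hfrac Q P (cls (0 * 0)) (cls (1 * 1))"
      using s by (intro frac_eqI[where h=0 and e'=0 and e=e]) simp_all
    also have "\<dots> = hfrac Q P (cls 0) (cls 1) \<otimes>\<^bsub>hloc Q P\<^esub> hfrac Q P (cls 0) (cls 1)"
      by (rule hloc_mult_cls(1)[symmetric, of _ 0 _ _ 0]) simp_all
    finally show ?case
      using nonunits_square.mult[OF 0 0] by simp
  next
    case (gen i l b)
    then have b: "b \<in> forms n (e - 2)" and e: "e \<ge> 2"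
      by auto
    have lb: "shift l * b \<in> forms n (e - 1)"
      by (rule forms_mult[OF shift_form[OF gen(2)] b]) (use e in arith)
    have ilb: "shift i * (shift l * b) \<in> forms n e"
      by (rule forms_mult[OF shift_form[OF gen(1)] lb]) (use e in arith)
    have lbj: "shift l * b * var j \<in> forms n e"
      by (rule forms_mult[OF lb forms_var[OF j(1)]]) (use e in arith)
    have ev: "ev (var j) \<noteq> 0"
      using j by simp
    have 1: "hfrac Q P (cls (shift i)) (cls (var j)) \<in> nonunits (hloc Q P)"
      by (subst nonunit_iff[OF shift_form[OF gen(1)] forms_var[OF j(1)] ev]) (rule ev_shift)
    have 2: "hfrac Q P (cls (shift l * b * var j)) (cls s) \<in> nonunits (hloc Q P)"
      using ev_shift[of l] by (subst nonunit_iff[OF lbj s]) simp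
    have vs: "var j * s \<in> forms n (1 + e)" "ev (var j * s) \<noteq> 0"
      using forms_mult[OF forms_var[OF j(1)] s(1) refl] s(2) ev by auto
    have "hfrac Q P (cls (shift i)) (cls (var j)) \<otimes>\<^bsub>hloc Q P\<^esub> hfrac Q P (cls (shift l * b * var j)) (cls s) =
        hfrac Q P (cls (shift i * (shift l * b * var j))) (cls (var j * s))"
      by (rule hloc_mult_cls(1)[OF shift_form[OF gen(1)] forms_var[OF j(1)] ev lbj s])
    also have "\<dots> = hfrac Q P (cls (shift i * (shift l * b))) (cls s)"
    proof (rule frac_eqI[OF forms_mult[OF shift_form[OF gen(1)] lbj refl] vs ilb s])
      show "shift i * (shift l * b * var j) * s - shift i * (shift l * b) * (var j * s) = 0 * f"
        by (simp add: mult.assoc)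
    qed simp
    finally show ?case
      using nonunits_square.mult[OF 1 2] ilb by simp
  next
    case (add p q)
    have sum: "p * s + q * s \<in> forms n (e + e)" "s * s \<in> forms n (e + e)" "ev (s * s) \<noteq> 0"
      using add s by (auto intro: forms_mult forms_add)
    have "hfrac Q P (cls p) (cls s) \<oplus>\<^bsub>hloc Q P\<^esub> hfrac Q P (cls q) (cls s) = hfrac Q P (cls (p * s + q * s)) (cls (s * s))"
      using add s by (intro hloc_mult_cls(2)) auto
    also have "\<dots> = hfrac Q P (cls (p + q)) (cls s)"
      using add s by (intro frac_eqI[OF sum _ s, where h=0]) (auto simp: algebra_simps)
    finally show ?case
      using add nonunits_square.add[of "hfrac Q P (cls p) (cls s)" "hloc Q P" "hfrac Q P (cls q) (cls s)"] by auto
  qed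
  then show ?thesis
    using sq_span_of_tau[OF a zero] by blast
qed

text \<open>A converse of \<open>square_mem\<close>. As f has no linear part, adding a multiple of f
  to a numerator does not affect linear parts, so their vanishing is independent of the
  representative.\<close>

lemma square_linear_part:
  assumes f2: "monom 1 2 dvd tau f"
    and z: "z \<in> nonunits_square (hloc Q P)" "a \<in> forms n e" "s \<in> forms n e" "ev s \<noteq> 0" "z = hfrac Q P (cls a) (cls s)"
  shows "coeff (tau a) 1 = 0"
proof -
  have f01: "coeff (tau f) 0 = 0" "coeff (tau f) 1 = 0"
    using f2 by (auto simp: monom_1_dvd_iff')
  have transfer: "coeff (tau a) 1 = 0" if eq: "hfrac Q P (cls a) (cls s) = hfrac Q P (cls b) (cls t)"
    and as: "a \<in> forms n e" "s \<in> forms n e" "ev s \<noteq> 0" and bt: "b \<in> forms n e'" "t \<in> forms n e'" "ev t \<noteq> 0"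
    and b: "ev b = 0" "coeff (tau b) 1 = 0" for a s b t e e'
  proof -
    obtain u i h where u: "u \<in> forms n i" "ev u \<noteq> 0" "h \<in> polys n" "u * (a * t) - u * (b * s) = h * f"
      using as bt eq by (rule frac_eqD)
    from arg_cong[OF u(4), of ev] have "ev a = 0"
      using u(2) bt(3) b f01 tau_0[of f] by simp
    moreover from arg_cong[OF u(4), of "\<lambda>p. coeff (tau p) 1"]
    have "coeff (tau (u * (a * t))) 1 - coeff (tau (u * (b * s))) 1 = coeff (tau (h * f)) 1"
      by simp
    then have "cst (ev u) * (cst (ev t) * coeff (tau a) 1) = 0"
      using b f01 tau_0[of f] \<open>ev a = 0\<close> unfolding lin_mult by simp
    ultimately show ?thesis
      using u(2) bt(3) by auto
  qed
  have "\<exists>b t e. b \<in> forms n e \<and> t \<in> forms n e \<and> ev t \<noteq> 0 \<and> z = hfrac Q P (cls b) (cls t) \<and> ev b = 0 \<and> coeff (tau b) 1 = 0"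
    using z(1)
  proof (induction rule: nonunits_square.induct)
    case (mult X Y)
    then have "X \<in> carrier (hloc Q P)" "Y \<in> carrier (hloc Q P)"
      by (auto simp: nonunits_def)
    obtain b t i where 1: "b \<in> forms n i" "t \<in> forms n i" "ev t \<noteq> 0" "X = hfrac Q P (cls b) (cls t)"
      using \<open>X \<in> carrier _\<close> by (rule stalk_element)
    obtain b' t' i' where 2: "b' \<in> forms n i'" "t' \<in> forms n i'" "ev t' \<noteq> 0" "Y = hfrac Q P (cls b') (cls t')"
      using \<open>Y \<in> carrier _\<close> by (rule stalk_element)
    have "ev b = 0" "ev b' = 0"
      using mult nonunit_iff[OF 1(1-3)] nonunit_iff[OF 2(1-3)] 1(4) 2(4) by auto
    then have "ev (b * b') = 0" "coeff (tau (b * b')) 1 = 0"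
      unfolding lin_mult by simp_all
    moreover have "b * b' \<in> forms n (i + i')" "t * t' \<in> forms n (i + i')" "ev (t * t') \<noteq> 0"
      using 1 2 by (auto intro: forms_mult)
    ultimately show ?case
      using hloc_mult_cls(1)[OF 1(1-3) 2(1-3)] 1(4) 2(4) by blast
  next
    case (add X Y)
    then obtain b t i b' t' i' where
      1: "b \<in> forms n i" "t \<in> forms n i" "ev t \<noteq> 0" "X = hfrac Q P (cls b) (cls t)" "ev b = 0" "coeff (tau b) 1 = 0" and
      2: "b' \<in> forms n i'" "t' \<in> forms n i'" "ev t' \<noteq> 0" "Y = hfrac Q P (cls b') (cls t')" "ev b' = 0" "coeff (tau b') 1 = 0"
      by blast
    have "ev (b * t' + b' * t) = 0"
      using 1 2 by simp
    moreover have "coeff (tau (b * t' + b' * t)) 1 = 0"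
      using 1 2 unfolding tau_simps(3) coeff_add lin_mult by simp
    moreover have "b * t' + b' * t \<in> forms n (i + i')"
      using forms_mult[OF 1(1) 2(2) refl] forms_mult[OF 2(1) 1(2), of "i + i'"] by (auto simp: add.commute)
    moreover have "t * t' \<in> forms n (i + i')" "ev (t * t') \<noteq> 0"
      using 1 2 by (auto intro: forms_mult)
    ultimately show ?case
      using hloc_mult_cls(2)[OF 1(1-3) 2(1-3)] 1(4) 2(4) by blast
  qed
  then obtain b t e' where bt: "b \<in> forms n e'" "t \<in> forms n e'" "ev t \<noteq> 0" "z = hfrac Q P (cls b) (cls t)"
    "ev b = 0" "coeff (tau b) 1 = 0"
    by blast
  show ?thesis
    using transfer[OF _ z(2-4) bt(1-3,5,6)] z(5) bt(4) by simp
qed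

end


section \<open>Rational points\<close>

context hyp
begin

lemma cls_subst_cong:
  assumes "p \<in> polys n" and g: "\<And>i. i \<le> n \<Longrightarrow> g i \<in> polys n \<and> g' i \<in> polys n \<and> cls (g i) = cls (g' i)"
  shows "cls (subst cst g p) = cls (subst cst g' p)"
  using assms(1)
proof (induction p rule: polys_induct)
  case (add p q)
  have m: "subst cst g p \<in> polys n" "subst cst g q \<in> polys n" "subst cst g' p \<in> polys n" "subst cst g' q \<in> polys n"
    using add(1,2) g by (auto intro: polys_subst)
  show ?case
    using Q_simps(5)[OF m(1,2)] Q_simps(5)[OF m(3,4)] add(3,4) by simp
next
  case (mult p q)
  have m: "subst cst g p \<in> polys n" "subst cst g q \<in> polys n" "subst cst g' p \<in> polys n" "subst cst g' q \<in> polys n"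
    using mult(1,2) g by (auto intro: polys_subst)
  show ?case
    using Q_simps(4)[OF m(1,2)] Q_simps(4)[OF m(3,4)] mult(3,4) by simp
qed (use g in simp_all)

context
  fixes P assumes P: "P \<in> proj_points Q"
begin

lemma cls_mult_in: "a \<in> polys n \<Longrightarrow> b \<in> polys n \<Longrightarrow> cls b \<in> P \<Longrightarrow> cls (a * b) \<in> P"
  using Q.in_mult(1)[OF P, of "cls a" "cls b"] by (simp add: Q_simps)

lemma cls_add_in: "a \<in> polys n \<Longrightarrow> b \<in> polys n \<Longrightarrow> cls a \<in> P \<Longrightarrow> cls b \<in> P \<Longrightarrow> cls (a + b) \<in> P"
  using Q.in_add[OF P, of "cls a" "cls b"] by (simp add: Q_simps)

lemma cls_0_in: "cls 0 \<in> P"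
  using Q.zero_in[OF P] by (simp add: Q_simps)

lemma cls_mult_notin:
  "a \<in> polys n \<Longrightarrow> b \<in> polys n \<Longrightarrow> cls a \<notin> P \<Longrightarrow> cls b \<notin> P \<Longrightarrow> cls (a * b) \<notin> P"
  using Q.mult_notin[OF P, of "cls a" "cls b"] by (simp add: Q_simps)

lemma subst_congruence:
  assumes "p \<in> polys n" and g: "\<And>i. i \<le> n \<Longrightarrow> g i \<in> polys n \<and> cls (var i - g i) \<in> P"
  shows "cls (p - subst cst g p) \<in> P"
  using assms(1)
proof (induction p rule: polys_induct)
  case (cst s)
  then show ?case
    using cls_0_in by simp
next
  case (var i)
  then show ?case
    using g by simp
next
  case (add p q)
  have "subst cst g p \<in> polys n" "subst cst g q \<in> polys n"
    using add(1,2) g by (auto intro: polys_subst)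
  then have "cls ((p - subst cst g p) + (q - subst cst g q)) \<in> P"
    using add by (intro cls_add_in polys_diff)
  then show ?case
    by (simp add: algebra_simps)
next
  case (mult p q)
  have s: "subst cst g p \<in> polys n" "subst cst g q \<in> polys n"
    using mult(1,2) g by (auto intro: polys_subst)
  then have "cls (p * (q - subst cst g q) + subst cst g q * (p - subst cst g p)) \<in> P"
    using mult by (intro cls_add_in cls_mult_in polys_diff polys_mult)
  then show ?case
    by (simp add: algebra_simps)
qed

text \<open>Otherwise every form of positive degree would be congruent modulo P to its value at the
  origin, which is 0, and P would contain the irrelevant ideal.\<close>

lemma exists_coordinate: "\<exists>j\<le>n. cls (var j) \<notin> P"
proof (rule ccontr)
  assume "\<not> (\<exists>j\<le>n. cls (var j) \<notin> P)"
  then have "cls (p - subst cst (\<lambda>i. 0) p) \<in> P" if "p \<in> polys n" for p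
    using that by (intro subst_congruence) auto
  moreover have "subst cst (\<lambda>i. 0) p = 0" if "p \<in> forms n e" "e > 0" for p :: "'k mpoly" and e
    using cst.subst_scale[OF that(1), of 0 "\<lambda>i. 0"] that(2) by (simp add: zero_power)
  ultimately have "cls p \<in> P" if "p \<in> forms n e" "e > 0" for p e
    using that forms_polys[OF that(1)] by (metis diff_zero)
  then have "(\<Union>e \<in> {0<..}. piece Q e) \<subseteq> P"
    unfolding Q_simps(6) by auto
  moreover have "ideal P Q"
    using Q.prime_P[OF P] by (rule primeideal.axioms)
  ultimately have "irrelevant_ideal Q \<subseteq> P"
    unfolding irrelevant_ideal_def by (intro Q.genideal_minimal)
  with P show False
    unfolding proj_points_def by blast
qed

text \<open>By rationality x_i / x_j has a constant residue t. Clearing denominators puts x_i - t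
  x_j into the prime P, and these constants are the coordinates.\<close>

lemma rational_kpoint:
  assumes rat: "\<forall>z\<in>carrier (hloc Q P). \<exists>t. \<exists>y\<in>nonunits (hloc Q P). z = stalk_const Q P t \<oplus>\<^bsub>hloc Q P\<^esub> y"
    and j: "j \<le> n" "cls (var j) \<notin> P"
  shows "\<exists>c. kpoint n d f P j c"
proof -
  have coord: "\<exists>t. cls (var i - cst t * var j) \<in> P" if i: "i \<le> n" for i
  proof -
    have ij: "(cls (var i), cls (var j)) \<in> Q.fracs P"
      using j forms_var[OF i] forms_var[OF j(1)] by (intro Q.fracsI[of _ 1]) (auto simp: Q_simps(6))
    obtain t y where ty: "y \<in> nonunits (hloc Q P)" "hfrac Q P (cls (var i)) (cls (var j)) = stalk_const Q P t \<oplus>\<^bsub>hloc Q P\<^esub> y"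
      using rat Q.hloc_carrierI[OF P ij] by blast
    obtain A S where AS: "(A, S) \<in> Q.fracs P" "y = hfrac Q P A S"
      using ty(1) Q.hloc_carrierE[OF P] by (metis DiffD1 nonunits_def)
    have "A \<in> P"
      using ty(1) AS Q.hloc_unit_iff[OF P AS(1)] by (simp add: nonunits_def)
    obtain m where "A \<in> piece Q m" "S \<in> piece Q m" "S \<notin> P"
      using AS(1) by (rule Q.fracsE)
    then obtain a s where as: "A = cls a" "S = cls s" "a \<in> polys n" "s \<in> polys n"
      unfolding Q_simps(6) using forms_polys by blast
    have one: "(cls (cst t), cls 1) \<in> Q.fracs P"
      using Q.fracs_one(3)[OF P, of t] by (simp add: Q_simps)
    have "hfrac Q P (cls (var i)) (cls (var j)) = hfrac Q P (cls (cst t * s + a)) (cls s)"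
      using ty(2) Q.hloc_add[OF P one AS(1)] as unfolding stalk_const_def AS(2)
      by (simp add: Q_simps polys_mult)
    moreover have "(cls (cst t * s + a), cls s) \<in> Q.fracs P"
      using Q.fracs_add[OF P one AS(1)] as by (simp add: Q_simps polys_mult)
    ultimately have "Q.frac_eq P (cls (var i)) (cls (var j)) (cls (cst t * s + a)) (cls s)"
      using Q.hfrac_eq_iff[OF P ij] by blast
    then obtain U where U: "U \<in> homogeneous_elems Q" "U \<notin> P"
      "U \<otimes>\<^bsub>Q\<^esub> (cls (var i) \<otimes>\<^bsub>Q\<^esub> cls s) = U \<otimes>\<^bsub>Q\<^esub> (cls (cst t * s + a) \<otimes>\<^bsub>Q\<^esub> cls (var j))"
      unfolding Q.frac_eq_def[OF P] by blast
    obtain u where u: "U = cls u" "u \<in> polys n"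
      using Q.homog_carrier[OF U(1)] unfolding Q_simps(1) by blast
    have vp: "var i \<in> (polys n :: 'k mpoly set)" "var j \<in> (polys n :: 'k mpoly set)"
      using i j by simp_all
    note pol = as(3,4) u(2) vp
    have cta: "cst t * s + a \<in> polys n"
      using pol by (intro polys_add polys_mult polys_cst)
    have m: "u * (var i * s) \<in> polys n" "u * ((cst t * s + a) * var j) \<in> polys n"
      using pol cta by (auto intro: polys_mult)
    have "cls (u * (var i * s)) = cls (u * ((cst t * s + a) * var j))"
      using U(3) pol cta unfolding u(1) by (simp add: Q_simps polys_mult)
    then obtain h where h: "h \<in> polys n" "u * (var i * s) - u * ((cst t * s + a) * var j) = h * f"
      using cls_eq_iff[OF m] by blast
    have "u * s * (var i - cst t * var j) - u * var j * a = h * f"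
      using h(2) by (simp add: algebra_simps)
    then have "cls (u * s * (var i - cst t * var j)) = cls (u * var j * a)"
      using cls_eq_iff[of "u * s * (var i - cst t * var j)" "u * var j * a"] h(1) pol polys_mult[OF polys_cst vp(2)]
      by (auto simp: polys_mult polys_diff)
    also have "\<dots> \<in> P"
      using \<open>A \<in> P\<close> as pol by (intro cls_mult_in polys_mult) auto
    finally have inP: "cls (u * s * (var i - cst t * var j)) \<in> P" .
    have "cls (var i - cst t * var j) \<in> P"
    proof (rule ccontr)
      assume "cls (var i - cst t * var j) \<notin> P"
      moreover have "cls (u * s) \<notin> P"
        using U(2) u \<open>S \<notin> P\<close> as by (intro cls_mult_notin) auto
      ultimately show False
        using inP cls_mult_notin[of "u * s" "var i - cst t * var j"] pol polys_mult[OF polys_cst vp(2)]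
        by (auto simp: polys_mult polys_diff)
    qed
    then show ?thesis ..
  qed
  obtain c0 where c0: "\<And>i. i \<le> n \<Longrightarrow> cls (var i - cst (c0 i) * var j) \<in> P"
    using coord by metis
  \<comment> \<open>Overwriting the chosen j-th value is harmless, since x_j - 1 * x_j = 0 lies in
    P.\<close>
  define c where "c = c0(j := 1)"
  have c: "cls (var i - cst (c i) * var j) \<in> P" if "i \<le> n" for i
    using c0[OF that] cls_0_in by (auto simp: c_def)
  have "kpoint n d f P j c"
  proof (unfold_locales)
    show "P \<in> proj_points Q" "j \<le> n" "c j = 1"
      using P j by (simp_all add: c_def)
    fix a :: "'k mpoly" and e assume a: "a \<in> forms n e"
    have ap: "a \<in> polys n"
      using a by (rule forms_polys)
    have vj: "var j \<in> (polys n :: 'k mpoly set)"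
      using j by simp
    have "subst cst (\<lambda>i. cst (c i) * var j) a = var j ^ e * subst cst (\<lambda>i. cst (c i)) a"
      using cst.subst_scale[OF a, of "var j" "\<lambda>i. cst (c i)"] by (simp add: mult.commute)
    also have "subst cst (\<lambda>i. cst (c i)) a = cst (subst id c a)"
      using ev.hom_subst[of cst c a] by (simp add: single_add mult_single)
    \<comment> \<open>Modulo P a form of degree e is its value at c times x_j^e, and powers of x_j
      are outside P.\<close>
    finally have red: "cls (a - cst (subst id c a) * var j ^ e) \<in> P"
      using subst_congruence[OF ap, of "\<lambda>i. cst (c i) * var j"] c vj by (simp add: polys_mult mult.commute)
    show "cls a \<in> P \<longleftrightarrow> subst id c a = 0"
    proof
      assume "subst id c a = 0"
      then show "cls a \<in> P"
        using red by simp
    next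
      assume aP: "cls a \<in> P"
      show "subst id c a = 0"
      proof (rule ccontr)
        let ?s = "subst id c a"
        assume s: "?s \<noteq> 0"
        have "cls ((- 1) * (a - cst ?s * var j ^ e) + a) \<in> P"
          using red aP ap vj by (intro cls_add_in cls_mult_in polys_diff polys_mult polys_power) auto
        then have "cls (cst ?s * var j ^ e) \<in> P"
          by simp
        then have "cls (cst (1 / ?s) * (cst ?s * var j ^ e)) \<in> P"
          by (rule cls_mult_in[OF polys_cst polys_mult[OF polys_cst polys_power[OF vj]]])
        moreover have "cst (1 / ?s) * (cst ?s * var j ^ e) = var j ^ e"
          using s by (simp add: mult_single flip: mult.assoc)
        moreover have "cls (var j ^ i) \<notin> P" for i
        proof (induction i)
          case 0
          then show ?case
            using Q.one_notin[OF P] by (simp add: Q_simps)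
        next
          case (Suc i)
          then show ?case
            using cls_mult_notin[of "var j" "var j ^ i"] j(2) vj by (simp add: polys_power)
        qed
        ultimately show False
          by simp
      qed
    qed
  qed
  then show ?thesis
    by blast
qed

end

end

section \<open>Obstructions to degeneracy at a rational point\<close>

context kpoint
begin

lemma ev_f: "ev f = 0"
  using mem[OF f] cls_0_in[OF P] by simp

text \<open>The residue of a/s is the quotient of the values of a and s at the coordinates.\<close>

lemma rational:
  "\<forall>z\<in>carrier (hloc Q P). \<exists>t. \<exists>y\<in>nonunits (hloc Q P). z = stalk_const Q P t \<oplus>\<^bsub>hloc Q P\<^esub> y"
proof
  fix z assume "z \<in> carrier (hloc Q P)"
  then obtain a s e where as: "a \<in> forms n e" "s \<in> forms n e" "ev s \<noteq> 0" "z = hfrac Q P (cls a) (cls s)"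
    by (rule stalk_element)
  define t where "t = ev a / ev s"
  have b: "a - cst t * s \<in> forms n e" "ev (a - cst t * s) = 0"
    using as by (auto intro: forms_scale simp: t_def)
  have "stalk_const Q P t \<oplus>\<^bsub>hloc Q P\<^esub> hfrac Q P (cls (a - cst t * s)) (cls s) =
      hfrac Q P (cls (cst t * s + (a - cst t * s) * 1)) (cls (1 * s))"
    unfolding stalk_const_def Q_simps by (rule hloc_mult_cls(2)[of _ 0]) (use as b in auto)
  then have "z = stalk_const Q P t \<oplus>\<^bsub>hloc Q P\<^esub> hfrac Q P (cls (a - cst t * s)) (cls s)"
    using as(4) by simp
  then show "\<exists>t. \<exists>y\<in>nonunits (hloc Q P). z = stalk_const Q P t \<oplus>\<^bsub>hloc Q P\<^esub> y"
    using nonunit_iff[OF b(1) as(2,3)] b(2) by blast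
qed

text \<open>Clearing denominators turns the relation into a polynomial identity to which Taylor
  expansion applies. K and G absorb the denominators and the multiplier from the equality of
  fractions; K does not vanish at the point.\<close>

lemma degenerateE:
  assumes "degenerate ind r (hloc Q P) (stalk_const Q P)"
  obtains a1 s1 e1 a2 s2 e2 a3 K G h where
    "a1 \<in> forms n e1" "s1 \<in> forms n e1" "ev s1 \<noteq> 0" "ev a1 = 0"
    "a2 \<in> forms n e2" "s2 \<in> forms n e2" "ev s2 \<noteq> 0" "ev a2 = 0"
    "ev a3 = 0" "ev K \<noteq> 0" "K * (a1 ^ r * a2) - a3 ^ (r + 2) * G = h * f"
    "hfrac Q P (cls a1) (cls s1) \<notin> nonunits_square (hloc Q P)"
    "hfrac Q P (cls a2) (cls s2) \<notin> nonunits_square (hloc Q P)"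
    "ind \<longrightarrow> \<not> (\<exists>t. \<exists>m\<in>nonunits_square (hloc Q P). hfrac Q P (cls a2) (cls s2) =
      stalk_const Q P t \<otimes>\<^bsub>hloc Q P\<^esub> hfrac Q P (cls a1) (cls s1) \<oplus>\<^bsub>hloc Q P\<^esub> m)"
proof -
  obtain U V W X where U: "U \<in> nonunits (hloc Q P)" and V: "V \<in> nonunits (hloc Q P)"
    and W: "W \<in> nonunits (hloc Q P)" and X: "X \<in> carrier (hloc Q P)"
    and eq: "U [^]\<^bsub>hloc Q P\<^esub> r \<otimes>\<^bsub>hloc Q P\<^esub> V = W [^]\<^bsub>hloc Q P\<^esub> (r + 2) \<otimes>\<^bsub>hloc Q P\<^esub> X"
    and nsq: "U \<notin> nonunits_square (hloc Q P)" "V \<notin> nonunits_square (hloc Q P)"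
      "ind \<longrightarrow> \<not> (\<exists>t. \<exists>m\<in>nonunits_square (hloc Q P). V = stalk_const Q P t \<otimes>\<^bsub>hloc Q P\<^esub> U \<oplus>\<^bsub>hloc Q P\<^esub> m)"
    using assms unfolding degenerate_def by meson
  have carr: "U \<in> carrier (hloc Q P)" "V \<in> carrier (hloc Q P)" "W \<in> carrier (hloc Q P)"
    using U V W by (simp_all add: nonunits_def)
  obtain a1 s1 e1 where 1: "a1 \<in> forms n e1" "s1 \<in> forms n e1" "ev s1 \<noteq> 0" "U = hfrac Q P (cls a1) (cls s1)"
    using carr(1) by (rule stalk_element)
  obtain a2 s2 e2 where 2: "a2 \<in> forms n e2" "s2 \<in> forms n e2" "ev s2 \<noteq> 0" "V = hfrac Q P (cls a2) (cls s2)"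
    using carr(2) by (rule stalk_element)
  obtain a3 s3 e3 where 3: "a3 \<in> forms n e3" "s3 \<in> forms n e3" "ev s3 \<noteq> 0" "W = hfrac Q P (cls a3) (cls s3)"
    using carr(3) by (rule stalk_element)
  obtain a4 s4 e4 where 4: "a4 \<in> forms n e4" "s4 \<in> forms n e4" "ev s4 \<noteq> 0" "X = hfrac Q P (cls a4) (cls s4)"
    using X by (rule stalk_element)
  have ev0: "ev a1 = 0" "ev a2 = 0" "ev a3 = 0"
    using U V W nonunit_iff[OF 1(1-3)] nonunit_iff[OF 2(1-3)] nonunit_iff[OF 3(1-3)] 1(4) 2(4) 3(4) by simp_all
  have p1: "a1 ^ r \<in> forms n (r * e1)" "s1 ^ r \<in> forms n (r * e1)" "ev (s1 ^ r) \<noteq> 0"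
    using 1 by (auto intro: forms_power)
  have p3: "a3 ^ (r + 2) \<in> forms n ((r + 2) * e3)" "s3 ^ (r + 2) \<in> forms n ((r + 2) * e3)" "ev (s3 ^ (r + 2)) \<noteq> 0"
    by (rule forms_power[OF 3(1) refl] forms_power[OF 3(2) refl])+ (use 3(3) in simp)
  have p12: "a1 ^ r * a2 \<in> forms n (r * e1 + e2)" "s1 ^ r * s2 \<in> forms n (r * e1 + e2)" "ev (s1 ^ r * s2) \<noteq> 0"
    using forms_mult[OF p1(1) 2(1) refl] forms_mult[OF p1(2) 2(2) refl] p1(3) 2(3) by simp_all
  have p34: "a3 ^ (r + 2) * a4 \<in> forms n ((r + 2) * e3 + e4)" "s3 ^ (r + 2) * s4 \<in> forms n ((r + 2) * e3 + e4)"
    "ev (s3 ^ (r + 2) * s4) \<noteq> 0"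
    using forms_mult[OF p3(1) 4(1) refl] forms_mult[OF p3(2) 4(2) refl] p3(3) 4(3) by simp_all
  have "hfrac Q P (cls (a1 ^ r * a2)) (cls (s1 ^ r * s2)) = hfrac Q P (cls (a3 ^ (r + 2) * a4)) (cls (s3 ^ (r + 2) * s4))"
    using eq unfolding 1(4) 2(4) 3(4) 4(4) hloc_pow_cls[OF 1(1-3)] hloc_pow_cls[OF 3(1-3)]
      hloc_mult_cls(1)[OF p1 2(1-3)] hloc_mult_cls(1)[OF p3 4(1-3)] .
  then obtain u i h where u: "u \<in> forms n i" "ev u \<noteq> 0" "h \<in> polys n"
    "u * ((a1 ^ r * a2) * (s3 ^ (r + 2) * s4)) - u * ((a3 ^ (r + 2) * a4) * (s1 ^ r * s2)) = h * f"
    by (rule frac_eqD[OF p12 p34])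
  have "(u * (s3 ^ (r + 2) * s4)) * (a1 ^ r * a2) - a3 ^ (r + 2) * (u * (a4 * (s1 ^ r * s2))) = h * f"
    using u(4) by (simp only: mult.assoc mult.left_commute mult.commute)
  moreover have "ev (u * (s3 ^ (r + 2) * s4)) \<noteq> 0"
    using u(2) p34(3) by simp
  ultimately show ?thesis
    using that[OF 1(1-3) ev0(1) 2(1-3) ev0(2,3)] nsq unfolding 1(4) 2(4) by blast
qed

text \<open>The multiple h f has order at least r + 2, so one of the linear parts vanishes by
  \<open>linear_parts_product\<close>, and \<open>square_mem\<close> contradicts the choice of u and
  v.\<close>

lemma not_degenerate_high_order:
  assumes "monom 1 (r + 2) dvd tau f"
  shows "\<not> degenerate ind r (hloc Q P) (stalk_const Q P)"
proof
  assume "degenerate ind r (hloc Q P) (stalk_const Q P)"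
  then obtain a1 s1 e1 a2 s2 e2 a3 K G h where
    1: "a1 \<in> forms n e1" "s1 \<in> forms n e1" "ev s1 \<noteq> 0" "ev a1 = 0" and
    2: "a2 \<in> forms n e2" "s2 \<in> forms n e2" "ev s2 \<noteq> 0" "ev a2 = 0" and
    3: "ev a3 = 0" "ev K \<noteq> 0" "K * (a1 ^ r * a2) - a3 ^ (r + 2) * G = h * f" and
    nsq: "hfrac Q P (cls a1) (cls s1) \<notin> nonunits_square (hloc Q P)"
    "hfrac Q P (cls a2) (cls s2) \<notin> nonunits_square (hloc Q P)"
    by (rule degenerateE)
  have "coeff (tau a1) 1 = 0 \<or> coeff (tau a2) 1 = 0"
  proof (rule linear_parts_product[OF _ _ _ _ assms])
    show "tau K * (tau a1 ^ r * tau a2) - tau a3 ^ (r + 2) * tau G = tau h * tau f"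
      using arg_cong[OF 3(3), of tau] by simp
  qed (use 1 2 3 in \<open>simp_all add: tau_0\<close>)
  then show False
    using square_mem[OF 1] square_mem[OF 2] nsq by blast
qed

text \<open>Where x_j is invertible, f = 0 is solved by x_i0 = -R / x_j^d'. The homogeneous
  substitution \<eta> inserts this solution; it kills f, and the relation becomes one between
  polynomials.\<close>

lemma not_degenerate_graph:
  fixes R :: "'a mpoly"
  assumes i0: "i0 \<le> n" "i0 \<noteq> j" and d: "d = Suc d'" and fR: "f = var j ^ d' * var i0 + R"
    and R: "R \<in> forms n d" "\<And>g g'. (\<And>i. i \<noteq> i0 \<Longrightarrow> g i = g' i) \<Longrightarrow> subst cst g R = subst cst g' R"
  shows "\<not> degenerate ind r (hloc Q P) (stalk_const Q P)"
proof
  define \<eta> where "\<eta> i = (if i = i0 then - R else var j ^ d' * var i)" for i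
  have vj: "var j ^ d' \<in> forms n d'"
    using forms_power[OF forms_var[OF j(1)], of d' d'] by simp
  have \<eta>_form: "\<eta> i \<in> forms n d" if "i \<le> n" for i
    using R(1) forms_mult[OF vj forms_var[OF that], of d] d by (auto simp: \<eta>_def)
  have \<eta>R: "subst cst \<eta> R = (var j ^ d') ^ d * R"
    using R(2)[of \<eta> "\<lambda>i. var j ^ d' * var i"] cst.subst_scale[OF R(1), of "var j ^ d'" var] by (simp add: \<eta>_def)
  have \<eta>f: "subst cst \<eta> f = 0"
    using i0 j \<eta>R d by (simp add: fR \<eta>_def power_mult_distrib algebra_simps flip: power_Suc power_mult power_add)
  have ev\<eta>: "ev (subst cst \<eta> a) = ev a" for a
  proof -
    have "ev (\<eta> i) = c i" for i
      using ev_f j by (simp add: \<eta>_def fR add_eq_0_iff)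
    then show ?thesis
      by (simp add: ev.subst_subst)
  qed
  \<comment> \<open>Modulo f, the substitution \<eta> multiplies every coordinate by x_j^d', so it
    represents the same fractions.\<close>
  have cls\<eta>: "cls ((var j ^ d') ^ e * a) = cls (subst cst \<eta> a)" if a: "a \<in> forms n e" for a e
  proof -
    have "cls (subst cst (\<lambda>i. var j ^ d' * var i) a) = cls (subst cst \<eta> a)"
    proof (rule cls_subst_cong[OF forms_polys[OF a]])
      fix i assume i: "i \<le> n"
      have m: "var j ^ d' * var i \<in> polys n" "\<eta> i \<in> polys n"
        using forms_polys[OF forms_mult[OF vj forms_var[OF i] refl]] forms_polys[OF \<eta>_form[OF i]] by auto
      moreover have "cls (var j ^ d' * var i) = cls (\<eta> i)"
      proof (cases "i = i0")
        case True
        have "var j ^ d' * var i - \<eta> i = 1 * f"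
          using True by (simp add: \<eta>_def fR)
        then show ?thesis
          using cls_eq_iff[OF m] polys_1 by blast
      qed (simp add: \<eta>_def)
      ultimately show "var j ^ d' * var i \<in> polys n \<and> \<eta> i \<in> polys n \<and> cls (var j ^ d' * var i) = cls (\<eta> i)"
        by blast
    qed
    then show ?thesis
      by (simp add: cst.subst_scale[OF a])
  qed
  have square: "hfrac Q P (cls a) (cls s) \<in> nonunits_square (hloc Q P)"
    if as: "a \<in> forms n e" "s \<in> forms n e" "ev s \<noteq> 0" and 0: "ev a = 0" "coeff (tau (subst cst \<eta> a)) 1 = 0" for a s e
  proof -
    have \<eta>a: "subst cst \<eta> a \<in> forms n (e * d)"
      using forms_subst[OF as(1)] \<eta>_form by blast
    have "(var j ^ d') ^ e \<in> forms n (e * d')"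
      by (rule forms_power[OF vj refl])
    then have t: "(var j ^ d') ^ e * s \<in> forms n (e * d)" "ev ((var j ^ d') ^ e * s) \<noteq> 0"
      using forms_mult[of "(var j ^ d') ^ e" n "e * d'" s e "e * d"] as j d by auto
    have "(var j ^ d') ^ e * a \<in> polys n" "subst cst \<eta> a \<in> polys n"
      using forms_polys[OF forms_mult[OF \<open>(var j ^ d') ^ e \<in> _\<close> as(1) refl]] forms_polys[OF \<eta>a] by auto
    then obtain h where h: "h \<in> polys n" "(var j ^ d') ^ e * a - subst cst \<eta> a = h * f"
      using cls\<eta>[OF as(1)] cls_eq_iff by blast
    have "hfrac Q P (cls a) (cls s) = hfrac Q P (cls (subst cst \<eta> a)) (cls ((var j ^ d') ^ e * s))"
    proof (rule frac_eqI[OF as \<eta>a t])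
      show "h * s \<in> polys n"
        using h(1) forms_polys[OF as(2)] by (rule polys_mult)
      have "a * ((var j ^ d') ^ e * s) - subst cst \<eta> a * s = ((var j ^ d') ^ e * a - subst cst \<eta> a) * s"
        by (simp only: left_diff_distrib) (simp only: mult.assoc mult.left_commute mult.commute)
      then show "a * ((var j ^ d') ^ e * s) - subst cst \<eta> a * s = h * s * f"
        unfolding h(2) by (simp only: mult.assoc mult.left_commute mult.commute)
    qed
    then show ?thesis
      using square_mem[OF \<eta>a t] ev\<eta> 0 by simp
  qed
  assume "degenerate ind r (hloc Q P) (stalk_const Q P)"
  then obtain a1 s1 e1 a2 s2 e2 a3 K G h where
    1: "a1 \<in> forms n e1" "s1 \<in> forms n e1" "ev s1 \<noteq> 0" "ev a1 = 0" and
    2: "a2 \<in> forms n e2" "s2 \<in> forms n e2" "ev s2 \<noteq> 0" "ev a2 = 0" and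
    3: "ev a3 = 0" "ev K \<noteq> 0" "K * (a1 ^ r * a2) - a3 ^ (r + 2) * G = h * f" and
    nsq: "hfrac Q P (cls a1) (cls s1) \<notin> nonunits_square (hloc Q P)"
    "hfrac Q P (cls a2) (cls s2) \<notin> nonunits_square (hloc Q P)"
    by (rule degenerateE)
  let ?t = "\<lambda>p. tau (subst cst \<eta> p)"
  have "coeff (?t a1) 1 = 0 \<or> coeff (?t a2) 1 = 0"
  \<comment> \<open>After \<eta> the multiple of f is 0, which every power of T divides; hence r is
    arbitrary.\<close>
  proof (rule linear_parts_product[where F=0])
    show "?t K * (?t a1 ^ r * ?t a2) - ?t a3 ^ (r + 2) * ?t G = 1 * 0"
      using arg_cong[OF 3(3), of ?t] \<eta>f by simp
  qed (use 1 2 3 in \<open>simp_all add: tau_0 ev\<eta>\<close>)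
  then show False
    using square[OF 1] square[OF 2] nsq by blast
qed

text \<open>In order 2 the relation reads l1 l2 = \<mu> x_0^2. Unique factorization makes both
  nonzero linear parts multiples of x_0, hence dependent.\<close>

lemma not_degenerate_double_plane:
  assumes tf: "coeff (tau f) 0 = 0" "coeff (tau f) 1 = 0" "coeff (tau f) 2 = cst \<gamma> * var 0 ^ 2"
  shows "\<not> degenerate True 1 (hloc Q P) (stalk_const Q P)"
proof
  assume "degenerate True 1 (hloc Q P) (stalk_const Q P)"
  then obtain a1 s1 e1 a2 s2 e2 a3 K G h where
    1: "a1 \<in> forms n e1" "s1 \<in> forms n e1" "ev s1 \<noteq> 0" "ev a1 = 0" and
    2: "a2 \<in> forms n e2" "s2 \<in> forms n e2" "ev s2 \<noteq> 0" "ev a2 = 0" and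
    3: "ev a3 = 0" "ev K \<noteq> 0" "K * (a1 ^ 1 * a2) - a3 ^ (1 + 2) * G = h * f" and
    nsq: "hfrac Q P (cls a1) (cls s1) \<notin> nonunits_square (hloc Q P)"
    "hfrac Q P (cls a2) (cls s2) \<notin> nonunits_square (hloc Q P)" and
    ind: "True \<longrightarrow> \<not> (\<exists>t. \<exists>m\<in>nonunits_square (hloc Q P). hfrac Q P (cls a2) (cls s2) =
      stalk_const Q P t \<otimes>\<^bsub>hloc Q P\<^esub> hfrac Q P (cls a1) (cls s1) \<oplus>\<^bsub>hloc Q P\<^esub> m)"
    by (rule degenerateE)
  let ?l1 = "coeff (tau a1) 1" and ?l2 = "coeff (tau a2) 1"
  have c2: "coeff (p * q) 2 = coeff p 0 * coeff q 2 + coeff p 1 * coeff q 1 + coeff p 2 * coeff q 0" for p q :: "'a mpoly poly"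
  proof -
    have "{..2::nat} = {0, 1, 2}"
      by auto
    then show ?thesis
      by (simp add: coeff_mult add.assoc)
  qed
  have c1: "coeff (p * q) 1 = coeff p 0 * coeff q 1 + coeff p 1 * coeff q 0" for p q :: "'a mpoly poly"
    by (simp add: coeff_mult)
  have c0: "coeff (p * q) 0 = coeff p 0 * coeff q 0" for p q :: "'a mpoly poly"
    by (simp add: coeff_mult)
  have "K * (a1 * a2) - a3 * (a3 * a3) * G = h * f"
    using 3(3) by (simp add: power3_eq_cube mult.assoc)
  then have "coeff (tau (K * (a1 * a2) - a3 * (a3 * a3) * G)) 2 = coeff (tau (h * f)) 2"
    by simp
  then have "cst (ev K) * (?l1 * ?l2) = cst (ev h) * (cst \<gamma> * var 0 ^ 2)"
    unfolding tau_simps(4,6) coeff_diff c2 c1 c0 tau_0 1(4) 2(4) 3(1) ev_f tf(2,3) by simp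
  then have "cst (1 / ev K) * (cst (ev K) * (?l1 * ?l2)) = cst (1 / ev K) * (cst (ev h) * (cst \<gamma> * var 0 ^ 2))"
    by simp
  moreover define \<mu> where "\<mu> = 1 / ev K * (ev h * \<gamma>)"
  ultimately have prod: "?l1 * ?l2 = cst \<mu> * var 0 ^ 2"
    using 3(2) by (simp add: mult_single flip: mult.assoc)
  let ?z = "subst cst (\<lambda>i. if i = 0 then 0 else var i)"
  obtain t1 where t1: "?l1 = cst t1 * var 0 + ?z ?l1"
    using lin_var_0[OF forms_polys[OF 1(1)]] by blast
  obtain t2 where t2: "?l2 = cst t2 * var 0 + ?z ?l2"
    using lin_var_0[OF forms_polys[OF 2(1)]] by blast
  have l: "?l1 \<noteq> 0" "?l2 \<noteq> 0"
    using square_mem[OF 1] square_mem[OF 2] nsq by auto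
  have other: "q = cst (\<mu> / t) * var 0" if "p * q = cst \<mu> * var 0 ^ 2" "p = cst t * var 0" "p \<noteq> 0" for p q t
  proof -
    have "t \<noteq> 0"
      using that(2,3) by auto
    have "var 0 * (cst t * q) = var 0 * (cst \<mu> * var 0)"
      using that(1) unfolding that(2) by (simp add: power2_eq_square ac_simps)
    then have "cst t * q = cst \<mu> * var 0"
      by (metis mult_cancel_left var_nonzero)
    then have "cst (1 / t) * (cst t * q) = cst (1 / t) * (cst \<mu> * var 0)"
      by simp
    then show ?thesis
      using \<open>t \<noteq> 0\<close> by (simp add: mult_single flip: mult.assoc)
  qed
  \<comment> \<open>Setting x_0 = 0 expresses that x_0 is prime: it divides one linear part, and by
    \<open>other\<close> also the remaining one.\<close>
  have "?z ?l1 * ?z ?l2 = 0"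
    using arg_cong[OF prod, of ?z] by simp
  then consider "?z ?l1 = 0" | "?z ?l2 = 0"
    by auto
  then obtain r1 r2 where r: "?l1 = cst r1 * var 0" "?l2 = cst r2 * var 0"
  proof cases
    case 1
    then have "?l1 = cst t1 * var 0"
      using t1 by simp
    then show ?thesis
      using other[OF prod] l that by blast
  next
    case 2
    then have "?l2 = cst t2 * var 0"
      using t2 by simp
    then show ?thesis
      using other[of ?l2 ?l1 t2] prod l that by (metis mult.commute)
  qed
  have "r1 \<noteq> 0"
    using r l by auto
  \<comment> \<open>The ratio of the linear parts, corrected by the values of the denominators, so
    that the numerator b of the difference loses its linear part.\<close>
  define t where "t = (r2 / r1) * (ev s1 / ev s2)"
  define b where "b = a2 * s1 - cst t * a1 * s2"
  have bf: "b \<in> forms n (e1 + e2)"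
    unfolding b_def using forms_mult[OF 2(1) 1(2), of "e1 + e2"] forms_mult[OF forms_scale[OF 1(1)] 2(2), of "e1 + e2"]
    by (auto simp: add.commute)
  have ss: "s1 * s2 \<in> forms n (e1 + e2)" "ev (s1 * s2) \<noteq> 0"
    using forms_mult[OF 1(2) 2(2) refl] 1(3) 2(3) by auto
  have "ev b = 0"
    using 1 2 by (simp add: b_def)
  moreover have "coeff (tau b) 1 = 0"
  proof -
    have "coeff (tau b) 1 = cst (ev s1) * ?l2 - cst (ev s2) * (cst t * ?l1)"
      unfolding b_def tau_simps(4) coeff_diff lin_mult using 1(4) 2(4) by simp
    also have "\<dots> = cst (ev s1 * r2 - ev s2 * (t * r1)) * var 0"
      unfolding r by (simp add: mult_single single_diff algebra_simps flip: mult.assoc)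
    also have "ev s1 * r2 - ev s2 * (t * r1) = 0"
      using \<open>r1 \<noteq> 0\<close> 2(3) by (simp add: t_def)
    finally show ?thesis by simp
  qed
  ultimately have m: "hfrac Q P (cls b) (cls (s1 * s2)) \<in> nonunits_square (hloc Q P)"
    by (rule square_mem[OF bf ss])
  have ta: "cst t * a1 \<in> forms n e1"
    using 1(1) by (rule forms_scale)
  have "stalk_const Q P t \<otimes>\<^bsub>hloc Q P\<^esub> hfrac Q P (cls a1) (cls s1) = hfrac Q P (cls (cst t * a1)) (cls (1 * s1))"
    unfolding stalk_const_def Q_simps by (rule hloc_mult_cls(1)[of _ 0]) (use 1 in auto)
  then have "stalk_const Q P t \<otimes>\<^bsub>hloc Q P\<^esub> hfrac Q P (cls a1) (cls s1) \<oplus>\<^bsub>hloc Q P\<^esub> hfrac Q P (cls b) (cls (s1 * s2)) =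
      hfrac Q P (cls (cst t * a1 * (s1 * s2) + b * s1)) (cls (s1 * (s1 * s2)))"
    using hloc_mult_cls(2)[OF ta 1(2,3) bf ss] by simp
  also have "\<dots> = hfrac Q P (cls a2) (cls s2)"
  proof (rule frac_eqI[OF _ _ _ 2(1-3)])
    show "cst t * a1 * (s1 * s2) + b * s1 \<in> forms n (e1 + (e1 + e2))"
      using forms_mult[OF ta ss(1) refl] forms_mult[OF bf 1(2), of "e1 + (e1 + e2)"] by auto
    show "s1 * (s1 * s2) \<in> forms n (e1 + (e1 + e2))" "ev (s1 * (s1 * s2)) \<noteq> 0"
      using forms_mult[OF 1(2) ss(1) refl] 1(3) 2(3) by auto
    show "(cst t * a1 * (s1 * s2) + b * s1) * s2 - a2 * (s1 * (s1 * s2)) = 0 * f"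
      by (simp add: b_def algebra_simps)
  qed simp
  finally show False
    using ind m by metis
qed

end


section \<open>Irreducibility\<close>

lemma var_0_decomp:
  fixes p :: "'k::comm_ring_1 mpoly"
  assumes "p \<in> polys n" "n \<ge> 1"
  shows "\<exists>q\<in>polys n. p = subst cst (\<lambda>i. if i = 0 then 0 else var i) p + var 0 * q"
  using assms(1)
proof (induction p rule: polys_induct)
  case (cst s)
  then show ?case by (intro bexI[of _ 0]) simp_all
next
  case (var i)
  show ?case
    by (cases "i = 0") (auto intro: bexI[of _ 1] bexI[of _ 0])
next
  case (add p q)
  let ?z = "subst cst (\<lambda>i. if i = 0 then 0 else var i) :: 'k mpoly \<Rightarrow> 'k mpoly"
  obtain p' q' where *: "p' \<in> polys n" "q' \<in> polys n" "p = ?z p + var 0 * p'" "q = ?z q + var 0 * q'"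
    using add(3,4) by blast
  have "p + q = (?z p + var 0 * p') + (?z q + var 0 * q')"
    using *(3,4) by simp
  also have "\<dots> = ?z (p + q) + var 0 * (p' + q')"
    by (simp add: distrib_left)
  finally show ?case
    using *(1,2) polys_add by blast
next
  case (mult p q)
  let ?z = "subst cst (\<lambda>i. if i = 0 then 0 else var i) :: 'k mpoly \<Rightarrow> 'k mpoly"
  obtain p' q' where *: "p' \<in> polys n" "q' \<in> polys n" "p = ?z p + var 0 * p'" "q = ?z q + var 0 * q'"
    using mult(3,4) by blast
  have "?z q \<in> polys n"
    using mult(2) by (rule polys_subst) auto
  then have m: "p * q' + ?z q * p' \<in> polys n"
    using mult(1) *(1,2) by (intro polys_add polys_mult)
  have "p * q = p * (?z q + var 0 * q')"
    using *(4) by simp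
  also have "\<dots> = p * ?z q + var 0 * (p * q')"
    by (simp add: algebra_simps)
  also have "p * ?z q = (?z p + var 0 * p') * ?z q"
    using *(3) by simp
  finally have "p * q = ?z (p * q) + var 0 * (p * q' + ?z q * p')"
    unfolding cst.subst_mult by (simp add: algebra_simps)
  then show ?case
    using m by blast
qed

text \<open>A divisor of R is not divisible by x_0, so in a factorization of x_0^m all factors x_0
  sit in the cofactor and can be cancelled one by one.\<close>

lemma invertible_if_divides_coprime:
  fixes b :: "'k::field mpoly"
  assumes "b \<in> polys n" "c1 \<in> polys n" "n \<ge> 1" "b * c1 = var 0 ^ m" "b * c0 = R"
    and R: "subst cst (\<lambda>i. if i = 0 then 0 else var i) R \<noteq> 0"
  shows "\<exists>b'\<in>polys n. b * b' = 1"
  using assms(2,4)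
proof (induction m arbitrary: c1)
  case 0
  then show ?case by auto
next
  case (Suc m)
  let ?z = "subst cst (\<lambda>i. if i = 0 then 0 else var i) :: 'k mpoly \<Rightarrow> 'k mpoly"
  have "?z b * ?z c1 = 0"
    using arg_cong[OF Suc.prems(2), of ?z] by simp
  moreover have "?z b \<noteq> 0"
    using R arg_cong[OF assms(5), of ?z] by auto
  ultimately have "?z c1 = 0"
    by simp
  then obtain q where q: "q \<in> polys n" "c1 = var 0 * q"
    using var_0_decomp[OF Suc.prems(1) assms(3)] by auto
  have "var 0 * (b * q) = var 0 * var 0 ^ m"
    using Suc.prems(2) q(2) by (simp add: ac_simps)
  then have "b * q = var 0 ^ m"
    by (metis mult_cancel_left var_nonzero)
  then show ?case
    using Suc.IH q(1) by blast
qed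

text \<open>The form is linear in y = \<open>var 1\<close>. In a factorization one factor is free of
  y and divides both coefficients x_0^m and R, which have no common divisor. Condition
  \<open>indep\<close> says that R is free of y, with y renamed to the indeterminate.\<close>

lemma irreducible_linear:
  fixes R :: "'k::field mpoly"
  assumes n: "n \<ge> 1" and R: "R \<in> polys n"
    and indep: "subst (\<lambda>a. [:cst a:]) (\<lambda>i. [:if i = 1 then 0 else var i, if i = 1 then 1 else 0:]) R = [:R:]"
    and R0: "subst cst (\<lambda>i. if i = 0 then 0 else var i) R \<noteq> 0"
  shows "ring_irreducible\<^bsub>poly_alg n\<^esub> (var 0 ^ m * var 1 + R)"
proof -
  define \<sigma> :: "'k mpoly \<Rightarrow> 'k mpoly poly"
    where "\<sigma> = subst (\<lambda>a. [:cst a:]) (\<lambda>i. [:if i = 1 then 0 else var i, if i = 1 then 1 else 0:])"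
  let ?f = "var 0 ^ m * var 1 + R"
  have \<sigma>_mult: "\<sigma> (p * q) = \<sigma> p * \<sigma> q" for p q
    by (simp add: \<sigma>_def)
  have \<sigma>f: "\<sigma> ?f = [:R, var 0 ^ m:]"
    using indep by (simp add: \<sigma>_def poly_const_pow)
  have coeffs: "coeff (\<sigma> p) r \<in> polys n" if "p \<in> polys n" for p r
    using taylor_coeffs[OF that, of "\<lambda>i. if i = 1 then 0 else var i" "\<lambda>i. if i = 1 then 1 else 0"]
    unfolding \<sigma>_def by auto
  have recover: "poly (\<sigma> p) (var 1) = p" for p
  proof -
    have "poly (\<sigma> p) (var 1) = subst (\<lambda>a. poly [:cst a:] (var 1))
        (\<lambda>i. poly [:if i = 1 then 0 else var i, if i = 1 then 1 else 0:] (var 1)) p"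
      unfolding \<sigma>_def by (rule pol.hom_subst) simp_all
    also have "(\<lambda>i. poly [:if i = 1 then 0 else var i, if i = 1 then 1 else 0:] (var 1)) = (var :: nat \<Rightarrow> 'k mpoly)"
      by auto
    finally show ?thesis
      by simp
  qed
  have unit: "\<exists>b'\<in>polys n. b * b' = 1" if b: "b \<in> polys n" "c \<in> polys n" "b * c = ?f" "degree (\<sigma> b) = 0" for b c
  proof -
    obtain b0 where b0: "\<sigma> b = [:b0:]"
      using b(4) by (rule degree_eq_zeroE)
    then have "b = b0"
      using recover[of b] by simp
    have "[:b0:] * \<sigma> c = [:R, var 0 ^ m:]"
      using \<sigma>_mult[of b c] b(3) \<sigma>f b0 by simp
    from arg_cong[OF this, of "\<lambda>p. coeff p 0"] arg_cong[OF this, of "\<lambda>p. coeff p 1"]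
    have "b * coeff (\<sigma> c) 1 = var 0 ^ m" "b * coeff (\<sigma> c) 0 = R"
      using \<open>b = b0\<close> by simp_all
    then show ?thesis
      using invertible_if_divides_coprime[OF b(1) coeffs[OF b(2)] n _ _ R0] by blast
  qed
  have deg: "degree (\<sigma> b) + degree (\<sigma> c) = 1" if "b * c = ?f" for b c
  proof -
    have "\<sigma> b * \<sigma> c = [:R, var 0 ^ m:]"
      using \<sigma>_mult[of b c] that \<sigma>f by simp
    moreover from this have "\<sigma> b \<noteq> 0" "\<sigma> c \<noteq> 0"
      by auto
    ultimately show ?thesis
      using degree_mult_eq[of "\<sigma> b" "\<sigma> c"] by simp
  qed
  have "?f \<noteq> 0"
  proof
    assume "?f = 0"
    then have "\<sigma> ?f = \<sigma> 0"
      by (rule arg_cong)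
    then show False
      unfolding \<sigma>f by (simp add: \<sigma>_def)
  qed
  moreover have "?f \<notin> Units (poly_alg n)"
  proof
    assume "?f \<in> Units (poly_alg n)"
    then obtain h where "?f * h = 1"
      by (auto simp: Units_def)
    then have "\<sigma> ?f * \<sigma> h = 1"
      using \<sigma>_mult[of ?f h] by (simp add: \<sigma>_def)
    then have "degree (\<sigma> ?f) = 0"
      by (metis degree_1 degree_mult_eq add_is_0 mult_zero_left mult_zero_right zero_neq_one)
    then show False
      unfolding \<sigma>f by simp
  qed
  moreover have "b \<in> Units (poly_alg n)" if b: "b \<in> polys n" "properfactor (poly_alg n) b ?f" for b
  proof -
    obtain c where c: "c \<in> polys n" "b * c = ?f"
      using b(2) by (auto simp: properfactor_def factor_def)
    have "degree (\<sigma> b) = 0"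
    proof (rule ccontr)
      assume "degree (\<sigma> b) \<noteq> 0"
      then have "degree (\<sigma> c) = 0"
        using deg[OF c(2)] by simp
      then obtain c' where c': "c' \<in> polys n" "c * c' = 1"
        using unit[OF c(1) b(1)] c(2) by (metis mult.commute)
      have "?f * c' = b * (c * c')"
        unfolding c(2)[symmetric] by (rule mult.assoc)
      then have "b = ?f * c'"
        using c'(2) by simp
      then have "?f divides\<^bsub>poly_alg n\<^esub> b"
        unfolding factor_def using c'(1) by auto
      then show False
        using b(2) unfolding properfactor_def by blast
    qed
    then show ?thesis
      using unit[OF b(1) c] b(1) by (auto simp: Units_def mult.commute)
  qed
  ultimately show ?thesis
    unfolding ring_irreducible_def Divisibility.irreducible_def by auto
qed


section \<open>Degenerate points\<close>

text \<open>The point is the kernel of setting all variables except x_m to 0. It is prime because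
  the image lies in a domain, and it contains f by assumption.\<close>

lemma (in hyp) coordinate_point:
  assumes m: "m \<le> n" and fm: "subst cst (\<lambda>i. if i = m then var m else 0) f = 0"
  shows "\<exists>P. kpoint n d f P m (\<lambda>i. if i = m then 1 else 0)"
proof -
  define \<phi> :: "'k mpoly \<Rightarrow> 'k mpoly" where "\<phi> = subst cst (\<lambda>i. if i = m then var m else 0)"
  define P where "P = cls ` {a \<in> polys n. \<phi> a = 0}"
  have \<phi>: "\<phi> (a + b) = \<phi> a + \<phi> b" "\<phi> (a * b) = \<phi> a * \<phi> b" "\<phi> (- a) = - \<phi> a" "\<phi> 0 = 0" "\<phi> 1 = 1"
    "\<phi> (a - b) = \<phi> a - \<phi> b" for a b
    by (simp_all add: \<phi>_def)
  have P_iff: "cls a \<in> P \<longleftrightarrow> \<phi> a = 0" if a: "a \<in> polys n" for a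
  proof
    assume "cls a \<in> P"
    then obtain b where b: "b \<in> polys n" "\<phi> b = 0" "cls a = cls b"
      unfolding P_def by blast
    then obtain h where "a - b = h * f"
      using cls_eq_iff[OF a b(1)] by blast
    from arg_cong[OF this, of \<phi>] show "\<phi> a = 0"
      using b(2) fm by (simp add: \<phi>) (simp add: \<phi>_def)
  qed (use a in \<open>auto simp: P_def\<close>)
  have carr: "\<exists>a\<in>polys n. X = cls a \<and> \<phi> a = 0" if "X \<in> P" for X
    using that unfolding P_def by blast
  have ideal: "ideal P Q"
  proof (rule idealI[OF Q.ring_axioms])
    show "subgroup P (add_monoid Q)"
    proof (rule Q.add.subgroupI)
      show "P \<subseteq> carrier Q"
        unfolding P_def Q_simps(1) by blast
      show "P \<noteq> {}"
        unfolding P_def using polys_0 \<phi>(4) by blast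
      fix X assume "X \<in> P"
      then obtain a where a: "a \<in> polys n" "X = cls a" "\<phi> a = 0"
        using carr by blast
      have "\<ominus>\<^bsub>Q\<^esub> X = cls (- a)"
        unfolding a(2) using a(1) by (intro Q.minus_equality) (auto simp: Q_simps polys_uminus)
      then show "\<ominus>\<^bsub>Q\<^esub> X \<in> P"
        using a P_iff[of "- a"] by (simp add: \<phi> polys_uminus)
      fix Y assume "Y \<in> P"
      then obtain b where b: "b \<in> polys n" "Y = cls b" "\<phi> b = 0"
        using carr by blast
      show "X \<oplus>\<^bsub>Q\<^esub> Y \<in> P"
        using a b P_iff[of "a + b"] by (simp add: Q_simps \<phi> polys_add)
    qed
    fix X Y assume "X \<in> P" "Y \<in> carrier Q"
    then obtain a b where ab: "a \<in> polys n" "X = cls a" "\<phi> a = 0" "b \<in> polys n" "Y = cls b"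
      using carr unfolding Q_simps(1) by blast
    then show "Y \<otimes>\<^bsub>Q\<^esub> X \<in> P" "X \<otimes>\<^bsub>Q\<^esub> Y \<in> P"
      using P_iff[of "a * b"] P_iff[of "b * a"] by (simp_all add: Q_simps \<phi> polys_mult)
  qed
  have prime: "primeideal P Q"
  proof (rule primeidealI[OF ideal Q.is_cring])
    have "cls 1 \<notin> P"
      using P_iff[of 1] by (simp add: \<phi>)
    then show "carrier Q \<noteq> P"
      unfolding Q_simps(1) using polys_1 by blast
    fix X Y assume "X \<in> carrier Q" "Y \<in> carrier Q" and XY: "X \<otimes>\<^bsub>Q\<^esub> Y \<in> P"
    then obtain a b where ab: "a \<in> polys n" "X = cls a" "b \<in> polys n" "Y = cls b"
      unfolding Q_simps(1) by blast
    then show "X \<in> P \<or> Y \<in> P"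
      using XY P_iff[of "a * b"] P_iff[of a] P_iff[of b] by (simp add: Q_simps \<phi> polys_mult)
  qed
  have "P \<subseteq> Idl\<^bsub>Q\<^esub> (P \<inter> homogeneous_elems Q)"
  proof
    fix X assume "X \<in> P"
    then obtain a where a: "a \<in> polys n" "X = cls a" "\<phi> a = 0"
      using carr by blast
    obtain F N where F': "\<forall>e. F e \<in> forms n e" "a = (\<Sum>e<N. F e)"
      using a(1) by (rule polys_forms_decomp)
    note F = F'(1)[rule_format] F'(2)
    have sub: "P \<inter> homogeneous_elems Q \<subseteq> carrier Q"
      unfolding P_def Q_simps(1) by blast
    interpret I: ideal "Idl\<^bsub>Q\<^esub> (P \<inter> homogeneous_elems Q)" Q
      using sub by (rule Q.genideal_ideal)
    have "cls (F e) \<in> Idl\<^bsub>Q\<^esub> (P \<inter> homogeneous_elems Q)" if e: "e < N" for e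
    proof -
      have \<phi>F: "\<phi> (F i) \<in> forms n i" for i
        unfolding \<phi>_def using forms_subst[OF F(1)[of i], of "\<lambda>i. if i = m then var m else 0" n 1] m by auto
      have "0 = (\<Sum>i<N. homog_part e (\<phi> (F i)))"
        using arg_cong[OF a(3), of "homog_part e"] unfolding F(2) \<phi>_def cst.subst_sum homog_part_sum by simp
      also have "\<dots> = (\<Sum>i<N. if e = i then \<phi> (F i) else 0)"
        by (intro sum.cong refl homog_part_form[OF \<phi>F])
      finally have "\<phi> (F e) = 0"
        using e by simp
      then have "cls (F e) \<in> P"
        using P_iff[OF forms_polys[OF F(1)]] by simp
      moreover have "cls (F e) \<in> homogeneous_elems Q"
        unfolding homogeneous_elems_def Q_simps(6) using F(1) by blast
      ultimately show ?thesis
        using Q.genideal_self[OF sub] by blast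
    qed
    moreover have "cls 0 \<in> Idl\<^bsub>Q\<^esub> (P \<inter> homogeneous_elems Q)"
      using I.zero_closed by (simp add: Q_simps)
    ultimately have "cls (\<Sum>e<M. F e) \<in> Idl\<^bsub>Q\<^esub> (P \<inter> homogeneous_elems Q)" if "M \<le> N" for M
      using that
    proof (induction M)
      case (Suc M)
      have "(\<Sum>e<M. F e) \<in> polys n"
        using forms_polys[OF F(1)] by (intro polys_sum)
      then have "cls (\<Sum>e<Suc M. F e) = cls (\<Sum>e<M. F e) \<oplus>\<^bsub>Q\<^esub> cls (F M)"
        using forms_polys[OF F(1)[of M]] by (simp add: Q_simps)
      moreover have "cls (\<Sum>e<M. F e) \<in> Idl\<^bsub>Q\<^esub> (P \<inter> homogeneous_elems Q)"
        using Suc by simp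
      moreover have "cls (F M) \<in> Idl\<^bsub>Q\<^esub> (P \<inter> homogeneous_elems Q)"
        using Suc by simp
      ultimately show ?case
        using I.a_closed by simp
    qed simp
    then show "X \<in> Idl\<^bsub>Q\<^esub> (P \<inter> homogeneous_elems Q)"
      using a(2) F(2) by simp
  qed
  moreover have "Idl\<^bsub>Q\<^esub> (P \<inter> homogeneous_elems Q) \<subseteq> P"
    using ideal by (rule Q.genideal_minimal) blast
  moreover have "\<not> irrelevant_ideal Q \<subseteq> P"
  proof
    assume *: "irrelevant_ideal Q \<subseteq> P"
    have "(\<Union>e\<in>{0<..}. piece Q e) \<subseteq> carrier Q"
      unfolding Q_simps(1,6) using forms_polys by blast
    then have "(\<Union>e\<in>{0<..}. piece Q e) \<subseteq> irrelevant_ideal Q"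
      unfolding irrelevant_ideal_def by (rule Q.genideal_self)
    moreover have "cls (var m) \<in> piece Q 1"
      unfolding Q_simps(6) using forms_var[OF m] by blast
    ultimately have "cls (var m) \<in> P"
      using * by (meson UN_I greaterThan_iff subsetD zero_less_one)
    then show False
      using P_iff[of "var m"] m by (simp add: \<phi>_def)
  qed
  ultimately have "P \<in> proj_points Q"
    unfolding proj_points_def by (intro CollectI conjI prime subset_antisym)
  moreover have "cls a \<in> P \<longleftrightarrow> subst id (\<lambda>i. if i = m then 1 else 0) a = 0" if a: "a \<in> forms n e" for a e
  proof -
    let ?c = "\<lambda>i. if i = m then 1 else 0 :: 'k"
    have "(\<lambda>i. if i = m then var m else 0) = (\<lambda>i. var m * cst (?c i))"
      by auto
    then have "\<phi> a = var m ^ e * subst cst (\<lambda>i. cst (?c i)) a"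
      unfolding \<phi>_def using cst.subst_scale[OF a, of "var m" "\<lambda>i. cst (?c i)"] by simp
    also have "subst cst (\<lambda>i. cst (?c i)) a = cst (subst id ?c a)"
      using ev.hom_subst[of cst ?c a] by (simp add: single_add mult_single)
    finally show ?thesis
      using P_iff[OF forms_polys[OF a]] by simp
  qed
  ultimately have "kpoint n d f P m (\<lambda>i. if i = m then 1 else 0)"
    using m by unfold_locales simp_all
  then show ?thesis
    by blast
qed

text \<open>The denominators turn forms into local functions, and \<open>rel\<close> is the relation
  after clearing them. As f has no linear part, linear parts of numerators decide about membership
  in the square and about independence.\<close>

lemma (in kpoint) degenerateI:
  assumes 1: "a1 \<in> forms n e1" "s1 \<in> forms n e1" "ev s1 \<noteq> 0" "ev a1 = 0"
    and 2: "a2 \<in> forms n e2" "s2 \<in> forms n e2" "ev s2 \<noteq> 0" "ev a2 = 0"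
    and 3: "a3 \<in> forms n e3" "s3 \<in> forms n e3" "ev s3 \<noteq> 0" "ev a3 = 0"
    and 4: "a4 \<in> forms n e4" "s4 \<in> forms n e4" "ev s4 \<noteq> 0"
    and rel: "h \<in> polys n" "a1 ^ r * a2 * (s3 ^ (r + 2) * s4) - a3 ^ (r + 2) * a4 * (s1 ^ r * s2) = h * f"
    and f2: "coeff (tau f) 1 = 0"
    and lin: "coeff (tau a1) 1 \<noteq> 0" "coeff (tau a2) 1 \<noteq> 0"
    and ind: "\<And>t. ind \<Longrightarrow> coeff (tau a2) 1 \<noteq> cst t * coeff (tau a1) 1"
  shows "degenerate ind r (hloc Q P) (stalk_const Q P)"
proof -
  have f01: "coeff (tau f) 0 = 0" "coeff (tau f) 1 = 0"
    using f2 tau_0[of f] ev_f by simp_all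
  have dvd: "monom 1 2 dvd tau f"
    unfolding monom_1_dvd_iff' using f01 by (auto simp: less_2_cases_iff)
  let ?u = "hfrac Q P (cls a1) (cls s1)" and ?v = "hfrac Q P (cls a2) (cls s2)"
    and ?w = "hfrac Q P (cls a3) (cls s3)" and ?g = "hfrac Q P (cls a4) (cls s4)"
  have nsq: "?u \<notin> nonunits_square (hloc Q P)" "?v \<notin> nonunits_square (hloc Q P)"
    using square_linear_part[OF dvd _ 1(1-3) refl] square_linear_part[OF dvd _ 2(1-3) refl] lin by blast+
  have p1: "a1 ^ r \<in> forms n (r * e1)" "s1 ^ r \<in> forms n (r * e1)" "ev (s1 ^ r) \<noteq> 0"
    using 1(3) forms_power[OF 1(1) refl] forms_power[OF 1(2) refl] by simp_all
  have p3: "a3 ^ (r + 2) \<in> forms n ((r + 2) * e3)" "s3 ^ (r + 2) \<in> forms n ((r + 2) * e3)" "ev (s3 ^ (r + 2)) \<noteq> 0"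
    by (rule forms_power[OF 3(1) refl] forms_power[OF 3(2) refl])+ (use 3(3) in simp)
  have p12: "a1 ^ r * a2 \<in> forms n (r * e1 + e2)" "s1 ^ r * s2 \<in> forms n (r * e1 + e2)" "ev (s1 ^ r * s2) \<noteq> 0"
    using forms_mult[OF p1(1) 2(1) refl] forms_mult[OF p1(2) 2(2) refl] p1(3) 2(3) by simp_all
  have p34: "a3 ^ (r + 2) * a4 \<in> forms n ((r + 2) * e3 + e4)" "s3 ^ (r + 2) * s4 \<in> forms n ((r + 2) * e3 + e4)"
    "ev (s3 ^ (r + 2) * s4) \<noteq> 0"
    using forms_mult[OF p3(1) 4(1) refl] forms_mult[OF p3(2) 4(2) refl] p3(3) 4(3) by simp_all
  have eq: "?u [^]\<^bsub>hloc Q P\<^esub> r \<otimes>\<^bsub>hloc Q P\<^esub> ?v = ?w [^]\<^bsub>hloc Q P\<^esub> (r + 2) \<otimes>\<^bsub>hloc Q P\<^esub> ?g"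
    unfolding hloc_pow_cls[OF 1(1-3)] hloc_pow_cls[OF 3(1-3)]
      hloc_mult_cls(1)[OF p1 2(1-3)] hloc_mult_cls(1)[OF p3 4(1-3)]
    by (rule frac_eqI[OF p12 p34 rel])
  have carr: "hfrac Q P (cls a) (cls s) \<in> carrier (hloc Q P)"
    if "a \<in> forms n e" "s \<in> forms n e" "ev s \<noteq> 0" for a s e
    by (rule Q.hloc_carrierI[OF P fracs_cls[OF that]])
  have sq_carr: "z \<in> carrier (hloc Q P)" if "z \<in> nonunits_square (hloc Q P)" for z
    using that
  proof (induction rule: nonunits_square.induct)
    case (mult X Y)
    then have "X \<in> carrier (hloc Q P)" "Y \<in> carrier (hloc Q P)"
      by (auto simp: nonunits_def)
    obtain b t i where b: "b \<in> forms n i" "t \<in> forms n i" "ev t \<noteq> 0" "X = hfrac Q P (cls b) (cls t)"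
      using \<open>X \<in> carrier _\<close> by (rule stalk_element)
    obtain b' t' i' where b': "b' \<in> forms n i'" "t' \<in> forms n i'" "ev t' \<noteq> 0" "Y = hfrac Q P (cls b') (cls t')"
      using \<open>Y \<in> carrier _\<close> by (rule stalk_element)
    have "ev (t * t') \<noteq> 0"
      using b(3) b'(3) by simp
    then show ?case
      unfolding b(4) b'(4) hloc_mult_cls(1)[OF b(1-3) b'(1-3)]
      by (rule carr[OF forms_mult[OF b(1) b'(1) refl] forms_mult[OF b(2) b'(2) refl]])
  next
    case (add X Y)
    obtain b t i where b: "b \<in> forms n i" "t \<in> forms n i" "ev t \<noteq> 0" "X = hfrac Q P (cls b) (cls t)"
      using add(3) by (rule stalk_element)
    obtain b' t' i' where b': "b' \<in> forms n i'" "t' \<in> forms n i'" "ev t' \<noteq> 0" "Y = hfrac Q P (cls b') (cls t')"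
      using add(4) by (rule stalk_element)
    have "ev (t * t') \<noteq> 0"
      using b(3) b'(3) by simp
    moreover have "b * t' + b' * t \<in> forms n (i + i')"
      using forms_mult[OF b(1) b'(2) refl] forms_mult[OF b'(1) b(2), of "i + i'"] by (auto simp: add.commute)
    ultimately show ?case
      unfolding b(4) b'(4) hloc_mult_cls(2)[OF b(1-3) b'(1-3)]
      using carr[OF _ forms_mult[OF b(2) b'(2) refl]] by blast
  qed
  have "\<not> (\<exists>t. \<exists>m\<in>nonunits_square (hloc Q P). ?v = stalk_const Q P t \<otimes>\<^bsub>hloc Q P\<^esub> ?u \<oplus>\<^bsub>hloc Q P\<^esub> m)" if ind': ind
  proof
    assume "\<exists>t. \<exists>m\<in>nonunits_square (hloc Q P). ?v = stalk_const Q P t \<otimes>\<^bsub>hloc Q P\<^esub> ?u \<oplus>\<^bsub>hloc Q P\<^esub> m"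
    then obtain t m where m: "m \<in> nonunits_square (hloc Q P)"
      and v: "?v = stalk_const Q P t \<otimes>\<^bsub>hloc Q P\<^esub> ?u \<oplus>\<^bsub>hloc Q P\<^esub> m"
      by blast
    obtain b s e where b: "b \<in> forms n e" "s \<in> forms n e" "ev s \<noteq> 0" "m = hfrac Q P (cls b) (cls s)"
      using sq_carr[OF m] by (rule stalk_element)
    have lb: "coeff (tau b) 1 = 0"
      by (rule square_linear_part[OF dvd m b])
    have tu: "stalk_const Q P t \<otimes>\<^bsub>hloc Q P\<^esub> ?u = hfrac Q P (cls (cst t * a1)) (cls s1)"
      using hloc_mult_cls(1)[of "cst t" 0 1 a1 e1 s1] 1 unfolding stalk_const_def Q_simps by simp
    have ta: "cst t * a1 \<in> forms n e1"
      using 1(1) by (rule forms_scale)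
    have sum: "cst t * a1 * s + b * s1 \<in> forms n (e1 + e)" "s1 * s \<in> forms n (e1 + e)" "ev (s1 * s) \<noteq> 0"
      using forms_mult[OF ta b(2) refl] forms_mult[OF b(1) 1(2), of "e1 + e"] forms_mult[OF 1(2) b(2) refl] 1(3) b(3)
      by (auto simp: add.commute)
    have "?v = hfrac Q P (cls (cst t * a1 * s + b * s1)) (cls (s1 * s))"
      using v unfolding tu b(4) hloc_mult_cls(2)[OF ta 1(2,3) b(1-3)] .
    then obtain u i h where u: "u \<in> forms n i" "ev u \<noteq> 0" "h \<in> polys n"
      "u * (a2 * (s1 * s)) - u * ((cst t * a1 * s + b * s1) * s2) = h * f"
      by (rule frac_eqD[OF 2(1-3) sum])
    have evb: "ev b = 0"
      using arg_cong[OF u(4), of ev] u(2) 1 2 ev_f by simp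
    have "coeff (tau (u * (a2 * (s1 * s)))) 1 - coeff (tau (u * ((cst t * a1 * s + b * s1) * s2))) 1 = coeff (tau (h * f)) 1"
      using arg_cong[OF u(4), of "\<lambda>p. coeff (tau p) 1"] by simp
    then have "cst (ev u) * (cst (ev s1) * (cst (ev s) * coeff (tau a2) 1)) =
        cst (ev u) * (cst (ev s2) * (cst (ev s) * (cst t * coeff (tau a1) 1)))"
      using 1(4) 2(4) evb lb f01 ev_f unfolding lin_mult tau_simps(3) coeff_add
      by (simp add: mult_single single_zero flip: mult.assoc)
    then have "cst (ev s) * (cst (ev s1) * coeff (tau a2) 1) = cst (ev s) * (cst (ev s2) * (cst t * coeff (tau a1) 1))"
      using u(2) by (simp add: mult.left_commute)
    then have "cst (ev s1) * coeff (tau a2) 1 = cst (ev s2) * (cst t * coeff (tau a1) 1)"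
      using b(3) by (metis cst_eq_0_iff mult_cancel_left)
    then have "cst (1 / ev s1) * (cst (ev s1) * coeff (tau a2) 1) = cst (1 / ev s1) * (cst (ev s2) * (cst t * coeff (tau a1) 1))"
      by simp
    then have "coeff (tau a2) 1 = cst (1 / ev s1 * ev s2 * t) * coeff (tau a1) 1"
      using 1(3) by (simp add: mult_single flip: mult.assoc)
    then show False
      using ind[OF ind'] by blast
  qed
  moreover have "?u \<in> nonunits (hloc Q P)" "?v \<in> nonunits (hloc Q P)" "?w \<in> nonunits (hloc Q P)"
    using nonunit_iff[OF 1(1-3)] nonunit_iff[OF 2(1-3)] nonunit_iff[OF 3(1-3)] 1(4) 2(4) 3(4) by simp_all
  ultimately show ?thesis
    unfolding degenerate_def using rational eq nsq carr[OF 4] by blast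
qed

section \<open>Irreducibility and degenerate points of the two forms\<close>

context family
begin

lemma p0_nonzero:
  assumes "\<alpha> \<noteq> 0 \<or> \<beta> \<noteq> 0"
  shows "p0 \<noteq> 0"
proof
  assume "p0 = 0"
  then have "subst id (\<lambda>i. if i = 2 \<and> \<beta> = 0 then 1 else if i = 3 then 1 else 0) p0 = 0"
    by simp
  then show False
    using assms by (auto simp: p0_def split: if_splits)
qed

lemma irreducible_forms:
  assumes "\<alpha> \<noteq> 0 \<or> \<beta> \<noteq> 0"
  shows "irreducible_form n (k + 2) f0" "irreducible_form n (k + 2) f1"
proof -
  have x0: "subst cst (\<lambda>i. if i = 0 then 0 else var i) p0 = p0"
    by (simp add: p0_def)
  have "ring_irreducible\<^bsub>poly_alg n\<^esub> (x ^ Suc k * y + p0)"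
  proof (rule irreducible_linear)
    show "subst (\<lambda>a. [:cst a:]) (\<lambda>i. [:if i = 1 then 0 else var i, if i = 1 then 1 else 0:]) p0 = [:p0:]"
      by (simp add: p0_def poly_const_pow del: power_Suc)
  qed (use n forms_polys[OF p0_form] x0 p0_nonzero[OF assms] in auto)
  then show "irreducible_form n (k + 2) f0"
    unfolding irreducible_form_def using f0_form by (simp add: f0_def)
  have "ring_irreducible\<^bsub>poly_alg n\<^esub> (x ^ Suc k * y + (p0 + C * q))"
  proof (rule irreducible_linear)
    show "subst (\<lambda>a. [:cst a:]) (\<lambda>i. [:if i = 1 then 0 else var i, if i = 1 then 1 else 0:]) (p0 + C * q) = [:p0 + C * q:]"
      by (simp add: p0_def C_def q_def poly_const_pow ac_simps del: power_Suc)
    show "subst cst (\<lambda>i. if i = 0 then 0 else var i) (p0 + C * q) \<noteq> 0"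
      using x0 p0_nonzero[OF assms] k by (simp add: C_def power_0_left)
  qed (use n forms_polys[OF p0_form] forms_polys[OF C_form] forms_polys[OF q_form] in auto)
  then show "irreducible_form n (k + 2) f1"
    unfolding irreducible_form_def using f1_form by (simp add: f1_def f0_def add.assoc)
qed

text \<open>If x is nonzero at the point, f0 is solved for y. If x = w = 0, its order or its tangent
  cone is the obstruction. If x = 0 and w is nonzero, the equation forces \<alpha> z + \<beta> w =
  0, hence \<alpha> = 1, and f0 is solved for z.\<close>

lemma f0_not_degenerate:
  assumes \<alpha>\<beta>: "\<alpha> = 0 \<and> \<beta> = 1 \<or> \<alpha> = 1 \<and> \<beta> = - 1 \<and> k \<ge> 2"
    and P: "P \<in> proj_points (coord_ring n f0)"
  shows "\<not> degenerate (k = 1) (max 1 (k - 1)) (hloc (coord_ring n f0) P) (stalk_const (coord_ring n f0) P)"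
proof
  assume deg: "degenerate (k = 1) (max 1 (k - 1)) (hloc (coord_ring n f0) P) (stalk_const (coord_ring n f0) P)"
  interpret H: hyp n "k + 2" f0
    by (rule hyp.intro[OF f0_form])
  note rat = deg[unfolded degenerate_def, THEN conjunct1]
  \<comment> \<open>The chart x = 1 is preferred, so any other choice of j means that x vanishes at
    the point.\<close>
  obtain j where jj: "j \<le> n" "H.cls (var j) \<notin> P" "j \<noteq> 0 \<Longrightarrow> H.cls x \<in> P"
  proof (cases "H.cls x \<in> P")
    case True
    then show ?thesis
      using H.exists_coordinate[OF P] that by blast
  qed (use that[of 0] in simp)
  obtain c where "kpoint n (k + 2) f0 P j c"
    using H.rational_kpoint[OF P rat jj(1,2)] by blast
  then interpret kpoint n "k + 2" f0 P j c .
  show False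
  proof (cases "j = 0")
    case True
    have "\<not> degenerate (k = 1) (max 1 (k - 1)) (hloc (coord_ring n f0) P) (stalk_const (coord_ring n f0) P)"
    proof (rule not_degenerate_graph)
      show "f0 = var j ^ Suc k * var 1 + p0"
        using True by (simp add: f0_def)
      show "subst cst g p0 = subst cst g' p0" if "\<And>i. i \<noteq> 1 \<Longrightarrow> g i = g' i" for g g' :: "nat \<Rightarrow> 'k mpoly"
        using that by (simp add: p0_def)
    qed (use n True p0_form in auto)
    with deg show False by blast
  next
    case False
    have c0: "c 0 = 0"
      using mem[of x 1] jj(3)[OF False] n by simp
    have f0c: "c 3 ^ Suc k * (\<alpha> * c 2 + \<beta> * c 3) = 0"
      using ev_f c0 by (simp add: f0_def p0_def)
    show False
    proof (cases "c 3 = 0")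
      case True
      then have j3: "j \<noteq> 3"
        using j(2) by auto
      have x: "tau x = monom (var 0) 1"
        using False c0 by (simp add: tau_var monom_Suc monom_0)
      have w: "tau w = monom (var 3) 1"
        using j3 True by (simp add: tau_var monom_Suc monom_0)
      have tf: "tau f0 = monom (var 0 ^ Suc k) (Suc k) * tau y + monom (var 3 ^ Suc k) (Suc k) * tau (cst \<alpha> * z + cst \<beta> * w)"
        unfolding f0_def p0_def tau_simps(3,6,7) x w monom_power by simp
      show False
      proof (cases "k = 1")
        case True
        then have ab: "\<alpha> = 0" "\<beta> = 1"
          using \<alpha>\<beta> by auto
        have L: "tau (cst \<alpha> * z + cst \<beta> * w) = monom (var 3) 1"
          using ab w by simp
        have tf': "tau f0 = monom (var 0 ^ 2) 2 * tau y + monom (var 3 ^ 2 * var 3) 3"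
          unfolding tf L using True by (simp add: mult_monom numeral_2_eq_2 numeral_3_eq_3)
        have "\<not> degenerate True 1 (hloc (coord_ring n f0) P) (stalk_const (coord_ring n f0) P)"
        proof (rule not_degenerate_double_plane)
          show "coeff (tau f0) 0 = 0" "coeff (tau f0) 1 = 0" "coeff (tau f0) 2 = cst (ev y) * var 0 ^ 2"
            unfolding tf' by (simp_all add: coeff_monom_mult tau_0)
        qed
        with deg True show False by simp
      next
        case False
        \<comment> \<open>Both summands of \<open>tau f0\<close> carry T^(k+1), which is T^(r+2) for
          k \<ge> 2.\<close>
        then have r: "max 1 (k - 1) + 2 = Suc k"
          using k by auto
        have dvd: "monom 1 (Suc k) dvd monom s (Suc k) * p" for s :: "'k mpoly" and p
        proof -
          have "monom s (Suc k) = smult s (monom 1 (Suc k))"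
            by (simp add: smult_monom)
          then show ?thesis
            by (simp add: dvd_smult dvd_mult2)
        qed
        have "monom 1 (max 1 (k - 1) + 2) dvd tau f0"
          unfolding r tf by (intro dvd_add dvd)
        with deg show False
          using not_degenerate_high_order by blast
      qed
    next
      case c3: False
      then have "\<alpha> * c 2 + \<beta> * c 3 = 0"
        using f0c by simp
      then have ab: "\<alpha> = 1" "\<beta> = - 1"
        using \<alpha>\<beta> c3 by auto
      have "H.cls w \<notin> P"
        using mem[of w 1] c3 n by simp
      \<comment> \<open>The same point is viewed in the chart w = 1, where f0 is a graph over the
        coordinates other than z.\<close>
      then obtain c' where "kpoint n (k + 2) f0 P 3 c'"
        using H.rational_kpoint[OF P rat, of 3] n by auto
      then interpret K: kpoint n "k + 2" f0 P 3 c' .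
      have R: "x ^ Suc k * y - w ^ (k + 2) \<in> forms n (k + 2)"
        using n by (intro forms_diff forms_mult[OF forms_power[OF forms_var refl] forms_var] forms_power[OF forms_var]) auto
      have "\<not> degenerate (k = 1) (max 1 (k - 1)) (hloc (coord_ring n f0) P) (stalk_const (coord_ring n f0) P)"
      proof (rule K.not_degenerate_graph[OF _ _ _ _ R])
        show "f0 = var 3 ^ Suc k * var 2 + (x ^ Suc k * y - w ^ (k + 2))"
          unfolding f0_def p0_def by (simp add: ab single_uminus algebra_simps)
        show "subst cst g (x ^ Suc k * y - w ^ (k + 2)) = subst cst g' (x ^ Suc k * y - w ^ (k + 2))"
          if "\<And>i. i \<noteq> 2 \<Longrightarrow> g i = g' i" for g g' :: "nat \<Rightarrow> 'k mpoly"
          using that by simp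
      qed (use n in auto)
      with deg show False by blast
    qed
  qed
qed

text \<open>For c = 0 take the point with only z nonzero: there x^k (x y + q) = - w^(k+1) (\<alpha>
  z + \<beta> w), and x y + q is a unit with value a, so u = v = x and r = k - 1. For the cubic take
  the point with only v nonzero: there x (x y + v q) = - w^3, and the second factor has the linear
  part of q, in which w has the nonzero coefficient b + g.\<close>

lemma f1_degenerate:
  assumes "c = 0 \<and> k \<ge> 2 \<and> a \<noteq> 0 \<or> c = 1 \<and> k = 1 \<and> \<alpha> = 0 \<and> \<beta> = 1 \<and> b + g \<noteq> 0"
  shows "\<exists>P\<in>proj_points (coord_ring n f1).
    degenerate (k = 1) (max 1 (k - 1)) (hloc (coord_ring n f1) P) (stalk_const (coord_ring n f1) P)"
proof -
  interpret H: hyp n "k + 2" f1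
    by (rule hyp.intro[OF f1_form])
  note [simp del] = power_Suc
  consider "c = 0" "e = 2" "k \<ge> 2" "a \<noteq> 0" | "c = 1" "e = 1" "k = 1" "\<alpha> = 0" "\<beta> = 1" "b + g \<noteq> 0"
    using assms ce by auto
  then show ?thesis
  proof cases
    case 1
    define r where "r = k - 1"
    then have r: "k = Suc r" "r \<ge> 1" "max 1 (k - 1) = r" "(k = 1) = False"
      using 1 by auto
    let ?L = "cst \<alpha> * z + cst \<beta> * w"
    have f1: "f1 = x * (x ^ r * (x * y + q)) + w * (w ^ Suc r * ?L)"
      unfolding f1_def f0_def p0_def C_def by (simp add: 1(1) r(1) algebra_simps power_Suc)
    have "subst cst (\<lambda>i. if i = 2 then var 2 else 0) f1 = 0"
      unfolding f1 by simp
    then obtain P where "kpoint n (k + 2) f1 P 2 (\<lambda>i. if i = 2 then 1 else 0)"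
      using H.coordinate_point[of 2] n by auto
    then interpret kpoint n "k + 2" f1 P 2 "\<lambda>i. if i = 2 then 1 else 0" .
    have q2: "q \<in> forms n 2"
      using q_form 1 by simp
    have evq: "ev (x * y + q) = a"
      unfolding q_def by (simp add: 1)
    have lx: "coeff (tau x) 1 \<noteq> 0"
      by (simp add: tau_var)
    have "degenerate False r (hloc (coord_ring n f1) P) (stalk_const (coord_ring n f1) P)"
    proof (rule degenerateI[where ?a1.0=x and ?s1.0=z and ?e1.0=1 and ?a2.0=x and ?s2.0=z and ?e2.0=1
          and ?a3.0=w and ?s3.0=z and ?e3.0=1 and ?a4.0="- (?L * z)" and ?s4.0="x * y + q" and ?e4.0=2 and h="z ^ (r + 2)"])
      show "- (?L * z) \<in> forms n 2"
        using n by (intro forms_uminus forms_mult[of _ n 1 _ 1] forms_add forms_scale forms_var) auto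
      show "x * y + q \<in> forms n 2"
        using n q2 by (intro forms_add forms_mult[of _ n 1 _ 1] forms_var) auto
      show "ev (x * y + q) \<noteq> 0"
        unfolding evq by (rule 1)
      show "z ^ (r + 2) \<in> polys n"
        using n by (intro polys_power) simp
      show "x ^ r * x * (z ^ (r + 2) * (x * y + q)) - w ^ (r + 2) * - (?L * z) * (z ^ r * z) = z ^ (r + 2) * f1"
        unfolding f1 by (simp add: algebra_simps power_Suc)
      show "coeff (tau f1) 1 = 0"
        unfolding f1 tau_simps(3) coeff_add lin_mult using r by simp
    qed (use n lx in auto)
    then show ?thesis
      unfolding r(3,4) using kpoint.P[OF kpoint_axioms] by blast
  next
    case 2
    have n4: "n \<ge> 4"
      using n 2 by auto
    have q: "q = cst a * z + cst (b + g) * w"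
      unfolding q_def by (simp add: 2 single_add algebra_simps)
    let ?u = "x * y + v * q"
    have f1: "f1 = x * ?u + w * (w * w)"
      unfolding f1_def f0_def p0_def C_def by (simp add: 2(1,3-5) algebra_simps power_Suc)
    have "subst cst (\<lambda>i. if i = 4 then var 4 else 0) f1 = 0"
      unfolding f1 q by simp
    then obtain P where "kpoint n (k + 2) f1 P 4 (\<lambda>i. if i = 4 then 1 else 0)"
      using H.coordinate_point[of 4] n4 by auto
    then interpret kpoint n "k + 2" f1 P 4 "\<lambda>i. if i = 4 then 1 else 0" .
    have lx: "coeff (tau x) 1 = var 0"
      by (simp add: tau_var)
    have "coeff (tau ?u) 1 = coeff (tau q) 1"
      unfolding tau_simps(3) coeff_add lin_mult by (simp add: q)
    also have "\<dots> = cst a * var 2 + cst (b + g) * var 3"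
      unfolding q by (simp add: tau_var)
    finally have lu: "coeff (tau ?u) 1 = cst a * var 2 + cst (b + g) * var 3" .
    have nind: "coeff (tau ?u) 1 \<noteq> cst t * coeff (tau x) 1" for t
    proof
      assume "coeff (tau ?u) 1 = cst t * coeff (tau x) 1"
      \<comment> \<open>Comparing both linear forms at the vector whose only nonzero entry is w = 1
        gives b + g = 0.\<close>
      then have "subst id (\<lambda>i. if i = 3 then 1 else 0) (cst a * var 2 + cst (b + g) * var 3) =
          subst id (\<lambda>i. if i = 3 then 1 else 0) (cst t * var 0)"
        unfolding lx lu by simp
      then show False
        using 2 by simp
    qed
    have "degenerate True 1 (hloc (coord_ring n f1) P) (stalk_const (coord_ring n f1) P)"
    proof (rule degenerateI[where ?a1.0=x and ?s1.0=v and ?e1.0=1 and ?a2.0="?u" and ?s2.0="v * v" and ?e2.0=2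
          and ?a3.0=w and ?s3.0=v and ?e3.0=1 and ?a4.0="- 1" and ?s4.0=1 and ?e4.0=0 and h="v ^ 3"])
      show "?u \<in> forms n 2"
        using n4 q_form 2 by (intro forms_add forms_mult[of _ n 1 _ 1] forms_var) auto
      show "v * v \<in> forms n 2"
        using n4 by (intro forms_mult[of _ n 1 _ 1] forms_var) auto
      show "v ^ 3 \<in> polys n"
        using n4 by (intro polys_power) simp
      show "x ^ 1 * ?u * (v ^ (1 + 2) * 1) - w ^ (1 + 2) * - 1 * (v ^ 1 * (v * v)) = v ^ 3 * f1"
        unfolding f1 by (simp add: algebra_simps power_Suc power3_eq_cube)
      show "coeff (tau f1) 1 = 0"
        unfolding f1 tau_simps(3) coeff_add lin_mult by (simp add: q)
      show "coeff (tau ?u) 1 \<noteq> 0"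
        using nind[of 0] by simp
      show "ev ?u = 0"
        by (simp add: q)
      show "(- 1 :: 'k mpoly) \<in> forms n 0"
        by (rule forms_uminus) simp
      show "coeff (tau ?u) 1 \<noteq> cst t * coeff (tau x) 1" for t
        by (rule nind)
    qed (use n4 lx in auto)
    then show ?thesis
      using 2 kpoint.P[OF kpoint_axioms] by auto
  qed
qed

lemma hypersurfaces_not_isomorphic:
  assumes "\<alpha> = 0 \<and> \<beta> = 1 \<or> \<alpha> = 1 \<and> \<beta> = - 1"
    and "c = 0 \<and> k \<ge> 2 \<and> a \<noteq> 0 \<or> c = 1 \<and> k = 1 \<and> \<alpha> = 0 \<and> \<beta> = 1 \<and> b + g \<noteq> 0"
  shows "\<not> isomorphic (hypersurface n f0) (hypersurface n f1)"
proof
  assume iso: "isomorphic (hypersurface n f0) (hypersurface n f1)"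
  interpret H0: hyp n "k + 2" f0
    by (rule hyp.intro[OF f0_form])
  interpret H1: hyp n "k + 2" f1
    by (rule hyp.intro[OF f1_form])
  obtain P' where P': "P' \<in> proj_points (coord_ring n f1)"
    "degenerate (k = 1) (max 1 (k - 1)) (hloc (coord_ring n f1) P') (stalk_const (coord_ring n f1) P')"
    using f1_degenerate[OF assms(2)] by blast
  obtain P where P: "P \<in> proj_points (coord_ring n f0)"
    "degenerate (k = 1) (max 1 (k - 1)) (hloc (coord_ring n f0) P) (stalk_const (coord_ring n f0) P)"
    by (rule H0.Q.degenerate_stalk_transfer[OF H1.Q.graded_cring_axioms iso[unfolded hypersurface_def] P'])
  then show False
    using f0_not_degenerate[OF _ P(1)] assms by auto
qed

end

lemma (in modification) witnesses:
  assumes "\<alpha> = 0 \<and> \<beta> = 1 \<or> \<alpha> = 1 \<and> \<beta> = - 1"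
    and "c = 0 \<and> k \<ge> 2 \<and> a \<noteq> 0 \<or> c = 1 \<and> k = 1 \<and> \<alpha> = 0 \<and> \<beta> = 1 \<and> b + g \<noteq> 0"
  shows "\<exists>f f' :: 'k mpoly. irreducible_form n (k + 2) f \<and> irreducible_form n (k + 2) f' \<and>
    \<not> isomorphic (hypersurface n f) (hypersurface n f') \<and>
    isomorphic (hypersurface_complement n f) (hypersurface_complement n f')"
proof -
  have "\<alpha> \<noteq> 0 \<or> \<beta> \<noteq> 0"
    using assms(1) by auto
  from irreducible_forms[OF this] hypersurfaces_not_isomorphic[OF assms] isomorphic_complements_f show ?thesis
    by blast
qed


section \<open>Choice of the coefficients\<close>

lemma cst_of_nat: "cst (of_nat r) = (of_nat r :: 'k::comm_ring_1 mpoly)"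
  by (induction r) (simp_all add: single_add)

lemma cst_numeral: "cst (numeral r) = (numeral r :: 'k::comm_ring_1 mpoly)"
  using cst_of_nat[of "numeral r"] by simp

theorem theorem1:
  fixes d n :: nat
  assumes "d \<ge> 3" and "n \<ge> 3"
    and "\<not> CHAR('k::field) dvd d"
    and "(d, n) \<noteq> (3, 3)"
  shows "\<exists>f f' :: 'k mpoly.
    irreducible_form n d f \<and> irreducible_form n d f' \<and>
    \<not> isomorphic (hypersurface n f) (hypersurface n f') \<and>
    isomorphic (hypersurface_complement n f) (hypersurface_complement n f')"
proof -
  have d0: "of_nat d \<noteq> (0 :: 'k)"
    using assms(3) by (simp add: of_nat_eq_0_iff_char_dvd)
  define k where "k = d - 2"
  have k1: "k \<ge> 1" and kd: "d = k + 2"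
    using assms(1) by (simp_all add: k_def)
  let ?z = "var 2 :: 'k mpoly" and ?w = "var 3 :: 'k mpoly"
  \<comment> \<open>The split by characteristic is due to the coefficient 3 d of z^2, which the
    invariant needs for k \<ge> 2.\<close>
  consider "k \<ge> 2" "(3 :: 'k) \<noteq> 0" | "k \<ge> 2" "(3 :: 'k) = 0" | "k = 1" "n \<ge> 4"
    using assms k1 kd by fastforce
  then show ?thesis
  proof cases
    case 1
    let ?d = "of_nat (k + 2) :: 'k mpoly"
    \<comment> \<open>With p0 = w^d the condition forces q = d ((z + w)^3 - z^3) / w.\<close>
    interpret F: family n k 0 2 "0 :: 'k" 1 "3 * of_nat d" "3 * of_nat d" "of_nat d"
      using k1 assms(2) by unfold_locales auto
    have c3: "cst (3 * of_nat d) = 3 * ?d"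
      using cst_of_nat[of "3 * d"] kd by simp
    have q: "F.q = 3 * ?d * ?z ^ 2 + 3 * ?d * (?z * ?w) + ?d * ?w ^ 2"
      unfolding F.q_def c3 cst_of_nat by (simp add: kd)
    interpret M: modification n k 0 2 "0 :: 'k" 1 "3 * of_nat d" "3 * of_nat d" "of_nat d"
    proof (unfold_locales, unfold q F.p0_def)
      show "of_nat (Suc k) * ?w ^ k * ((?z + ?w) ^ Suc 2 - ?z ^ Suc 2) * (cst 0 * ?z + cst 1 * ?w) +
          ?w ^ Suc k * (cst 1 * ((?z + ?w) ^ Suc 2 - ?z ^ Suc 2) - cst 0 * (?z + ?w) ^ Suc 2) =
          ?w ^ Suc k * (cst 0 * ?z + cst 1 * ?w) * (3 * ?d * ?z ^ 2 + 3 * ?d * (?z * ?w) + ?d * ?w ^ 2)"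
        by (simp add: algebra_simps power2_eq_square power3_eq_cube)
    qed
    show ?thesis
      unfolding kd by (rule M.witnesses) (use 1 d0 in auto)
  next
    case 2
    \<comment> \<open>As (z + w)^3 - z^3 = w^3 now, the derivative of w^(k+1) (z - w) is w^(k+1) ((k
      + 1) w^2 (z - w) - (z^3 - w^3)). Division by p0 gives q, in which z^2 has coefficient
      -1.\<close>
    interpret F: family n k 0 2 "1 :: 'k" "- 1" "- 1" "- 1" "of_nat k"
      using k1 assms(2) by unfold_locales auto
    have three: "(3 :: 'k mpoly) = 0"
      using cst_numeral[of "Num.Bit1 Num.One", where 'k='k] 2(2) by simp
    have q: "F.q = - (?z ^ 2) - ?z * ?w + of_nat k * ?w ^ 2"
      unfolding F.q_def cst_of_nat by (simp add: single_uminus)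
    have cube: "(?z + ?w) ^ Suc 2 = ?z ^ 3 + ?w ^ 3"
    proof -
      have "(?z + ?w) ^ Suc 2 = ?z ^ 3 + ?w ^ 3 + 3 * (?z * ?w * (?z + ?w))"
        by (simp add: power3_eq_cube power2_eq_square algebra_simps)
      then show ?thesis
        unfolding three by simp
    qed
    interpret M: modification n k 0 2 "1 :: 'k" "- 1" "- 1" "- 1" "of_nat k"
    proof (unfold_locales, unfold q F.p0_def cube)
      \<comment> \<open>With the cube already simplified, the two sides differ by exactly 3 w^(k+4)
        over any field, and this vanishes here.\<close>
      have "of_nat (Suc k) * ?w ^ k * (?z ^ 3 + ?w ^ 3 - ?z ^ Suc 2) * (cst 1 * ?z + cst (- 1) * ?w) +
          ?w ^ Suc k * (cst (- 1) * (?z ^ 3 + ?w ^ 3 - ?z ^ Suc 2) - cst 1 * (?z ^ 3 + ?w ^ 3)) =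
          ?w ^ Suc k * (cst 1 * ?z + cst (- 1) * ?w) * (- (?z ^ 2) - ?z * ?w + of_nat k * ?w ^ 2) - 3 * ?w ^ (k + 4)"
        by (simp add: single_uminus power_add power3_eq_cube power2_eq_square eval_nat_numeral algebra_simps)
      then show "of_nat (Suc k) * ?w ^ k * (?z ^ 3 + ?w ^ 3 - ?z ^ Suc 2) * (cst 1 * ?z + cst (- 1) * ?w) +
          ?w ^ Suc k * (cst (- 1) * (?z ^ 3 + ?w ^ 3 - ?z ^ Suc 2) - cst 1 * (?z ^ 3 + ?w ^ 3)) =
          ?w ^ Suc k * (cst 1 * ?z + cst (- 1) * ?w) * (- (?z ^ 2) - ?z * ?w + of_nat k * ?w ^ 2)"
        unfolding three by simp
    qed
    show ?thesis
      unfolding kd by (rule M.witnesses) (use 2 in auto)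
  next
    case 3
    \<comment> \<open>Here q = 3 ((z + w)^2 - z^2) / w. The coefficient 6 may vanish in
      characteristic 2; the invariant uses b + g = 3, nonzero because d = 3 is not a multiple of the
      characteristic.\<close>
    interpret F: family n k 1 1 "0 :: 'k" 1 6 3 0
      using k1 assms(2) 3 by unfold_locales auto
    have q: "F.q = 6 * ?z + 3 * ?w"
      unfolding F.q_def cst_numeral by simp
    interpret M: modification n k 1 1 "0 :: 'k" 1 6 3 0
    proof (unfold_locales, unfold q F.p0_def)
      show "of_nat (Suc k) * ?w ^ k * ((?z + ?w) ^ Suc 1 - ?z ^ Suc 1) * (cst 0 * ?z + cst 1 * ?w) +
          ?w ^ Suc k * (cst 1 * ((?z + ?w) ^ Suc 1 - ?z ^ Suc 1) - cst 0 * (?z + ?w) ^ Suc 1) =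
          ?w ^ Suc k * (cst 0 * ?z + cst 1 * ?w) * (6 * ?z + 3 * ?w)"
        unfolding 3(1) by (simp add: power2_eq_square algebra_simps)
    qed
    have "(3 :: 'k) \<noteq> 0"
      using d0 kd 3(1) by simp
    then show ?thesis
      unfolding kd by (intro M.witnesses) (use 3 in auto)
  qed
qed

end
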